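(* Let $A$ and $B$ be finite-dimensional $C^*$-algebras, and let $\varphi\colon A \to B$ be a unital completely positive map. The following are equivalent: (1) $\varphi$ is a homomorphism; (2) for all positive integers $k$ and all states $\mu$ on $M_k(B) = B \otimes M_k(\mathbb{C})$, $$\tilde S(\mu \circ (\varphi \otimes \mathrm{id})) \leq \tilde S(\mu),$$ where $\mathrm{id}$ is the identity map on $M_k(\mathbb{C})$, so that $\mu\circ(\varphi\otimes\mathrm{id})$ is a state on $A \otimes M_k(\mathbb{C})$.
   Context: $C^*$-algebras are assumed nonzero. "Homomorphism" means $*$-homomorphism; since completely positive maps are $*$-preserving, this amounts to $\varphi(ab)=\varphi(a)\varphi(b)$ for all $a,b$. Every finite-dimensional $C^*$-algebra $A$ is, up to isomorphism, $M_{n_1}(\mathbb{C}) \oplus \cdots \oplus M_{n_\ell}(\mathbb{C})$ for positive integers $n_1,\ldots,n_\ell$. Define $\mathrm{tr}\colon A\to\mathbb{C}$ by $\mathrm{tr}(a_1\oplus\cdots\oplus a_\ell)=\mathrm{tr}(a_1)+\cdots+\mathrm{tr}(a_\ell)$ (sum of the usual matrix traces), and define $\zeta_A\in A$ by $\zeta_A = n_1 1_{n_1}\oplus\cdots\oplus n_\ell 1_{n_\ell}$. A state on $A$ is a positive linear map $\mu\colon A\to\mathbb{C}$ with $\mu(1)=1$. The adjusted entropy of a state $\mu$ on $A$ is $$\tilde S(\mu) = -\mu(\log d)+\mu(\log\zeta_A),$$ where $d\in A$ is the unique operator such that $\mu(a)=\mathrm{tr}(da)$ for all $a\in A$. Here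 $\mu(\log d)=\mathrm{tr}(d\log d)$ is understood with the convention $0\log 0=0$, i.e. $d\log d$ denotes $f(d)$ with $f(t)=t\log t$ for $t>0$ and $f(0)=0$. The logarithm is taken with respect to an arbitrary fixed base (greater than $1$). *)

theory Defs
  imports
    "Jordan_Normal_Form.Schur_Decomposition"
begin

text \<open>
  A finite-dimensional C*-algebra is taken in the form of a direct sum of full complex matrix
  algebras, given by the nonempty list \<open>ns\<close> of the (positive) block sizes. An element is the list
  of its blocks. A map on such an algebra is a HOL function on lists of matrices of which only the
  values on \<open>fd_carrier ns\<close> are relevant.
\<close>

definition fd_cstar :: "nat list \<Rightarrow> bool" where
  "fd_cstar ns \<longleftrightarrow> ns \<noteq> [] \<and> (\<forall>n\<in>set ns. 0 < n)"

definition fd_carrier :: "nat list \<Rightarrow> complex mat list set" where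
  "fd_carrier ns = {a. length a = length ns \<and> (\<forall>i<length ns. a ! i \<in> carrier_mat (ns ! i) (ns ! i))}"

definition fd_one :: "nat list \<Rightarrow> complex mat list" where
  "fd_one ns = map 1\<^sub>m ns"

definition fd_add :: "complex mat list \<Rightarrow> complex mat list \<Rightarrow> complex mat list" where
  "fd_add a b = map2 (+) a b"

definition fd_mult :: "complex mat list \<Rightarrow> complex mat list \<Rightarrow> complex mat list" where
  "fd_mult a b = map2 (*) a b"

definition fd_smult :: "complex \<Rightarrow> complex mat list \<Rightarrow> complex mat list" where
  "fd_smult c a = map (\<lambda>m. c \<cdot>\<^sub>m m) a"

definition fd_star :: "complex mat list \<Rightarrow> complex mat list" where
  "fd_star a = map mat_adjoint a"

definition fd_positive :: "nat list \<Rightarrow> complex mat list \<Rightarrow> bool" where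
  "fd_positive ns a \<longleftrightarrow> (\<exists>b\<in>fd_carrier ns. a = fd_mult (fd_star b) b)"

definition fd_tr :: "complex mat list \<Rightarrow> complex" where
  "fd_tr a = (\<Sum>m\<leftarrow>a. sum_list (diag_mat m))"

definition fd_zeta :: "nat list \<Rightarrow> complex mat list" where
  "fd_zeta ns = map (\<lambda>n. of_nat n \<cdot>\<^sub>m 1\<^sub>m n) ns"

definition fd_linear_map ::
  "nat list \<Rightarrow> nat list \<Rightarrow> (complex mat list \<Rightarrow> complex mat list) \<Rightarrow> bool" where
  "fd_linear_map ns ms \<phi> \<longleftrightarrow>
     (\<forall>a\<in>fd_carrier ns. \<phi> a \<in> fd_carrier ms) \<and>
     (\<forall>a\<in>fd_carrier ns. \<forall>b\<in>fd_carrier ns. \<phi> (fd_add a b) = fd_add (\<phi> a) (\<phi> b)) \<and>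
     (\<forall>c. \<forall>a\<in>fd_carrier ns. \<phi> (fd_smult c a) = fd_smult c (\<phi> a))"

definition fd_hom ::
  "nat list \<Rightarrow> nat list \<Rightarrow> (complex mat list \<Rightarrow> complex mat list) \<Rightarrow> bool" where
  "fd_hom ns ms \<phi> \<longleftrightarrow>
     fd_linear_map ns ms \<phi> \<and>
     (\<forall>a\<in>fd_carrier ns. \<forall>b\<in>fd_carrier ns. \<phi> (fd_mult a b) = fd_mult (\<phi> a) (\<phi> b)) \<and>
     (\<forall>a\<in>fd_carrier ns. \<phi> (fd_star a) = fd_star (\<phi> a))"

text \<open>
  The algebra \<open>M\<^sub>k(A) = A \<otimes> M\<^sub>k\<close> of \<open>k \<times> k\<close> matrices over the algebra \<open>A\<close> with block sizes \<open>ns\<close>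
  has block sizes \<open>amp_sizes k ns\<close>: its \<open>i\<close>-th block, of size \<open>k n\<^sub>i\<close>, consists of \<open>k \<times> k\<close> many
  \<open>n\<^sub>i \<times> n\<^sub>i\<close> subblocks, and \<open>amp_entry ns x r s\<close>, the \<open>(r, s)\<close> entry in \<open>A\<close> of the element \<open>x\<close>,
  collects the \<open>(r, s)\<close> subblocks of all blocks. The map \<open>amp_map k ns ms \<phi>\<close> is
  \<open>\<phi> \<otimes> id\<close>, that is, \<open>\<phi>\<close> applied to each of the \<open>k \<times> k\<close> entries.
\<close>

definition amp_sizes :: "nat \<Rightarrow> nat list \<Rightarrow> nat list" where
  "amp_sizes k ns = map (\<lambda>n. k * n) ns"

definition amp_entry :: "nat list \<Rightarrow> complex mat list \<Rightarrow> nat \<Rightarrow> nat \<Rightarrow> complex mat list" where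
  "amp_entry ns x r s =
     map (\<lambda>i. mat (ns ! i) (ns ! i) (\<lambda>(p, q). (x ! i) $$ (r * (ns ! i) + p, s * (ns ! i) + q)))
       [0..<length ns]"

definition amp_map ::
  "nat \<Rightarrow> nat list \<Rightarrow> nat list \<Rightarrow> (complex mat list \<Rightarrow> complex mat list)
     \<Rightarrow> complex mat list \<Rightarrow> complex mat list" where
  "amp_map k ns ms \<phi> x =
     map (\<lambda>j. let m = ms ! j in
            mat (k * m) (k * m)
              (\<lambda>(p, q). (\<phi> (amp_entry ns x (p div m) (q div m)) ! j) $$ (p mod m, q mod m)))
       [0..<length ms]"

definition fd_completely_positive ::
  "nat list \<Rightarrow> nat list \<Rightarrow> (complex mat list \<Rightarrow> complex mat list) \<Rightarrow> bool" where
  "fd_completely_positive ns ms \<phi> \<longleftrightarrow>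
     fd_linear_map ns ms \<phi> \<and>
     (\<forall>k>0. \<forall>x. fd_positive (amp_sizes k ns) x \<longrightarrow> fd_positive (amp_sizes k ms) (amp_map k ns ms \<phi> x))"

definition fd_unital ::
  "nat list \<Rightarrow> nat list \<Rightarrow> (complex mat list \<Rightarrow> complex mat list) \<Rightarrow> bool" where
  "fd_unital ns ms \<phi> \<longleftrightarrow> \<phi> (fd_one ns) = fd_one ms"

definition fd_state :: "nat list \<Rightarrow> (complex mat list \<Rightarrow> complex) \<Rightarrow> bool" where
  "fd_state ns \<mu> \<longleftrightarrow>
     (\<forall>a\<in>fd_carrier ns. \<forall>b\<in>fd_carrier ns. \<mu> (fd_add a b) = \<mu> a + \<mu> b) \<and>
     (\<forall>c. \<forall>a\<in>fd_carrier ns. \<mu> (fd_smult c a) = c * \<mu> a) \<and>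
     (\<forall>a. fd_positive ns a \<longrightarrow> \<mu> a \<in> \<real> \<and> 0 \<le> Re (\<mu> a)) \<and>
     \<mu> (fd_one ns) = 1"

definition fd_density :: "nat list \<Rightarrow> (complex mat list \<Rightarrow> complex) \<Rightarrow> complex mat list" where
  "fd_density ns \<mu> = (THE d. d \<in> fd_carrier ns \<and> (\<forall>a\<in>fd_carrier ns. \<mu> a = fd_tr (fd_mult d a)))"

text \<open>
  Functional calculus for Hermitian matrices: if \<open>M = U D U*\<close> with \<open>U\<close> unitary and \<open>D\<close> real
  diagonal, then \<open>f(M) = U f(D) U*\<close>, independently of the diagonalization chosen.
\<close>

definition mat_fun :: "(real \<Rightarrow> real) \<Rightarrow> complex mat \<Rightarrow> complex mat" where
  "mat_fun f M = (THE X. \<exists>U e. let n = dim_row M in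
     U \<in> carrier_mat n n \<and> U * mat_adjoint U = 1\<^sub>m n \<and> mat_adjoint U * U = 1\<^sub>m n \<and>
     M = U * mat_diag n (\<lambda>i. complex_of_real (e i)) * mat_adjoint U \<and>
     X = U * mat_diag n (\<lambda>i. complex_of_real (f (e i))) * mat_adjoint U)"

definition fd_fun :: "(real \<Rightarrow> real) \<Rightarrow> complex mat list \<Rightarrow> complex mat list" where
  "fd_fun f a = map (mat_fun f) a"

definition xlogx :: "real \<Rightarrow> real \<Rightarrow> real" where
  "xlogx b t = (if 0 < t then t * log b t else 0)"

text \<open>
  The parameter \<open>b > 1\<close> is the base of the logarithm. The term \<open>\<mu>(log d)\<close> is read as the trace of
  \<open>d log d\<close>, with \<open>0 log 0 = 0\<close>. For a state, both terms are real; \<open>Re\<close> is a mere coercion.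
\<close>

definition adj_entropy :: "real \<Rightarrow> nat list \<Rightarrow> (complex mat list \<Rightarrow> complex) \<Rightarrow> real" where
  "adj_entropy b ns \<mu> =
     Re (- fd_tr (fd_fun (xlogx b) (fd_density ns \<mu>)) + \<mu> (fd_fun (log b) (fd_zeta ns)))"

end

theory Submission
  imports Defs "Jordan_Normal_Form.Spectral_Radius"
begin

text \<open>
  If the density of a state on \<open>\<Oplus>\<^sub>i M\<^bsub>n\<^sub>i\<^esub>\<close> has eigenvalues \<open>f\<^sub>i\<^sub>p\<close> in block \<open>i\<close>, then the adjusted
  entropy is \<open>- \<Sum> f\<^sub>i\<^sub>p log (f\<^sub>i\<^sub>p / n\<^sub>i)\<close> (\<open>state_spectral\<close>): it is the entropy relative to the trace of
  the regular representation. Both directions compare such sums through bounds on quotients of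
  eigenvalues and block sizes.

  A homomorphism \<open>\<phi>\<close> does not increase the adjusted entropy. Since its amplifications are again
  homomorphisms, it is enough to treat \<open>\<phi>\<close> itself. Heuristically, let \<open>d\<close> and \<open>d'\<close> be the densities of
  \<open>\<mu>\<close> and \<open>\<mu> \<circ> \<phi>\<close> relative to the traces of the regular representations; the Pimsner-Popa
  inequality is \<open>d \<le> \<phi>(d')\<close>, and monotonicity of the logarithm gives the result. The proof below
  replaces both ingredients by elementary ones. For an eigenvector \<open>u\<close> of \<open>d\<close> in a block of size \<open>m\<close>, with
  eigenvalue \<open>e\<close> relative to the usual trace, and the eigenvectors \<open>w\<^sub>i\<^sub>p\<close> belonging to \<open>f\<^sub>i\<^sub>p\<close>, the weights
  \<open>t\<^sub>i\<^sub>p = \<langle>u, \<phi>(w\<^sub>i\<^sub>p w\<^sub>i\<^sub>p*) u\<rangle>\<close> have sum 1. The inequality \<open>\<Sum> t\<^sub>i\<^sub>p n\<^sub>i / f\<^sub>i\<^sub>p \<le> m / e\<close> follows from the Welch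
  bound for the vectors \<open>\<phi>(w\<^sub>i\<^sub>p w\<^sub>i\<^sub>q*) u\<close> (\<open>hom_frame_bound\<close>) together with the domination of one vector
  functional by \<open>\<mu> \<circ> \<phi>\<close> (\<open>hom_compression_le\<close>). By concavity of the logarithm it implies
  \<open>\<Sum> t\<^sub>i\<^sub>p log (n\<^sub>i / f\<^sub>i\<^sub>p) \<le> log (m / e)\<close>, and the average over the eigenvectors \<open>u\<close> with weights \<open>e\<close> is the
  assertion (\<open>hom_entropy_le\<close>).

  Conversely, the entropy condition is applied to the maximally entangled states \<open>\<mu>\<close> on
  \<open>M\<^sub>m \<otimes> M\<^sub>m\<close>, one for each block of \<open>B\<close>, where \<open>m\<close> is the size of the block and \<open>k = m\<close>. The density of
  the pullback of \<open>\<mu>\<close> is \<open>C / m\<close>, where the Choi matrix \<open>C\<close> has the entries of the matrices \<open>\<phi>(E\<^sub>p\<^sub>q)\<close>. On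
  a block of size \<open>n\<close> of \<open>A\<close> one has \<open>C \<le> n\<close> (\<open>cp_choi_le\<close>), so every eigenvalue is at most \<open>n / m\<close> and
  the adjusted entropy of the pullback is at least \<open>log (m * m)\<close>, which is that of \<open>\<mu>\<close>. The entropy
  condition therefore forces every eigenvalue to be \<open>0\<close> or \<open>n / m\<close>, that is, \<open>C\<^sup>2 = n C\<close>, and in terms of
  \<open>\<phi>\<close> this means \<open>\<Sum>q. \<phi>(E\<^sub>p\<^sub>q) \<phi>(E\<^sub>q\<^sub>r) = n \<phi>(E\<^sub>p\<^sub>r)\<close>. For \<open>p = r\<close> this is equality in a sum of
  Schwarz inequalities, so each matrix unit lies in the multiplicative domain of \<open>\<phi>\<close>
  (\<open>cp_hom_if_choi_square\<close>).
\<close>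

section \<open>The spectral theorem and functional calculus for Hermitian matrices\<close>

lemma mat_adjoint_carrier [simp, intro]:
  "A \<in> carrier_mat n m \<Longrightarrow> mat_adjoint A \<in> carrier_mat m n"
  by (auto simp: mat_adjoint_def)

lemma mult_carrier_square [simp]:
  "A \<in> carrier_mat n n \<Longrightarrow> B \<in> carrier_mat n n \<Longrightarrow> A * B \<in> carrier_mat n n"
  by simp

lemma mat_adjoint_dim [simp]:
  "dim_row (mat_adjoint A) = dim_col A" "dim_col (mat_adjoint A) = dim_row A"
  by (auto simp: mat_adjoint_def)

lemma mat_adjoint_index [simp]:
  fixes A :: "complex mat"
  shows "i < dim_col A \<Longrightarrow> j < dim_row A \<Longrightarrow> mat_adjoint A $$ (i, j) = cnj (A $$ (j, i))"
  by (simp add: mat_adjoint_def mat_of_rows_index)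

lemma mat_mult_entry:
  "A \<in> carrier_mat n k \<Longrightarrow> B \<in> carrier_mat k m \<Longrightarrow> i < n \<Longrightarrow> j < m \<Longrightarrow>
    (A * B) $$ (i, j) = (\<Sum>l<k. A $$ (i, l) * B $$ (l, j))"
  by (auto simp: scalar_prod_def atLeast0LessThan intro!: sum.cong)

lemma mat_adjoint_mult:
  fixes A B :: "complex mat"
  assumes "A \<in> carrier_mat n k" "B \<in> carrier_mat k m"
  shows "mat_adjoint (A * B) = mat_adjoint B * mat_adjoint A"
  using assms by (intro eq_matI) (auto simp: scalar_prod_def mult.commute intro!: sum.cong)

lemma mat_adjoint_one [simp]: "mat_adjoint (1\<^sub>m n :: complex mat) = 1\<^sub>m n"
  by (intro eq_matI) auto

definition unitary_mat :: "nat \<Rightarrow> complex mat \<Rightarrow> bool" where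
  "unitary_mat n U \<longleftrightarrow>
     U \<in> carrier_mat n n \<and> U * mat_adjoint U = 1\<^sub>m n \<and> mat_adjoint U * U = 1\<^sub>m n"

lemma unitary_mat_mult:
  assumes "unitary_mat n U" "unitary_mat n V"
  shows "unitary_mat n (U * V)"
proof -
  have c: "U \<in> carrier_mat n n" "V \<in> carrier_mat n n" 
    "mat_adjoint U \<in> carrier_mat n n" "mat_adjoint V \<in> carrier_mat n n"
    using assms by (auto simp: unitary_mat_def)
  have "U * V * mat_adjoint (U * V) = U * (V * mat_adjoint V) * mat_adjoint U"
    using c by (simp add: mat_adjoint_mult[OF c(1,2)] assoc_mult_mat[of _ n n _ n _ n])
  moreover have "mat_adjoint (U * V) * (U * V) = mat_adjoint V * (mat_adjoint U * U) * V"
    using c by (simp add: mat_adjoint_mult[OF c(1,2)] assoc_mult_mat[of _ n n _ n _ n])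
  ultimately show ?thesis
    using assms c by (simp add: unitary_mat_def)
qed

text \<open>
  The reflection along \<open>w = v + \<theta> e\<close>, where \<open>e\<close> is the last basis vector and \<open>\<theta>\<close> a unit scalar. It
  replaces the completion of \<open>v\<close> to an orthonormal basis.
\<close>

lemma householder_reflection:
  fixes v :: "complex vec"
  assumes v: "v \<in> carrier_vec (Suc n)" and v1: "(\<Sum>i<Suc n. v $ i * cnj (v $ i)) = 1"
  obtains H c where "H \<in> carrier_mat (Suc n) (Suc n)" "mat_adjoint H = H" "H * H = 1\<^sub>m (Suc n)"
    "c \<noteq> 0" "\<And>i. i < Suc n \<Longrightarrow> H $$ (i, n) = c * v $ i"
proof -
  \<comment> \<open>With the phase of \<open>v $ n\<close> in \<open>\<theta>\<close> no cancellation occurs: \<open>\<langle>w, v\<rangle> = N\<close> and \<open>\<langle>w, w\<rangle> = 2 N\<close>, where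
    \<open>N\<close> is at least 1. So the reflection is \<open>1 - w w* / N\<close>, and it maps \<open>v\<close> to \<open>- \<theta> e\<close>.\<close>
  define \<theta> where "\<theta> = (if v $ n = 0 then 1 else v $ n / cmod (v $ n))"
  have nsq: "z * cnj z = complex_of_real (cmod z) * complex_of_real (cmod z)" for z
    using complex_norm_square[of z] by (simp add: power2_eq_square)
  have "cmod \<theta> = 1" by (simp add: \<theta>_def norm_divide)
  hence \<theta>1: "\<theta> * cnj \<theta> = 1" by (simp add: nsq)
  have \<theta>v: "cnj \<theta> * v $ n = cmod (v $ n)"
    using nsq[of "v $ n"] by (simp add: \<theta>_def mult.commute[of "cnj _"])
  hence \<theta>v': "\<theta> * cnj (v $ n) = cmod (v $ n)"
    by (metis complex_cnj_cnj complex_cnj_complex_of_real complex_cnj_mult)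
  define N where "N = 1 + complex_of_real (cmod (v $ n))"
  have N0: "N \<noteq> 0"
    unfolding N_def by (metis add_cancel_right_left add_nonneg_eq_0_iff norm_ge_zero of_real_1 of_real_add
        of_real_eq_0_iff zero_le_one zero_neq_one)
  define w where "w i = v $ i + (if i = n then \<theta> else 0)" for i
  have wv: "(\<Sum>i<Suc n. cnj (w i) * v $ i) = N"
    using v1 \<theta>v by (simp add: w_def algebra_simps sum.distrib N_def lessThan_Suc)
  have ww: "(\<Sum>i<Suc n. cnj (w i) * w i) = 2 * N"
  proof -
    have "(\<Sum>i<Suc n. cnj (w i) * w i) = (\<Sum>i<Suc n. cnj (w i) * v $ i) + cnj (w n) * \<theta>"
      by (simp add: w_def algebra_simps)
    also have "cnj (w n) * \<theta> = N"
      using \<theta>1 \<theta>v' by (simp add: w_def N_def algebra_simps)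
    finally show ?thesis using wv by simp
  qed
  define \<beta> where "\<beta> = inverse N"
  have \<beta>N: "\<beta> * N = 1" using N0 by (simp add: \<beta>_def)
  define H where "H = mat (Suc n) (Suc n) (\<lambda>(i, j). (if i = j then 1 else 0) - w i * cnj (w j) * \<beta>)"
  have \<beta>c: "cnj \<beta> = \<beta>" by (simp add: \<beta>_def N_def)
  show thesis
  proof (rule that)
    show H: "H \<in> carrier_mat (Suc n) (Suc n)" by (simp add: H_def)
    show "mat_adjoint H = H"
      by (intro eq_matI) (simp_all add: H_def \<beta>c mult_ac)
    show "H * H = 1\<^sub>m (Suc n)"
    proof (rule eq_matI, goal_cases)
      case (1 i j)
      hence ij: "i < Suc n" "j < Suc n" by auto
      have "(H * H) $$ (i, j) = (\<Sum>l<Suc n. ((if i = l then 1 else 0) - w i * cnj (w l) * \<beta>) *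
          ((if l = j then 1 else 0) - w l * cnj (w j) * \<beta>))"
        using ij by (subst mat_mult_entry[OF H H ij]) (simp add: H_def del: sum.lessThan_Suc)
      also have "\<dots> = (\<Sum>l<Suc n. (if i = l then (if l = j then 1 else 0) - w l * cnj (w j) * \<beta> else 0)
           - (if l = j then w i * cnj (w l) * \<beta> else 0)
           + (w i * cnj (w j) * (\<beta> * \<beta>)) * (cnj (w l) * w l))"
        by (rule sum.cong[OF refl]) (simp add: left_diff_distrib right_diff_distrib mult_ac)
      also have "\<dots> = (if i = j then 1 else 0) - w i * cnj (w j) * \<beta> - w i * cnj (w j) * \<beta>
          + (w i * cnj (w j) * (\<beta> * \<beta>)) * (2 * N)"
        unfolding sum.distrib sum_subtractf sum_distrib_left[symmetric] ww
        using ij by (simp add: sum.delta sum.delta' del: sum.lessThan_Suc)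
      also have "(w i * cnj (w j) * (\<beta> * \<beta>)) * (2 * N) = 2 * (w i * cnj (w j) * \<beta>) * (\<beta> * N)"
        by (simp only: mult_ac)
      also have "(if i = j then 1 else 0) - w i * cnj (w j) * \<beta> - w i * cnj (w j) * \<beta> + \<dots>
          = (if i = j then 1 else 0)"
        unfolding \<beta>N by simp
      finally show ?case using ij by simp
    qed (simp_all add: H_def)
    show "- cnj \<theta> \<noteq> 0" using \<theta>1 by auto
    show "H $$ (i, n) = - cnj \<theta> * v $ i" if "i < Suc n" for i
    proof -
      have "cnj \<theta> * N = cnj \<theta> + (\<theta> * cnj \<theta>) * cnj (v $ n)"
        unfolding N_def \<theta>v'[symmetric] by (simp only: distrib_left mult_ac mult_1_left mult_1_right)
      hence "cnj (w n) = cnj \<theta> * N" unfolding \<theta>1 by (simp add: w_def)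
      hence "H $$ (i, n) = (if i = n then 1 else 0) - w i * cnj \<theta>"
        using that \<beta>N by (simp add: H_def mult_ac)
      also have "\<dots> = (if i = n then 1 - \<theta> * cnj \<theta> else 0) - cnj \<theta> * v $ i"
        by (simp add: w_def ring_distribs mult.commute)
      finally show ?thesis by (simp add: \<theta>1)
    qed
  qed
qed

lemma four_block_diag_mult:
  assumes "A \<in> carrier_mat n n" "B \<in> carrier_mat n n"
  shows "four_block_mat A (0\<^sub>m n 1) (0\<^sub>m 1 n) (c \<cdot>\<^sub>m 1\<^sub>m 1)
       * four_block_mat B (0\<^sub>m n 1) (0\<^sub>m 1 n) (d \<cdot>\<^sub>m 1\<^sub>m 1)
       = four_block_mat (A * B) (0\<^sub>m n 1) (0\<^sub>m 1 n) ((c * d :: complex) \<cdot>\<^sub>m 1\<^sub>m 1)"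
proof -
  have "(c \<cdot>\<^sub>m 1\<^sub>m 1) * (d \<cdot>\<^sub>m 1\<^sub>m 1) = ((c * d) \<cdot>\<^sub>m 1\<^sub>m 1 :: complex mat)"
    by (intro eq_matI) (auto simp: scalar_prod_def)
  moreover have "A * B \<in> carrier_mat n n" using assms by simp
  ultimately show ?thesis
    using assms by (subst mult_four_block_mat[of _ n n _ 1 _ 1 _ _ n _ 1]) auto
qed

text \<open>
  Conjugating with the reflection that carries the last basis vector to an eigenvector turns \<open>A\<close> into a
  block matrix with a Hermitian block of size \<open>n\<close> and the (real) eigenvalue as last entry, to which the
  induction hypothesis applies.
\<close>

theorem hermitian_unitarily_diagonalizable:
  fixes A :: "complex mat"
  assumes "A \<in> carrier_mat n n" and "mat_adjoint A = A"
  shows "\<exists>U e. unitary_mat n U \<and>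
           A = U * mat_diag n (\<lambda>i. complex_of_real (e i)) * mat_adjoint U"
  using assms
proof (induction n arbitrary: A)
  case 0
  then show ?case
    by (intro exI[of _ "1\<^sub>m 0"] exI[of _ "\<lambda>_. 0"]) (auto simp: unitary_mat_def)
next
  case (Suc n)
  note A = Suc.prems(1) and AA = Suc.prems(2)
  let ?N = "Suc n"
  obtain l where "l \<in> spectrum A" using spectrum_non_empty[OF A] by auto
  then obtain v0 where "eigenvector A v0 l"
    by (auto simp: spectrum_def eigenvalue_def)
  hence v0: "v0 \<in> carrier_vec ?N" "v0 \<noteq> 0\<^sub>v ?N" "A *\<^sub>v v0 = l \<cdot>\<^sub>v v0"
    using A by (auto simp: eigenvector_def)
  define r where "r = (\<Sum>i<?N. (cmod (v0 $ i))\<^sup>2)"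
  have "\<exists>i<?N. v0 $ i \<noteq> 0" using v0(1,2) by (metis carrier_vecD eq_vecI index_zero_vec(1) zero_carrier_vec)
  then obtain i0 where "i0 < ?N" "v0 $ i0 \<noteq> 0" by auto
  hence r0: "r > 0" unfolding r_def by (intro sum_pos2[of _ i0]) auto
  define v where "v = complex_of_real (1 / sqrt r) \<cdot>\<^sub>v v0"
  have v: "v \<in> carrier_vec ?N" using v0 by (simp add: v_def)
  have Av: "A *\<^sub>v v = l \<cdot>\<^sub>v v"
    using A v0 by (simp add: v_def mult_mat_vec smult_smult_assoc mult.commute)
  have "(\<Sum>i<?N. v $ i * cnj (v $ i)) = (\<Sum>i<?N. complex_of_real (1 / r * (cmod (v0 $ i))\<^sup>2))"
  proof (intro sum.cong refl)
    fix i assume i: "i \<in> {..<?N}"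
    have "complex_of_real (1 / sqrt r) * complex_of_real (1 / sqrt r) = complex_of_real (1 / r)"
      using r0 by (simp flip: of_real_mult)
    moreover have "v $ i * cnj (v $ i) =
        (complex_of_real (1 / sqrt r) * complex_of_real (1 / sqrt r)) * (v0 $ i * cnj (v0 $ i))"
      using i v0 by (simp add: v_def)
    ultimately show "v $ i * cnj (v $ i) = complex_of_real (1 / r * (cmod (v0 $ i))\<^sup>2)"
      using complex_norm_square[of "v0 $ i"] by simp
  qed
  also have "\<dots> = complex_of_real (1 / r * r)"
    unfolding r_def sum_distrib_left of_real_sum ..
  finally have v1: "(\<Sum>i<?N. v $ i * cnj (v $ i)) = 1" using r0 by simp
  obtain H c where H: "H \<in> carrier_mat ?N ?N" and HH: "mat_adjoint H = H" and H2: "H * H = 1\<^sub>m ?N"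
    and c: "c \<noteq> 0" and Hn: "\<And>i. i < ?N \<Longrightarrow> H $$ (i, n) = c * v $ i"
    using householder_reflection[OF v v1] by blast
  have uH: "unitary_mat ?N H" using H HH H2 by (simp add: unitary_mat_def)
  define B where "B = H * A * H"
  have B: "B \<in> carrier_mat ?N ?N" using H A by (simp add: B_def)
  have BB: "mat_adjoint B = B"
    using A H by (simp add: B_def mat_adjoint_mult[of _ ?N ?N _ ?N] AA HH assoc_mult_mat[of _ ?N ?N _ ?N _ ?N])
  have A_B: "A = H * B * H"
  proof -
    have "H * B * H = (H * H) * A * (H * H)"
      using A H by (simp add: B_def assoc_mult_mat[of _ ?N ?N _ ?N _ ?N])
    thus ?thesis using A H2 by simp
  qed
  \<comment> \<open>The last column of \<open>H\<close> is an eigenvector of \<open>A\<close>, so the last column of \<open>B\<close> is \<open>l\<close> times that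
    of the identity.\<close>
  have Bn: "B $$ (i, n) = (if i = n then l else 0)" if i: "i < ?N" for i
  proof -
    have AH: "(A * H) $$ (k, n) = l * H $$ (k, n)" if k: "k < ?N" for k
    proof -
      have "(A * H) $$ (k, n) = (\<Sum>j<?N. A $$ (k, j) * (c * v $ j))"
        unfolding mat_mult_entry[OF A H k lessI] by (intro sum.cong refl) (simp add: Hn)
      also have "\<dots> = c * (\<Sum>j<?N. A $$ (k, j) * v $ j)"
        by (simp only: sum_distrib_left mult.left_commute)
      also have "(\<Sum>j<?N. A $$ (k, j) * v $ j) = (A *\<^sub>v v) $ k"
        using A v k by (simp add: scalar_prod_def atLeast0LessThan del: sum.lessThan_Suc)
      also have "\<dots> = l * v $ k" using k v unfolding Av by simp
      finally show ?thesis unfolding Hn[OF k] by (simp only: mult.left_commute)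
    qed
    have "B $$ (i, n) = (H * (A * H)) $$ (i, n)"
      unfolding B_def assoc_mult_mat[OF H A H] ..
    also have "\<dots> = (\<Sum>k<?N. H $$ (i, k) * (l * H $$ (k, n)))"
      unfolding mat_mult_entry[OF H mult_carrier_square[OF A H] i lessI]
      by (intro sum.cong refl) (simp only: AH lessThan_iff)
    also have "\<dots> = l * (H * H) $$ (i, n)"
      unfolding mat_mult_entry[OF H H i lessI] by (simp only: sum_distrib_left mult.left_commute)
    finally show ?thesis using i unfolding H2 by simp
  qed
  have Bcnj: "B $$ (i, j) = cnj (B $$ (j, i))" if "i < ?N" "j < ?N" for i j
  proof -
    have "mat_adjoint B $$ (i, j) = cnj (B $$ (j, i))"
      using that B by (intro mat_adjoint_index) auto
    thus ?thesis unfolding BB .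
  qed
  have "l = cnj l" using Bcnj[OF lessI lessI] unfolding Bn[OF lessI] by simp
  hence "l = complex_of_real (Re l)" by (cases l) (simp add: complex_eq_iff)
  then obtain lr where l: "l = complex_of_real lr" ..
  have Bn': "B $$ (n, j) = (if j = n then l else 0)" if "j < ?N" for j
    unfolding Bcnj[OF lessI that] using Bn[OF that] l by simp
  define C where "C = mat n n (\<lambda>(i, j). B $$ (i, j))"
  have C: "C \<in> carrier_mat n n" "mat_adjoint C = C"
    by (auto simp: C_def intro!: eq_matI Bcnj[symmetric])
  obtain V e where V: "unitary_mat n V" 
    and CV: "C = V * mat_diag n (\<lambda>i. complex_of_real (e i)) * mat_adjoint V"
    using Suc.IH[OF C] by blast
  have Vc: "V \<in> carrier_mat n n" using V by (simp add: unitary_mat_def)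
  define W where "W = four_block_mat V (0\<^sub>m n 1) (0\<^sub>m 1 n) (1 \<cdot>\<^sub>m 1\<^sub>m 1)"
  define f where "f i = (if i < n then e i else lr)" for i
  have W: "W \<in> carrier_mat ?N ?N" 
    unfolding W_def using four_block_carrier_mat[OF Vc, of "1 \<cdot>\<^sub>m 1\<^sub>m 1" 1 1] by simp
  have Va: "mat_adjoint V \<in> carrier_mat n n" using Vc by simp
  have Wadj: "mat_adjoint W = four_block_mat (mat_adjoint V) (0\<^sub>m n 1) (0\<^sub>m 1 n) (1 \<cdot>\<^sub>m 1\<^sub>m 1)"
    using Vc by (intro eq_matI) (auto simp: W_def)
  have D: "mat_diag ?N (\<lambda>i. complex_of_real (f i)) =
      four_block_mat (mat_diag n (\<lambda>i. complex_of_real (e i))) (0\<^sub>m n 1) (0\<^sub>m 1 n) (l \<cdot>\<^sub>m 1\<^sub>m 1)"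
    using l by (intro eq_matI) (auto simp: mat_diag_def f_def less_Suc_eq)
  have one: "four_block_mat (1\<^sub>m n) (0\<^sub>m n 1) (0\<^sub>m 1 n) (1 \<cdot>\<^sub>m 1\<^sub>m 1) = (1\<^sub>m ?N :: complex mat)"
    by (intro eq_matI) auto
  have uW: "unitary_mat ?N W"
    using W V unfolding unitary_mat_def Wadj unfolding W_def
      four_block_diag_mult[OF Vc Va] four_block_diag_mult[OF Va Vc]
    by (simp only: one mult_1_left)
  have "B = four_block_mat C (0\<^sub>m n 1) (0\<^sub>m 1 n) (l \<cdot>\<^sub>m 1\<^sub>m 1)"
    using B Bn Bn' by (intro eq_matI) (auto simp: C_def less_Suc_eq)
  also have "\<dots> = W * mat_diag ?N (\<lambda>i. complex_of_real (f i)) * mat_adjoint W"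
    unfolding Wadj unfolding D CV W_def
    using four_block_diag_mult[OF Vc mat_diag_dim[of n "\<lambda>i. complex_of_real (e i)"], of 1 l]
      four_block_diag_mult[OF mult_carrier_square[OF Vc mat_diag_dim[of n "\<lambda>i. complex_of_real (e i)"]] Va, of l 1]
    by (simp only: mult_1_left mult_1_right)
  finally have BW: "B = W * mat_diag ?N (\<lambda>i. complex_of_real (f i)) * mat_adjoint W" .
  have "A = (H * W) * mat_diag ?N (\<lambda>i. complex_of_real (f i)) * mat_adjoint (H * W)"
    unfolding A_B BW using H W HH
    by (simp add: mat_adjoint_mult[of _ ?N ?N _ ?N] assoc_mult_mat[of _ ?N ?N _ ?N _ ?N])
  thus ?case using unitary_mat_mult[OF uH uW] by (intro exI[of _ "H * W"] exI[of _ f] conjI)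
qed

text \<open>
  The description that defines the functional calculus has a unique solution: if \<open>U D U*\<close> and
  \<open>V E V*\<close> agree, then \<open>W = V* U\<close> satisfies \<open>E W = W D\<close>, so \<open>W\<close> has nonzero entries only where the
  diagonal entries of \<open>E\<close> and \<open>D\<close> coincide, and hence \<open>f(E) W = W f(D)\<close>.
\<close>

lemma mat_fun_unitary_diag:
  assumes U: "unitary_mat n U"
  shows "mat_fun f (U * mat_diag n (\<lambda>i. complex_of_real (e i)) * mat_adjoint U)
       = U * mat_diag n (\<lambda>i. complex_of_real (f (e i))) * mat_adjoint U"
proof -
  define M where "M = U * mat_diag n (\<lambda>i. complex_of_real (e i)) * mat_adjoint U"
  have Uc: "U \<in> carrier_mat n n" using U by (simp add: unitary_mat_def)
  have dM: "dim_row M = n" using Uc by (simp add: M_def)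
  have uniq: "V * mat_diag n (\<lambda>i. complex_of_real (f (d i))) * mat_adjoint V
      = U * mat_diag n (\<lambda>i. complex_of_real (f (e i))) * mat_adjoint U"
    if V: "unitary_mat n V" and MV: "M = V * mat_diag n (\<lambda>i. complex_of_real (d i)) * mat_adjoint V"
    for V d
  proof -
    have Vc: "V \<in> carrier_mat n n" using V by (simp add: unitary_mat_def)
    have ids: "V * mat_adjoint V = 1\<^sub>m n" "mat_adjoint V * V = 1\<^sub>m n" 
      "U * mat_adjoint U = 1\<^sub>m n" "mat_adjoint U * U = 1\<^sub>m n"
      using U V by (auto simp: unitary_mat_def)
    note assoc = assoc_mult_mat[of _ n n _ n _ n]
    define W where "W = mat_adjoint V * U"
    have W: "W \<in> carrier_mat n n" using Uc Vc by (simp add: W_def)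
    have conj: "mat_adjoint V * (V * X * mat_adjoint V) * U = X * W"
      "mat_adjoint V * (U * X * mat_adjoint U) * U = W * X" 
      "V * (X * W) * mat_adjoint U = V * X * mat_adjoint V" if X: "X \<in> carrier_mat n n" for X
    proof -
      have "mat_adjoint V * (V * X * mat_adjoint V) * U = (mat_adjoint V * V) * X * (mat_adjoint V * U)"
        using Uc Vc X by (simp add: assoc)
      thus "mat_adjoint V * (V * X * mat_adjoint V) * U = X * W" using X by (simp add: ids W_def)
      have "mat_adjoint V * (U * X * mat_adjoint U) * U = mat_adjoint V * U * X * (mat_adjoint U * U)"
        using Uc Vc X by (simp add: assoc)
      thus "mat_adjoint V * (U * X * mat_adjoint U) * U = W * X" using X Uc Vc by (simp add: ids W_def)
      have "V * (X * W) * mat_adjoint U = V * X * mat_adjoint V * (U * mat_adjoint U)"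
        using Uc Vc X by (simp add: assoc W_def)
      thus "V * (X * W) * mat_adjoint U = V * X * mat_adjoint V" using X Uc Vc by (simp add: ids)
    qed
    have "mat_diag n (\<lambda>i. complex_of_real (d i)) * W = W * mat_diag n (\<lambda>i. complex_of_real (e i))"
      using conj(1)[OF mat_diag_dim, of "\<lambda>i. complex_of_real (d i)"] 
        conj(2)[OF mat_diag_dim, of "\<lambda>i. complex_of_real (e i)"] MV M_def by metis
    hence ent: "complex_of_real (d i) * W $$ (i, j) = W $$ (i, j) * complex_of_real (e j)"
      if "i < n" "j < n" for i j
      using that W by (simp add: mat_diag_mult_left[OF W] mat_diag_mult_right[OF W] mat_eq_iff)
    have "complex_of_real (f (d i)) * W $$ (i, j) = W $$ (i, j) * complex_of_real (f (e j))"
      if "i < n" "j < n" for i j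
      using ent[OF that] by (cases "W $$ (i, j) = 0") auto
    hence fW: "mat_diag n (\<lambda>i. complex_of_real (f (d i))) * W = W * mat_diag n (\<lambda>i. complex_of_real (f (e i)))"
      using W by (simp add: mat_diag_mult_left[OF W] mat_diag_mult_right[OF W] mat_eq_iff)
    have "V * mat_diag n (\<lambda>i. complex_of_real (f (d i))) * mat_adjoint V 
        = V * (W * mat_diag n (\<lambda>i. complex_of_real (f (e i)))) * mat_adjoint U"
      using conj(3)[OF mat_diag_dim, of "\<lambda>i. complex_of_real (f (d i))"] fW by simp
    also have "\<dots> = (V * mat_adjoint V) * U * mat_diag n (\<lambda>i. complex_of_real (f (e i))) * mat_adjoint U"
      using Uc Vc by (simp add: assoc W_def)
    finally show ?thesis using Uc by (simp add: ids)
  qed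
  have "mat_fun f M = U * mat_diag n (\<lambda>i. complex_of_real (f (e i))) * mat_adjoint U"
    unfolding mat_fun_def Let_def dM
  proof (rule the_equality, goal_cases)
    case 1
    then show ?case using U unfolding unitary_mat_def M_def by blast
  next
    case (2 X)
    then show ?case using uniq unfolding unitary_mat_def by blast
  qed
  thus ?thesis by (simp add: M_def)
qed

section \<open>Entries, matrix units and linear functionals\<close>

definition fd_of_entries :: "nat list \<Rightarrow> (nat \<Rightarrow> nat \<Rightarrow> nat \<Rightarrow> complex) \<Rightarrow> complex mat list" where
  "fd_of_entries ns f = map (\<lambda>i. mat (ns ! i) (ns ! i) (\<lambda>(p, q). f i p q)) [0..<length ns]"

lemma fd_of_entries_carrier [simp, intro]: "fd_of_entries ns f \<in> fd_carrier ns"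
  by (auto simp: fd_of_entries_def fd_carrier_def)

lemma fd_add_carrier [simp, intro]:
  "a \<in> fd_carrier ns \<Longrightarrow> b \<in> fd_carrier ns \<Longrightarrow> fd_add a b \<in> fd_carrier ns"
  by (auto simp: fd_add_def fd_carrier_def)

lemma fd_mult_carrier [simp, intro]:
  "a \<in> fd_carrier ns \<Longrightarrow> b \<in> fd_carrier ns \<Longrightarrow> fd_mult a b \<in> fd_carrier ns"
  by (auto simp: fd_mult_def fd_carrier_def)

lemma fd_star_carrier [simp, intro]: "a \<in> fd_carrier ns \<Longrightarrow> fd_star a \<in> fd_carrier ns"
  by (auto simp: fd_star_def fd_carrier_def)

lemma fd_smult_carrier [simp, intro]: "a \<in> fd_carrier ns \<Longrightarrow> fd_smult c a \<in> fd_carrier ns"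
  by (auto simp: fd_smult_def fd_carrier_def)

lemma fd_one_carrier [simp, intro]: "fd_one ns \<in> fd_carrier ns"
  by (auto simp: fd_one_def fd_carrier_def)

lemma length_amp_sizes [simp]: "length (amp_sizes k ns) = length ns"
  by (simp add: amp_sizes_def)

lemma nth_amp_sizes [simp]: "i < length ns \<Longrightarrow> amp_sizes k ns ! i = k * ns ! i"
  by (simp add: amp_sizes_def)

lemma amp_entry_carrier [simp, intro]: "amp_entry ns x r s \<in> fd_carrier ns"
  by (auto simp: amp_entry_def fd_carrier_def)

lemma amp_map_carrier [simp, intro]: "amp_map k ns ms \<phi> x \<in> fd_carrier (amp_sizes k ms)"
  by (auto simp: amp_map_def fd_carrier_def Let_def)

lemma fd_carrier_nth: "a \<in> fd_carrier ns \<Longrightarrow> i < length ns \<Longrightarrow> a ! i \<in> carrier_mat (ns ! i) (ns ! i)"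
  by (simp add: fd_carrier_def)

lemma fd_carrier_dim [simp]:
  "a \<in> fd_carrier ns \<Longrightarrow> i < length ns \<Longrightarrow> dim_row (a ! i) = ns ! i"
  "a \<in> fd_carrier ns \<Longrightarrow> i < length ns \<Longrightarrow> dim_col (a ! i) = ns ! i"
  by (auto simp: fd_carrier_def)

lemma fd_carrier_length [simp]: "a \<in> fd_carrier ns \<Longrightarrow> length a = length ns"
  by (simp add: fd_carrier_def)

lemma fd_eqI:
  assumes "a \<in> fd_carrier ns" "b \<in> fd_carrier ns"
    and "\<And>i p q. i < length ns \<Longrightarrow> p < ns ! i \<Longrightarrow> q < ns ! i \<Longrightarrow> a ! i $$ (p, q) = b ! i $$ (p, q)"
  shows "a = b"
  using assms by (intro nth_equalityI eq_matI) auto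

lemma fd_of_entries_entry [simp]:
  "i < length ns \<Longrightarrow> p < ns ! i \<Longrightarrow> q < ns ! i \<Longrightarrow> fd_of_entries ns f ! i $$ (p, q) = f i p q"
  by (simp add: fd_of_entries_def)

lemma fd_add_entry [simp]:
  "a \<in> fd_carrier ns \<Longrightarrow> b \<in> fd_carrier ns \<Longrightarrow> i < length ns \<Longrightarrow> p < ns ! i \<Longrightarrow> q < ns ! i \<Longrightarrow>
    fd_add a b ! i $$ (p, q) = a ! i $$ (p, q) + b ! i $$ (p, q)"
  by (simp add: fd_add_def)

lemma fd_smult_entry [simp]:
  "a \<in> fd_carrier ns \<Longrightarrow> i < length ns \<Longrightarrow> p < ns ! i \<Longrightarrow> q < ns ! i \<Longrightarrow>
    fd_smult c a ! i $$ (p, q) = c * a ! i $$ (p, q)"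
  by (simp add: fd_smult_def)

lemma fd_star_entry [simp]:
  "a \<in> fd_carrier ns \<Longrightarrow> i < length ns \<Longrightarrow> p < ns ! i \<Longrightarrow> q < ns ! i \<Longrightarrow>
    fd_star a ! i $$ (p, q) = cnj (a ! i $$ (q, p))"
  by (simp add: fd_star_def)

lemma fd_one_entry [simp]:
  "i < length ns \<Longrightarrow> p < ns ! i \<Longrightarrow> q < ns ! i \<Longrightarrow>
    fd_one ns ! i $$ (p, q) = (if p = q then 1 else 0)"
  by (simp add: fd_one_def)

lemma fd_mult_entry:
  assumes "a \<in> fd_carrier ns" "b \<in> fd_carrier ns" "i < length ns" "p < ns ! i" "q < ns ! i"
  shows "fd_mult a b ! i $$ (p, q) = (\<Sum>r<ns ! i. a ! i $$ (p, r) * b ! i $$ (r, q))"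
proof -
  have "fd_mult a b ! i = a ! i * b ! i"
    using assms by (simp add: fd_mult_def)
  thus ?thesis
    using mat_mult_entry[OF fd_carrier_nth[OF assms(1,3)] fd_carrier_nth[OF assms(2,3)] assms(4,5)]
    by simp
qed

lemma fd_tr_mult:
  assumes "a \<in> fd_carrier ns" "b \<in> fd_carrier ns"
  shows "fd_tr (fd_mult a b) =
    (\<Sum>i<length ns. \<Sum>p<ns ! i. \<Sum>q<ns ! i. a ! i $$ (p, q) * b ! i $$ (q, p))"
proof -
  have c: "fd_mult a b \<in> fd_carrier ns" using assms by simp
  have "fd_tr (fd_mult a b) = (\<Sum>i<length ns. sum_list (diag_mat (fd_mult a b ! i)))"
    using c by (simp add: fd_tr_def sum_list_sum_nth atLeast0LessThan)
  also have "\<dots> = (\<Sum>i<length ns. \<Sum>p<ns ! i. fd_mult a b ! i $$ (p, p))"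
    using c by (intro sum.cong refl) (simp add: diag_mat_def sum_list_sum_nth atLeast0LessThan)
  also have "\<dots> = (\<Sum>i<length ns. \<Sum>p<ns ! i. \<Sum>q<ns ! i. a ! i $$ (p, q) * b ! i $$ (q, p))"
    using assms by (intro sum.cong refl) (simp add: fd_mult_entry)
  finally show ?thesis .
qed

definition fd_functional :: "nat list \<Rightarrow> (complex mat list \<Rightarrow> complex) \<Rightarrow> bool" where
  "fd_functional ns L \<longleftrightarrow>
     (\<forall>a\<in>fd_carrier ns. \<forall>b\<in>fd_carrier ns. L (fd_add a b) = L a + L b) \<and>
     (\<forall>c. \<forall>a\<in>fd_carrier ns. L (fd_smult c a) = c * L a)"

text \<open>
  Addition is given as a binary operation on lists of matrices; this is the form in which linear
  functionals are applied to finite sums, described by their entries.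
\<close>

lemma fd_functional_sum:
  assumes L: "fd_functional ns L" and "finite T"
    and "a \<in> fd_carrier ns" and b: "\<And>t. t \<in> T \<Longrightarrow> b t \<in> fd_carrier ns"
    and "\<And>i p q. i < length ns \<Longrightarrow> p < ns ! i \<Longrightarrow> q < ns ! i \<Longrightarrow>
           a ! i $$ (p, q) = (\<Sum>t\<in>T. c t * b t ! i $$ (p, q))"
  shows "L a = (\<Sum>t\<in>T. c t * L (b t))"
  using assms(2-)
proof (induction T arbitrary: a rule: finite_induct)
  case empty
  have "a = fd_smult 0 a"
    using empty by (intro fd_eqI[of _ ns]) simp_all
  hence "L a = 0 * L a" using L empty(1) unfolding fd_functional_def by metis
  thus ?case by simp
next
  case (insert t T)
  define a' where "a' = fd_of_entries ns (\<lambda>i p q. \<Sum>s\<in>T. c s * b s ! i $$ (p, q))"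
  have bt: "b t \<in> fd_carrier ns" using insert by simp
  have a': "a' \<in> fd_carrier ns" by (simp add: a'_def)
  have La': "L a' = (\<Sum>s\<in>T. c s * L (b s))"
    using insert.prems by (intro insert.IH) (simp_all add: a'_def)
  have "a = fd_add (fd_smult (c t) (b t)) a'"
    using bt a' insert.prems(1,3) insert.hyps
    by (intro fd_eqI[of _ ns]) (simp_all add: a'_def fd_add_entry[of _ ns])
  hence "L a = L (fd_smult (c t) (b t)) + L a'"
    using L bt a' unfolding fd_functional_def by (metis fd_smult_carrier)
  also have "L (fd_smult (c t) (b t)) = c t * L (b t)"
    using L bt unfolding fd_functional_def by blast
  finally show ?case using La' insert.hyps by simp
qed

definition fd_unit :: "nat list \<Rightarrow> nat \<Rightarrow> nat \<Rightarrow> nat \<Rightarrow> complex mat list" where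
  "fd_unit ns i p q = fd_of_entries ns (\<lambda>i' p' q'. if i' = i \<and> p' = p \<and> q' = q then 1 else 0)"

lemma fd_unit_carrier [simp, intro]: "fd_unit ns i p q \<in> fd_carrier ns"
  by (simp add: fd_unit_def)

lemma fd_unit_entry [simp]:
  "i' < length ns \<Longrightarrow> p' < ns ! i' \<Longrightarrow> q' < ns ! i' \<Longrightarrow>
     fd_unit ns i p q ! i' $$ (p', q') = (if i' = i \<and> p' = p \<and> q' = q then 1 else 0)"
  by (simp add: fd_unit_def)

lemma fd_functional_expand:
  assumes L: "fd_functional ns L" and a: "a \<in> fd_carrier ns"
  shows "L a = (\<Sum>i<length ns. \<Sum>p<ns ! i. \<Sum>q<ns ! i. a ! i $$ (p, q) * L (fd_unit ns i p q))"
proof -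
  let ?T = "SIGMA i:{..<length ns}. {..<ns ! i} \<times> {..<ns ! i}"
  have "L a = (\<Sum>t\<in>?T. (case t of (i, p, q) \<Rightarrow> a ! i $$ (p, q)) * L (case t of (i, p, q) \<Rightarrow> fd_unit ns i p q))"
  proof (rule fd_functional_sum[OF L _ a])
    fix i p q assume i: "i < length ns" "p < ns ! i" "q < ns ! i"
    have "(\<Sum>t\<in>?T. (case t of (i, p, q) \<Rightarrow> a ! i $$ (p, q)) *
            (case t of (i, p, q) \<Rightarrow> fd_unit ns i p q) ! i $$ (p, q))
        = (\<Sum>t\<in>?T. if t = (i, p, q) then a ! i $$ (p, q) else 0)"
      using i by (intro sum.cong refl) (auto split: prod.splits)
    also have "\<dots> = a ! i $$ (p, q)" using i by (subst sum.delta) auto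
    finally show "a ! i $$ (p, q) = (\<Sum>t\<in>?T. (case t of (i, p, q) \<Rightarrow> a ! i $$ (p, q)) *
            (case t of (i, p, q) \<Rightarrow> fd_unit ns i p q) ! i $$ (p, q))" ..
  qed (auto split: prod.splits)
  also have "\<dots> = (\<Sum>i<length ns. \<Sum>(p, q)\<in>{..<ns ! i} \<times> {..<ns ! i}. a ! i $$ (p, q) * L (fd_unit ns i p q))"
    by (subst sum.Sigma) (auto intro!: sum.cong)
  finally show ?thesis by (simp add: sum.cartesian_product)
qed

section \<open>Amplifications\<close>

lemma sum_blocks:
  fixes f :: "nat \<Rightarrow> 'a :: comm_monoid_add"
  shows "(\<Sum>P<k * m. f P) = (\<Sum>r<k. \<Sum>p<m. f (r * m + p))"
proof -
  have "(\<Sum>p<m. f (r * m + p)) = (\<Sum>P\<in>{r * m..<r * m + m}. f P)" for r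
    using sum.shift_bounds_nat_ivl[of f 0 "r * m" m] by (simp add: add.commute atLeast0LessThan)
  thus ?thesis by (simp add: sum.nat_group)
qed

lemma block_index_less: "r < k \<Longrightarrow> p < m \<Longrightarrow> r * m + p < k * (m :: nat)"
  by (metis add.commute add_less_cancel_left less_le_trans mult_Suc mult_le_mono1 Suc_leI)

lemma block_div_less: "P < k * m \<Longrightarrow> P div m < (k :: nat)"
  by (simp add: less_mult_imp_div_less)

lemma block_mod_less: "P < k * m \<Longrightarrow> P mod m < (m :: nat)"
  by (cases "m = 0") auto

lemma amp_entry_entry [simp]:
  "i < length ns \<Longrightarrow> p < ns ! i \<Longrightarrow> q < ns ! i \<Longrightarrow>
    amp_entry ns x r s ! i $$ (p, q) = x ! i $$ (r * ns ! i + p, s * ns ! i + q)"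
  by (simp add: amp_entry_def)

lemma amp_map_entry:
  "j < length ms \<Longrightarrow> P < k * ms ! j \<Longrightarrow> Q < k * ms ! j \<Longrightarrow>
    amp_map k ns ms \<phi> x ! j $$ (P, Q) =
    \<phi> (amp_entry ns x (P div ms ! j) (Q div ms ! j)) ! j $$ (P mod ms ! j, Q mod ms ! j)"
  by (simp add: amp_map_def Let_def)

lemma amp_map_block_entry:
  assumes "j < length ms" "r < k" "s < k" "p < ms ! j" "q < ms ! j"
  shows "amp_map k ns ms \<phi> x ! j $$ (r * ms ! j + p, s * ms ! j + q) = \<phi> (amp_entry ns x r s) ! j $$ (p, q)"
  using assms by (simp add: amp_map_entry block_index_less)

lemma fd_linear_map_carrier:
  "fd_linear_map ns ms \<phi> \<Longrightarrow> a \<in> fd_carrier ns \<Longrightarrow> \<phi> a \<in> fd_carrier ms"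
  by (simp add: fd_linear_map_def)

lemma fd_functional_entry:
  assumes "fd_linear_map ns ms \<phi>" "j < length ms" "r < ms ! j" "s < ms ! j"
  shows "fd_functional ns (\<lambda>a. \<phi> a ! j $$ (r, s))"
proof -
  have "\<phi> (fd_add a b) ! j $$ (r, s) = \<phi> a ! j $$ (r, s) + \<phi> b ! j $$ (r, s)"
    if "a \<in> fd_carrier ns" "b \<in> fd_carrier ns" for a b
  proof -
    have "\<phi> (fd_add a b) = fd_add (\<phi> a) (\<phi> b)" "\<phi> a \<in> fd_carrier ms" "\<phi> b \<in> fd_carrier ms"
      using assms(1) that by (simp_all add: fd_linear_map_def)
    thus ?thesis using assms by simp
  qed
  moreover have "\<phi> (fd_smult c a) ! j $$ (r, s) = c * \<phi> a ! j $$ (r, s)"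
    if "a \<in> fd_carrier ns" for a c
  proof -
    have "\<phi> (fd_smult c a) = fd_smult c (\<phi> a)" "\<phi> a \<in> fd_carrier ms"
      using assms(1) that by (simp_all add: fd_linear_map_def)
    thus ?thesis using assms by simp
  qed
  ultimately show ?thesis unfolding fd_functional_def by blast
qed

lemma amp_map_linear:
  assumes "fd_linear_map ns ms \<phi>"
  shows "fd_linear_map (amp_sizes k ns) (amp_sizes k ms) (amp_map k ns ms \<phi>)"
proof -
  note f = fd_functional_entry[OF assms, unfolded fd_functional_def]
  have "amp_map k ns ms \<phi> (fd_add a b) = fd_add (amp_map k ns ms \<phi> a) (amp_map k ns ms \<phi> b)"
    if ab: "a \<in> fd_carrier (amp_sizes k ns)" "b \<in> fd_carrier (amp_sizes k ns)" for a b
  proof (rule fd_eqI[of _ "amp_sizes k ms"])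
    fix j P Q
    assume j: "j < length (amp_sizes k ms)" and PQ: "P < amp_sizes k ms ! j" "Q < amp_sizes k ms ! j"
    have "amp_entry ns (fd_add a b) r s = fd_add (amp_entry ns a r s) (amp_entry ns b r s)"
      if "r < k" "s < k" for r s
      using ab that by (intro fd_eqI[of _ ns]) (simp_all add: block_index_less fd_add_entry[of _ ns])
    thus "amp_map k ns ms \<phi> (fd_add a b) ! j $$ (P, Q) =
        fd_add (amp_map k ns ms \<phi> a) (amp_map k ns ms \<phi> b) ! j $$ (P, Q)"
      using j PQ f[of j "P mod ms ! j" "Q mod ms ! j"]
      by (simp add: amp_map_entry block_div_less block_mod_less fd_add_entry[of _ "amp_sizes k ms"]
          fd_smult_entry[of _ "amp_sizes k ms"])
  qed auto
  moreover have "amp_map k ns ms \<phi> (fd_smult c a) = fd_smult c (amp_map k ns ms \<phi> a)"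
    if a: "a \<in> fd_carrier (amp_sizes k ns)" for a c
  proof (rule fd_eqI[of _ "amp_sizes k ms"])
    fix j P Q
    assume j: "j < length (amp_sizes k ms)" and PQ: "P < amp_sizes k ms ! j" "Q < amp_sizes k ms ! j"
    have "amp_entry ns (fd_smult c a) r s = fd_smult c (amp_entry ns a r s)"
      if "r < k" "s < k" for r s
      using a that by (intro fd_eqI[of _ ns]) (simp_all add: block_index_less fd_smult_entry[of _ ns])
    thus "amp_map k ns ms \<phi> (fd_smult c a) ! j $$ (P, Q) = fd_smult c (amp_map k ns ms \<phi> a) ! j $$ (P, Q)"
      using j PQ f[of j "P mod ms ! j" "Q mod ms ! j"]
      by (simp add: amp_map_entry block_div_less block_mod_less fd_add_entry[of _ "amp_sizes k ms"]
          fd_smult_entry[of _ "amp_sizes k ms"])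
  qed auto
  ultimately show ?thesis by (auto simp: fd_linear_map_def)
qed

lemma amp_map_unital:
  assumes L: "fd_linear_map ns ms \<phi>" and "fd_unital ns ms \<phi>"
  shows "fd_unital (amp_sizes k ns) (amp_sizes k ms) (amp_map k ns ms \<phi>)"
  unfolding fd_unital_def
proof (rule fd_eqI[of _ "amp_sizes k ms"])
  fix j P Q
  assume j: "j < length (amp_sizes k ms)" and PQ: "P < amp_sizes k ms ! j" "Q < amp_sizes k ms ! j"
  let ?m = "ms ! j"
  let ?r = "P div ?m" and ?s = "Q div ?m"
  have rs: "?r < k" "?s < k" "P mod ?m < ?m" "Q mod ?m < ?m"
    using j PQ by (simp_all add: block_div_less block_mod_less)
  have "amp_entry ns (fd_one (amp_sizes k ns)) ?r ?s = fd_smult (if ?r = ?s then 1 else 0) (fd_one ns)"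
  proof (rule fd_eqI[of _ ns])
    fix i p q assume "i < length ns" "p < ns ! i" "q < ns ! i"
    moreover have "?r * ns ! i + p = ?s * ns ! i + q \<longleftrightarrow> ?r = ?s \<and> p = q" if "p < ns ! i" "q < ns ! i"
      using that by (metis add_left_cancel div_mult_self3 div_less add.right_neutral less_nat_zero_code)
    ultimately show "amp_entry ns (fd_one (amp_sizes k ns)) ?r ?s ! i $$ (p, q) =
        fd_smult (if ?r = ?s then 1 else 0) (fd_one ns) ! i $$ (p, q)"
      using rs by (simp add: block_index_less fd_smult_entry[of _ ns])
  qed auto
  moreover have "\<phi> (fd_smult c (fd_one ns)) = fd_smult c (fd_one ms)" for c
    using assms unfolding fd_linear_map_def fd_unital_def by (metis fd_one_carrier)
  ultimately have "amp_map k ns ms \<phi> (fd_one (amp_sizes k ns)) ! j $$ (P, Q) =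
      (if ?r = ?s \<and> P mod ?m = Q mod ?m then 1 else 0)"
    using j PQ rs by (simp add: amp_map_entry fd_smult_entry[of _ ms])
  moreover have "?r = ?s \<and> P mod ?m = Q mod ?m \<longleftrightarrow> P = Q"
    by (metis div_mult_mod_eq)
  ultimately show "amp_map k ns ms \<phi> (fd_one (amp_sizes k ns)) ! j $$ (P, Q) = fd_one (amp_sizes k ms) ! j $$ (P, Q)"
    using j PQ by simp
qed auto

lemma fd_star_star [simp]: "a \<in> fd_carrier ns \<Longrightarrow> fd_star (fd_star a) = a"
  by (intro fd_eqI[of _ ns]) (auto simp: fd_star_entry[of _ ns])

lemma fd_mult_one [simp]: "a \<in> fd_carrier ns \<Longrightarrow> fd_mult a (fd_one ns) = a"
  by (intro fd_eqI[of _ ns]) (auto simp: fd_mult_entry[of _ ns] if_distrib[of "\<lambda>x. _ * x"] cong: if_cong)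

lemma fd_one_mult [simp]: "a \<in> fd_carrier ns \<Longrightarrow> fd_mult (fd_one ns) a = a"
  by (intro fd_eqI[of _ ns]) (auto simp: fd_mult_entry[of _ ns] if_distrib[of "\<lambda>x. x * _"] cong: if_cong)

lemma fd_star_one [simp]: "fd_star (fd_one ns) = fd_one ns"
  by (intro fd_eqI[of _ ns]) (auto simp: fd_star_entry[of _ ns])

text \<open>
  Multiplying out the \<open>k \<times> k\<close> matrices over the algebra, the \<open>(r, s)\<close> entry of a product is
  \<open>\<Sum>t. x\<^sub>r\<^sub>t y\<^sub>t\<^sub>s\<close>, and a homomorphism respects every term.
\<close>

lemma amp_map_hom:
  assumes "fd_hom ns ms \<phi>"
  shows "fd_hom (amp_sizes k ns) (amp_sizes k ms) (amp_map k ns ms \<phi>)"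
proof -
  have lin: "fd_linear_map ns ms \<phi>"
    and mult: "\<And>a b. a \<in> fd_carrier ns \<Longrightarrow> b \<in> fd_carrier ns \<Longrightarrow> \<phi> (fd_mult a b) = fd_mult (\<phi> a) (\<phi> b)"
    and star: "\<And>a. a \<in> fd_carrier ns \<Longrightarrow> \<phi> (fd_star a) = fd_star (\<phi> a)"
    using assms by (auto simp: fd_hom_def)
  note phi_c = fd_linear_map_carrier[OF lin]
  have "amp_map k ns ms \<phi> (fd_mult x y) = fd_mult (amp_map k ns ms \<phi> x) (amp_map k ns ms \<phi> y)"
    if x: "x \<in> fd_carrier (amp_sizes k ns)" and y: "y \<in> fd_carrier (amp_sizes k ns)" for x y
  proof (rule fd_eqI[of _ "amp_sizes k ms"])
    fix j P Q
    assume j: "j < length (amp_sizes k ms)" and PQ: "P < amp_sizes k ms ! j" "Q < amp_sizes k ms ! j"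
    let ?m = "ms ! j"
    define r p s q where rpsq: "r = P div ?m" "p = P mod ?m" "s = Q div ?m" "q = Q mod ?m"
    have j': "j < length ms" using j by simp
    have b: "r < k" "s < k" "p < ?m" "q < ?m"
      using j PQ by (simp_all add: rpsq block_div_less block_mod_less)
    have "\<phi> (amp_entry ns (fd_mult x y) r s) ! j $$ (p, q) =
        (\<Sum>t<k. 1 * \<phi> (fd_mult (amp_entry ns x r t) (amp_entry ns y t s)) ! j $$ (p, q))"
    proof (rule fd_functional_sum[OF fd_functional_entry[OF lin j' b(3,4)]])
      fix i p q assume i: "i < length ns" "p < ns ! i" "q < ns ! i"
      have "amp_entry ns (fd_mult x y) r s ! i $$ (p, q)
          = (\<Sum>R<k * ns ! i. x ! i $$ (r * ns ! i + p, R) * y ! i $$ (R, s * ns ! i + q))"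
        using i b x y by (simp add: fd_mult_entry[of _ "amp_sizes k ns"] block_index_less)
      also have "\<dots> = (\<Sum>t<k. fd_mult (amp_entry ns x r t) (amp_entry ns y t s) ! i $$ (p, q))"
        using i unfolding sum_blocks by (intro sum.cong refl) (simp add: fd_mult_entry[of _ ns])
      finally show "amp_entry ns (fd_mult x y) r s ! i $$ (p, q)
          = (\<Sum>t<k. 1 * fd_mult (amp_entry ns x r t) (amp_entry ns y t s) ! i $$ (p, q))" by simp
    qed auto
    also have "\<dots> = (\<Sum>t<k. \<Sum>l<?m. \<phi> (amp_entry ns x r t) ! j $$ (p, l) * \<phi> (amp_entry ns y t s) ! j $$ (l, q))"
      using j' b phi_c by (intro sum.cong refl) (simp add: mult fd_mult_entry[of _ ms])
    also have "\<dots> = fd_mult (amp_map k ns ms \<phi> x) (amp_map k ns ms \<phi> y) ! j $$ (P, Q)"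
      using j PQ b by (simp add: fd_mult_entry[of _ "amp_sizes k ms"] sum_blocks amp_map_entry
          block_index_less rpsq)
    finally show "amp_map k ns ms \<phi> (fd_mult x y) ! j $$ (P, Q) =
        fd_mult (amp_map k ns ms \<phi> x) (amp_map k ns ms \<phi> y) ! j $$ (P, Q)"
      using j PQ by (simp add: amp_map_entry rpsq)
  qed (use x y in auto)
  moreover have "amp_map k ns ms \<phi> (fd_star x) = fd_star (amp_map k ns ms \<phi> x)"
    if x: "x \<in> fd_carrier (amp_sizes k ns)" for x
  proof (rule fd_eqI[of _ "amp_sizes k ms"])
    fix j P Q
    assume j: "j < length (amp_sizes k ms)" and PQ: "P < amp_sizes k ms ! j" "Q < amp_sizes k ms ! j"
    have "amp_entry ns (fd_star x) r s = fd_star (amp_entry ns x s r)" if "r < k" "s < k" for r s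
      using that x by (intro fd_eqI[of _ ns])
        (simp_all add: block_index_less fd_star_entry[of _ ns] fd_star_entry[of _ "amp_sizes k ns"])
    thus "amp_map k ns ms \<phi> (fd_star x) ! j $$ (P, Q) = fd_star (amp_map k ns ms \<phi> x) ! j $$ (P, Q)"
      using j PQ phi_c by (simp add: amp_map_entry block_div_less block_mod_less star
          fd_star_entry[of _ ms] fd_star_entry[of _ "amp_sizes k ms"])
  qed auto
  ultimately show ?thesis using amp_map_linear[OF lin] by (auto simp: fd_hom_def)
qed

section \<open>Completely positive maps and their multiplicative domains\<close>

text \<open>
  The number \<open>\<langle>x, M y\<rangle>\<close>, conjugate linear in \<open>x\<close>; \<open>ip\<close> and \<open>mv\<close> below are the inner product and the
  matrix-vector product that belong to it.
\<close>

definition sesq :: "nat \<Rightarrow> complex mat \<Rightarrow> (nat \<Rightarrow> complex) \<Rightarrow> (nat \<Rightarrow> complex) \<Rightarrow> complex" where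
  "sesq m M x y = (\<Sum>p<m. \<Sum>q<m. cnj (x p) * M $$ (p, q) * y q)"

lemma cnj_mult_self_nonneg: "0 \<le> cnj z * z"
  by (simp add: less_eq_complex_def)

lemma sum_delta_lessThan:
  fixes f :: "nat \<Rightarrow> complex"
  shows "p < m \<Longrightarrow> (\<Sum>r<m. (if r = p then c else 0) * f r) = c * f p"
    "p < m \<Longrightarrow> (\<Sum>r<m. f r * (if r = p then c else 0)) = f p * c"
  by (simp_all add: if_distrib[of "\<lambda>x. x * _"] if_distrib[of "\<lambda>x. _ * x"] cong: if_cong)

lemma sesq_delta:
  assumes "p < m" "q < m"
  shows "sesq m M (\<lambda>r. if r = p then \<alpha> else 0) (\<lambda>r. if r = q then \<beta> else 0) = cnj \<alpha> * M $$ (p, q) * \<beta>"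
proof -
  have "sesq m M (\<lambda>r. if r = p then \<alpha> else 0) (\<lambda>r. if r = q then \<beta> else 0)
      = (\<Sum>r<m. (if r = p then cnj \<alpha> else 0) * (\<Sum>s<m. M $$ (r, s) * (if s = q then \<beta> else 0)))"
    unfolding sesq_def sum_distrib_left by (intro sum.cong refl) simp
  also have "\<dots> = cnj \<alpha> * (M $$ (p, q) * \<beta>)"
    using assms by (simp add: sum_delta_lessThan)
  finally show ?thesis by simp
qed

lemma fd_positive_sesq_nonneg:
  assumes "fd_positive ns a" and j: "j < length ns"
  shows "0 \<le> sesq (ns ! j) (a ! j) x x"
proof -
  obtain c where c: "c \<in> fd_carrier ns" and a: "a = fd_mult (fd_star c) c"
    using assms unfolding fd_positive_def by blast
  let ?n = "ns ! j"
  have "sesq ?n (a ! j) x x =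
      (\<Sum>p<?n. \<Sum>q<?n. \<Sum>R<?n. cnj (c ! j $$ (R, p) * x p) * (c ! j $$ (R, q) * x q))"
    unfolding sesq_def a using c j
    by (intro sum.cong refl) (simp add: fd_mult_entry[of _ ns] fd_star_entry[of _ ns]
      sum_distrib_left sum_distrib_right mult_ac)
  also have "\<dots> = (\<Sum>p<?n. \<Sum>R<?n. \<Sum>q<?n. cnj (c ! j $$ (R, p) * x p) * (c ! j $$ (R, q) * x q))"
    by (intro sum.cong refl sum.swap)
  also have "\<dots> = (\<Sum>R<?n. \<Sum>p<?n. \<Sum>q<?n. cnj (c ! j $$ (R, p) * x p) * (c ! j $$ (R, q) * x q))"
    by (rule sum.swap)
  also have "\<dots> = (\<Sum>R<?n. cnj (\<Sum>p<?n. c ! j $$ (R, p) * x p) * (\<Sum>q<?n. c ! j $$ (R, q) * x q))"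
    by (simp only: cnj_sum sum_product)
  also have "0 \<le> \<dots>" by (intro sum_nonneg cnj_mult_self_nonneg)
  finally show ?thesis .
qed

text \<open>
  Complete positivity in the form in which it is used: \<open>[y\<^sub>r* y\<^sub>s]\<close> is a positive matrix over the algebra,
  being \<open>Y* Y\<close> for the matrix \<open>Y\<close> whose first row is \<open>y\<close> and whose other rows vanish.
\<close>

lemma cp_form_nonneg:
  fixes k :: nat
  assumes cp: "fd_completely_positive ns ms \<phi>" and j: "j < length ms" and k: "0 < k"
    and y: "\<And>r. r < k \<Longrightarrow> y r \<in> fd_carrier ns"
  shows "0 \<le> (\<Sum>r<k. \<Sum>s<k. sesq (ms ! j) (\<phi> (fd_mult (fd_star (y r)) (y s)) ! j) (\<xi> r) (\<xi> s))"
proof -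
  let ?m = "ms ! j"
  define Y where "Y = fd_of_entries (amp_sizes k ns)
    (\<lambda>i R S. if R < ns ! i then y (S div ns ! i) ! i $$ (R, S mod ns ! i) else 0)"
  define X where "X = fd_mult (fd_star Y) Y"
  have Y: "Y \<in> fd_carrier (amp_sizes k ns)" by (simp add: Y_def)
  have entry: "amp_entry ns X r s = fd_mult (fd_star (y r)) (y s)" if rs: "r < k" "s < k" for r s
  proof (rule fd_eqI[of _ ns])
    fix i p q assume i: "i < length ns" "p < ns ! i" "q < ns ! i"
    have sub: "{..<ns ! i} \<subseteq> {..<k * ns ! i}" using k by auto
    have "amp_entry ns X r s ! i $$ (p, q) =
        (\<Sum>R<k * ns ! i. cnj (Y ! i $$ (R, r * ns ! i + p)) * Y ! i $$ (R, s * ns ! i + q))"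
      using i rs Y by (simp add: X_def block_index_less fd_mult_entry[of _ "amp_sizes k ns"]
          fd_star_entry[of _ "amp_sizes k ns"])
    also have "\<dots> = (\<Sum>R<ns ! i. cnj (Y ! i $$ (R, r * ns ! i + p)) * Y ! i $$ (R, s * ns ! i + q))"
      using sub i rs by (intro sum.mono_neutral_right) (auto simp: Y_def block_index_less)
    also have "\<dots> = (\<Sum>R<ns ! i. cnj (y r ! i $$ (R, p)) * y s ! i $$ (R, q))"
      using i rs sub by (intro sum.cong refl) (auto simp: Y_def block_index_less subset_iff)
    also have "\<dots> = fd_mult (fd_star (y r)) (y s) ! i $$ (p, q)"
      using i rs y by (simp add: fd_mult_entry[of _ ns] fd_star_entry[of _ ns])
    finally show "amp_entry ns X r s ! i $$ (p, q) = fd_mult (fd_star (y r)) (y s) ! i $$ (p, q)" .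
  qed (use rs y in auto)
  have "fd_positive (amp_sizes k ns) X" using Y by (auto simp: fd_positive_def X_def)
  hence "fd_positive (amp_sizes k ms) (amp_map k ns ms \<phi> X)"
    using cp k by (simp add: fd_completely_positive_def)
  hence "0 \<le> sesq (k * ?m) (amp_map k ns ms \<phi> X ! j) (\<lambda>P. \<xi> (P div ?m) (P mod ?m)) (\<lambda>P. \<xi> (P div ?m) (P mod ?m))"
    using fd_positive_sesq_nonneg[of "amp_sizes k ms" _ j] j by simp
  also have "\<dots> = (\<Sum>r<k. \<Sum>p<?m. \<Sum>s<k. \<Sum>q<?m.
      cnj (\<xi> r p) * \<phi> (fd_mult (fd_star (y r)) (y s)) ! j $$ (p, q) * \<xi> s q)"
    unfolding sesq_def sum_blocks using j
    by (intro sum.cong refl) (simp add: amp_map_block_entry entry)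
  also have "\<dots> = (\<Sum>r<k. \<Sum>s<k. sesq ?m (\<phi> (fd_mult (fd_star (y r)) (y s)) ! j) (\<xi> r) (\<xi> s))"
    unfolding sesq_def by (intro sum.cong refl sum.swap)
  finally show ?thesis .
qed

lemma cp_linear: "fd_completely_positive ns ms \<phi> \<Longrightarrow> fd_linear_map ns ms \<phi>"
  by (simp add: fd_completely_positive_def)

text \<open>
  The form of the pair \<open>(x, 1)\<close> is real for all choices of the two vectors, so its mixed terms
  \<open>\<langle>\<xi>, \<phi>(x*) \<eta>\<rangle>\<close> and \<open>\<langle>\<eta>, \<phi>(x) \<xi>\<rangle>\<close> are conjugate to each other.
\<close>

lemma cp_star:
  assumes cp: "fd_completely_positive ns ms \<phi>" and u: "fd_unital ns ms \<phi>" and x: "x \<in> fd_carrier ns"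
  shows "\<phi> (fd_star x) = fd_star (\<phi> x)"
proof (rule fd_eqI[of _ ms])
  note phi_c = fd_linear_map_carrier[OF cp_linear[OF cp]]
  fix j p q assume j: "j < length ms" and pq: "p < ms ! j" "q < ms ! j"
  let ?u = "\<phi> (fd_star x) ! j $$ (p, q)" and ?v = "\<phi> x ! j $$ (q, p)"
  let ?d = "\<lambda>r \<alpha> s. if s = r then \<alpha> else (0 :: complex)"
  have nn: "0 \<le> \<phi> (fd_mult (fd_star x) x) ! j $$ (p, p) + ?u * \<beta> + (cnj \<beta> * ?v + cnj \<beta> * \<beta>)" for \<beta>
  proof -
    have "0 \<le> (\<Sum>r<2. \<Sum>s<2. sesq (ms ! j)
       (\<phi> (fd_mult (fd_star (if r = (0::nat) then x else fd_one ns)) (if s = (0::nat) then x else fd_one ns)) ! j)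
        (if r = 0 then ?d p 1 else ?d q \<beta>) (if s = 0 then ?d p 1 else ?d q \<beta>))"
      using x by (intro cp_form_nonneg[OF cp j]) auto
    thus ?thesis
      using x pq j u by (simp add: numeral_2_eq_2 sesq_delta fd_unital_def)
  qed
  have "Im (\<phi> (fd_mult (fd_star x) x) ! j $$ (p, p)) = 0"
    using nn[of 0] by (simp add: less_eq_complex_def)
  hence "Im (?u * \<beta> + cnj \<beta> * ?v) = 0" for \<beta>
    using nn[of \<beta>] by (simp add: less_eq_complex_def)
  from this[of 1] this[of \<i>] have "?u = cnj ?v"
    by (simp add: complex_eq_iff)
  thus "\<phi> (fd_star x) ! j $$ (p, q) = fd_star (\<phi> x) ! j $$ (p, q)"
    using x j pq phi_c by (simp add: fd_star_entry[of _ ms])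
qed (use x fd_linear_map_carrier[OF cp_linear[OF cp]] in auto)

definition ip :: "nat \<Rightarrow> (nat \<Rightarrow> complex) \<Rightarrow> (nat \<Rightarrow> complex) \<Rightarrow> complex" where
  "ip m x y = (\<Sum>p<m. cnj (x p) * y p)"

definition mv :: "nat \<Rightarrow> complex mat \<Rightarrow> (nat \<Rightarrow> complex) \<Rightarrow> nat \<Rightarrow> complex" where
  "mv m M x p = (\<Sum>q<m. M $$ (p, q) * x q)"

lemma sesq_eq_ip: "sesq m M x y = ip m x (mv m M y)"
  by (simp add: sesq_def ip_def mv_def sum_distrib_left mult.assoc)

lemma sesq_star:
  assumes "b \<in> fd_carrier ms" "j < length ms"
  shows "sesq (ms ! j) (fd_star b ! j) x y = ip (ms ! j) (mv (ms ! j) (b ! j) x) y"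
proof -
  let ?m = "ms ! j"
  have "sesq ?m (fd_star b ! j) x y = (\<Sum>p<?m. \<Sum>q<?m. cnj (b ! j $$ (q, p) * x p) * y q)"
    unfolding sesq_def using assms by (intro sum.cong refl) (simp add: fd_star_entry[of _ ms] mult_ac)
  also have "\<dots> = (\<Sum>q<?m. \<Sum>p<?m. cnj (b ! j $$ (q, p) * x p) * y q)" by (rule sum.swap)
  finally show ?thesis by (simp add: ip_def mv_def sum_distrib_right)
qed

lemma ip_sum_right: "ip m x (\<lambda>p. \<Sum>s\<in>S. f s p) = (\<Sum>s\<in>S. ip m x (f s))"
  unfolding ip_def by (simp only: sum_distrib_left) (rule sum.swap)

lemma ip_sum_left: "ip m (\<lambda>p. \<Sum>s\<in>S. f s p) y = (\<Sum>s\<in>S. ip m (f s) y)"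
  unfolding ip_def by (simp only: sum_distrib_right cnj_sum) (rule sum.swap)

lemma ip_uminus: "ip m x (\<lambda>p. - y p) = - ip m x y" "ip m (\<lambda>p. - x p) y = - ip m x y"
  by (simp_all add: ip_def sum_negf)

lemma sesq_one: "j < length ms \<Longrightarrow> sesq (ms ! j) (fd_one ms ! j) x y = ip (ms ! j) x y"
  by (simp add: sesq_def ip_def if_distrib[of "\<lambda>x. _ * x"] if_distrib[of "\<lambda>x. x * _"] cong: if_cong)

text \<open>
  The Kadison-Schwarz inequality for a family: the matrix with entries
  \<open>\<phi>(y\<^sub>r* y\<^sub>s) - \<phi>(y\<^sub>r)* \<phi>(y\<^sub>s)\<close> is positive. The family is enlarged by \<open>y\<^sub>k = 1\<close> with the vector
  \<open>- \<Sum>r. \<phi>(y\<^sub>r) \<xi>\<^sub>r\<close>, which completes the square.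
\<close>

lemma cp_schwarz_form:
  fixes k :: nat
  assumes cp: "fd_completely_positive ns ms \<phi>" and u: "fd_unital ns ms \<phi>" and j: "j < length ms"
    and y: "\<And>r. r < k \<Longrightarrow> y r \<in> fd_carrier ns"
  shows "0 \<le> (\<Sum>r<k. \<Sum>s<k. sesq (ms ! j) (\<phi> (fd_mult (fd_star (y r)) (y s)) ! j) (\<xi> r) (\<xi> s)
            - ip (ms ! j) (mv (ms ! j) (\<phi> (y r) ! j) (\<xi> r)) (mv (ms ! j) (\<phi> (y s) ! j) (\<xi> s)))"
proof -
  let ?m = "ms ! j"
  note phi_c = fd_linear_map_carrier[OF cp_linear[OF cp]]
  define g where "g p = (\<Sum>r<k. mv ?m (\<phi> (y r) ! j) (\<xi> r) p)" for p
  define y' where "y' r = (if r < k then y r else fd_one ns)" for r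
  define \<xi>' where "\<xi>' r = (if r < k then \<xi> r else (\<lambda>p. - g p))" for r
  define F where "F r s = sesq ?m (\<phi> (fd_mult (fd_star (y' r)) (y' s)) ! j) (\<xi>' r) (\<xi>' s)" for r s
  have y': "y' r \<in> fd_carrier ns" for r using y by (simp add: y'_def)
  have "0 \<le> (\<Sum>r<Suc k. \<Sum>s<Suc k. F r s)"
    unfolding F_def using y' by (intro cp_form_nonneg[OF cp j]) auto
  also have "\<dots> = (\<Sum>r<k. \<Sum>s<k. F r s) + (\<Sum>r<k. F r k) + ((\<Sum>s<k. F k s) + F k k)"
    by (simp add: sum.distrib)
  also have "(\<Sum>r<k. F r k) = (\<Sum>r<k. - ip ?m (mv ?m (\<phi> (y r) ! j) (\<xi> r)) g)"
    using y phi_c j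
    by (intro sum.cong refl) (simp add: F_def y'_def \<xi>'_def cp_star[OF cp u] sesq_star[of _ ms] ip_uminus)
  also have "\<dots> = - ip ?m g g"
    unfolding sum_negf ip_sum_left[symmetric] g_def[symmetric] ..
  also have "(\<Sum>s<k. F k s) = (\<Sum>s<k. - ip ?m g (mv ?m (\<phi> (y s) ! j) (\<xi> s)))"
    using y by (intro sum.cong refl) (simp add: F_def y'_def \<xi>'_def sesq_eq_ip ip_uminus)
  also have "\<dots> = - ip ?m g g"
    unfolding sum_negf ip_sum_right[symmetric] g_def[symmetric] ..
  also have "F k k = ip ?m g g"
    using u j by (simp add: F_def y'_def \<xi>'_def fd_unital_def sesq_one ip_uminus)
  also have "(\<Sum>r<k. \<Sum>s<k. F r s) + - ip ?m g g + (- ip ?m g g + ip ?m g g) = (\<Sum>r<k. \<Sum>s<k. F r s) - ip ?m g g"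
    by simp
  also have "ip ?m g g = (\<Sum>r<k. \<Sum>s<k. ip ?m (mv ?m (\<phi> (y r) ! j) (\<xi> r)) (mv ?m (\<phi> (y s) ! j) (\<xi> s)))"
    unfolding ip_sum_left[symmetric] ip_sum_right[symmetric] g_def[symmetric] ..
  also have "(\<Sum>r<k. \<Sum>s<k. F r s) = (\<Sum>r<k. \<Sum>s<k. sesq ?m (\<phi> (fd_mult (fd_star (y r)) (y s)) ! j) (\<xi> r) (\<xi> s))"
    by (intro sum.cong refl) (simp add: F_def y'_def \<xi>'_def)
  finally show ?thesis by (simp only: sum_subtractf)
qed

lemma ip_mv_delta:
  assumes "p < m" "q < m"
  shows "ip m (mv m M (\<lambda>r. if r = p then \<alpha> else 0)) (mv m N (\<lambda>r. if r = q then \<beta> else 0))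
       = cnj \<alpha> * (\<Sum>r<m. cnj (M $$ (r, p)) * N $$ (r, q)) * \<beta>"
  using assms unfolding ip_def mv_def
  by (simp add: sum_delta_lessThan sum_distrib_left sum_distrib_right mult_ac)

lemma cp_defect_nonneg:
  assumes cp: "fd_completely_positive ns ms \<phi>" and u: "fd_unital ns ms \<phi>" and j: "j < length ms"
    and y: "y \<in> fd_carrier ns" and s: "s < ms ! j"
  shows "0 \<le> \<phi> (fd_mult (fd_star y) y) ! j $$ (s, s) - fd_mult (fd_star (\<phi> y)) (\<phi> y) ! j $$ (s, s)"
  using cp_schwarz_form[OF cp u j, of 1 "\<lambda>_. y" "\<lambda>_ r. if r = s then 1 else 0"] y s j
    fd_linear_map_carrier[OF cp_linear[OF cp] y]
  by (simp add: sesq_delta ip_mv_delta fd_mult_entry[of _ ms] fd_star_entry[of _ ms])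

text \<open>
  A nonnegative function of \<open>t\<close> cannot have a linear part; real and imaginary \<open>t\<close> together isolate \<open>c\<close>.
\<close>

lemma linear_nonneg_imp_zero:
  fixes c c' d :: complex
  assumes "\<And>t. 0 \<le> cnj t * c + t * c' + d"
  shows "c = 0"
proof -
  have a: "Re d \<ge> 0" "Im d = 0" using assms[of 0] by (auto simp: less_eq_complex_def)
  have lin: "x = 0" if "\<And>t::real. 0 \<le> t * x + r" for x r :: real
  proof (rule ccontr)
    assume "x \<noteq> 0"
    with that[of "- (r + 1) / x"] show False by simp
  qed
  have "Re (c + c') = 0"
    by (rule lin[of _ "Re d"]) (use assms[of "complex_of_real _"] in \<open>simp add: less_eq_complex_def algebra_simps\<close>)
  moreover have "Im (c - c') = 0"
    by (rule lin[of _ "Re d"]) (use assms[of "\<i> * complex_of_real _"] in \<open>simp add: less_eq_complex_def algebra_simps\<close>)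
  moreover have "Im (c + c') = 0" "Re (c - c') = 0"
    using assms[of 1] assms[of \<i>] a by (simp_all add: less_eq_complex_def)
  ultimately show ?thesis by (simp add: complex_eq_iff)
qed

text \<open>
  Choi's multiplicative domain, row by row. The Schwarz form of the pair \<open>(a*, x)\<close> is nonnegative, and
  its term that is quadratic in the first vector vanishes by hypothesis; so the mixed term, which is the
  defect of multiplicativity of \<open>\<phi>\<close> at \<open>(a, x)\<close>, has to vanish too.
\<close>

lemma cp_multiplicative_domain:
  assumes cp: "fd_completely_positive ns ms \<phi>" and u: "fd_unital ns ms \<phi>" and j: "j < length ms"
    and a: "a \<in> fd_carrier ns" and x: "x \<in> fd_carrier ns" and p: "p < ms ! j" and q: "q < ms ! j"
    and eq: "\<phi> (fd_mult a (fd_star a)) ! j $$ (p, p) = fd_mult (\<phi> a) (\<phi> (fd_star a)) ! j $$ (p, p)"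
  shows "\<phi> (fd_mult a x) ! j $$ (p, q) = fd_mult (\<phi> a) (\<phi> x) ! j $$ (p, q)"
proof -
  let ?m = "ms ! j"
  let ?y = "\<lambda>r. if r = (0::nat) then fd_star a else x"
  let ?d = "\<lambda>r \<alpha> s. if s = r then \<alpha> else (0 :: complex)"
  note phi_c = fd_linear_map_carrier[OF cp_linear[OF cp]]
  note st = cp_star[OF cp u]
  define D where "D r s = \<phi> (fd_mult (fd_star (?y r)) (?y s)) ! j $$ (if r = 0 then p else q, if s = 0 then p else q)
      - (\<Sum>i<?m. cnj (\<phi> (?y r) ! j $$ (i, if r = 0 then p else q)) * \<phi> (?y s) ! j $$ (i, if s = 0 then p else q))" for r s
  have "0 \<le> cnj t * D 0 1 + t * D 1 0 + D 1 1" for t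
  proof -
    have "0 \<le> (\<Sum>r<2. \<Sum>s<2. sesq ?m (\<phi> (fd_mult (fd_star (?y r)) (?y s)) ! j)
        (if r = 0 then ?d p t else ?d q 1) (if s = 0 then ?d p t else ?d q 1)
      - ip ?m (mv ?m (\<phi> (?y r) ! j) (if r = 0 then ?d p t else ?d q 1))
              (mv ?m (\<phi> (?y s) ! j) (if s = 0 then ?d p t else ?d q 1)))"
      using a x by (intro cp_schwarz_form[OF cp u j]) auto
    also have "\<dots> = cnj t * D 0 0 * t + cnj t * D 0 1 + (D 1 0 * t + D 1 1)"
      using p q by (simp add: numeral_2_eq_2 sesq_delta ip_mv_delta D_def algebra_simps)
    also have "D 0 0 = 0"
      using eq a p j phi_c by (simp add: D_def fd_mult_entry[of _ ms] st fd_star_entry[of _ ms])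
    finally show ?thesis by (simp add: algebra_simps)
  qed
  hence "D 0 1 = 0" by (rule linear_nonneg_imp_zero)
  thus ?thesis
    using a x p q j phi_c by (simp add: D_def fd_mult_entry[of _ ms] st fd_star_entry[of _ ms])
qed

section \<open>States and their spectral data\<close>

lemma unitary_diag_entry:
  assumes U: "U \<in> carrier_mat n n" and pq: "p < n" "q < n"
  shows "(U * mat_diag n g * mat_adjoint U) $$ (p, q) = (\<Sum>a<n. g a * (U $$ (p, a) * cnj (U $$ (q, a))))"
proof -
  have c: "U * mat_diag n g \<in> carrier_mat n n" "mat_adjoint U \<in> carrier_mat n n" using U by simp_all
  show ?thesis
    unfolding mat_mult_entry[OF c pq] using U pq
    by (intro sum.cong refl) (simp add: mat_diag_mult_right[OF U])
qed

text \<open>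
  The rank one matrix \<open>x y*\<close> in block \<open>i\<close>, and zero in the other blocks.
\<close>

definition fd_rank1 :: "nat list \<Rightarrow> nat \<Rightarrow> (nat \<Rightarrow> complex) \<Rightarrow> (nat \<Rightarrow> complex) \<Rightarrow> complex mat list" where
  "fd_rank1 ns i x y = fd_of_entries ns (\<lambda>i' p q. if i' = i then x p * cnj (y q) else 0)"

lemma fd_rank1_carrier [simp, intro]: "fd_rank1 ns i x y \<in> fd_carrier ns"
  by (simp add: fd_rank1_def)

lemma fd_rank1_entry [simp]:
  "i' < length ns \<Longrightarrow> p < ns ! i' \<Longrightarrow> q < ns ! i' \<Longrightarrow>
    fd_rank1 ns i x y ! i' $$ (p, q) = (if i' = i then x p * cnj (y q) else 0)"
  by (simp add: fd_rank1_def)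

lemma fd_functional_rank1:
  assumes L: "fd_functional ns L" and i: "i < length ns"
  shows "L (fd_rank1 ns i x y) = (\<Sum>p<ns ! i. \<Sum>q<ns ! i. x p * cnj (y q) * L (fd_unit ns i p q))"
proof -
  have "L (fd_rank1 ns i x y) = (\<Sum>i'<length ns. if i' = i then
      \<Sum>p<ns ! i. \<Sum>q<ns ! i. x p * cnj (y q) * L (fd_unit ns i p q) else 0)"
    unfolding fd_functional_expand[OF L fd_rank1_carrier]
    by (intro sum.cong refl) (simp add: if_distrib[of "\<lambda>x. x * _"] cong: if_cong)
  thus ?thesis using i by simp
qed

lemma fd_rank1_positive: "fd_positive ns (fd_rank1 ns i z z)"
proof -
  \<comment> \<open>The matrix with first row \<open>z*\<close> satisfies \<open>b* b = z z*\<close>.\<close>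
  define b where "b = fd_of_entries ns (\<lambda>i' p q. if i' = i \<and> p = 0 then cnj (z q) else 0)"
  have b: "b \<in> fd_carrier ns" by (simp add: b_def)
  have "fd_rank1 ns i z z = fd_mult (fd_star b) b"
  proof (rule fd_eqI[of _ ns])
    fix i' p q assume i': "i' < length ns" "p < ns ! i'" "q < ns ! i'"
    have "fd_mult (fd_star b) b ! i' $$ (p, q) =
        (\<Sum>r<ns ! i'. if r = 0 then (if i' = i then z p * cnj (z q) else 0) else 0)"
      unfolding fd_mult_entry[OF fd_star_carrier[OF b] b i']
      using i' b by (intro sum.cong refl) (simp add: fd_star_entry[of _ ns], auto simp: b_def)
    also have "\<dots> = (if i' = i then z p * cnj (z q) else 0)"
      using i'(2) by simp
    finally show "fd_rank1 ns i z z ! i' $$ (p, q) = fd_mult (fd_star b) b ! i' $$ (p, q)"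
      using i' by simp
  qed (use b in auto)
  thus ?thesis using b by (auto simp: fd_positive_def)
qed

lemma sesq_rank1:
  "i < length ns \<Longrightarrow> sesq (ns ! i) (fd_rank1 ns i x y ! i) v w = ip (ns ! i) v x * ip (ns ! i) y w"
  unfolding sesq_def ip_def sum_product by (intro sum.cong refl) simp

lemma sesq_rank1_other:
  "i' < length ns \<Longrightarrow> i' \<noteq> i \<Longrightarrow> sesq (ns ! i') (fd_rank1 ns i x y ! i') v w = 0"
  by (simp add: sesq_def)

text \<open>
  The form at the vectors \<open>e\<^sub>p + \<beta> e\<^sub>q\<close> with \<open>\<beta> = 1\<close> and \<open>\<beta> = \<i>\<close> is real, which determines the imaginary
  part of the sum and the real part of the difference of the two entries.
\<close>

lemma psd_imp_hermitian:
  fixes M :: "complex mat"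
  assumes psd: "\<And>z. 0 \<le> sesq m M z z" and p: "p < m" and q: "q < m"
  shows "M $$ (p, q) = cnj (M $$ (q, p))"
proof -
  let ?d = "\<lambda>r \<alpha> s. if s = r then \<alpha> else (0 :: complex)"
  have diag: "Im (M $$ (r, r)) = 0" if "r < m" for r
    using psd[of "?d r 1"] that by (simp add: sesq_delta less_eq_complex_def)
  have "sesq m M (\<lambda>s. ?d p 1 s + ?d q \<beta> s) (\<lambda>s. ?d p 1 s + ?d q \<beta> s) =
      sesq m M (?d p 1) (?d p 1) + sesq m M (?d p 1) (?d q \<beta>) + sesq m M (?d q \<beta>) (?d p 1)
        + sesq m M (?d q \<beta>) (?d q \<beta>)" for \<beta>
    unfolding sesq_def sum.distrib[symmetric] by (intro sum.cong refl) (simp add: algebra_simps)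
  hence nn: "0 \<le> M $$ (p, p) + M $$ (p, q) * \<beta> + cnj \<beta> * M $$ (q, p) + cnj \<beta> * M $$ (q, q) * \<beta>" for \<beta>
    using psd[of "\<lambda>s. ?d p 1 s + ?d q \<beta> s"] p q by (simp add: sesq_delta)
  have "Im (M $$ (p, q) + M $$ (q, p)) = 0" "Re (M $$ (p, q)) = Re (M $$ (q, p))"
    using nn[of 1] nn[of \<i>] diag[OF p] diag[OF q] by (simp_all add: less_eq_complex_def)
  thus ?thesis by (simp add: complex_eq_iff)
qed

lemma fd_state_functional: "fd_state ns \<mu> \<Longrightarrow> fd_functional ns \<mu>"
  by (simp add: fd_state_def fd_functional_def)

lemma fd_state_nonneg: "fd_state ns \<mu> \<Longrightarrow> fd_positive ns a \<Longrightarrow> 0 \<le> \<mu> a"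
  by (auto simp: fd_state_def less_eq_complex_def complex_is_Real_iff)

lemma sum_if_const:
  "(\<Sum>x\<in>S. if P then f x else 0) = (if P then \<Sum>x\<in>S. f x else (0 :: 'a :: comm_monoid_add))"
  by simp

lemma fd_density_eq:
  assumes L: "fd_functional ns \<mu>"
  shows "fd_density ns \<mu> = fd_of_entries ns (\<lambda>i p q. \<mu> (fd_unit ns i q p))"
  unfolding fd_density_def
proof (rule the_equality, goal_cases)
  case 1
  have "\<mu> a = fd_tr (fd_mult (fd_of_entries ns (\<lambda>i p q. \<mu> (fd_unit ns i q p))) a)" if a: "a \<in> fd_carrier ns" for a
  proof -
    have "\<mu> a = (\<Sum>i<length ns. \<Sum>p<ns ! i. \<Sum>q<ns ! i. \<mu> (fd_unit ns i p q) * a ! i $$ (p, q))"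
      using fd_functional_expand[OF L a] by (simp add: mult.commute)
    also have "\<dots> = (\<Sum>i<length ns. \<Sum>q<ns ! i. \<Sum>p<ns ! i. \<mu> (fd_unit ns i p q) * a ! i $$ (p, q))"
      by (intro sum.cong refl sum.swap)
    finally show ?thesis using a by (simp add: fd_tr_mult[of _ ns])
  qed
  thus ?case by (intro conjI ballI fd_of_entries_carrier)
next
  case (2 d)
  hence d: "d \<in> fd_carrier ns" and eq: "\<And>a. a \<in> fd_carrier ns \<Longrightarrow> \<mu> a = fd_tr (fd_mult d a)" by auto
  show ?case
  proof (rule fd_eqI[OF d fd_of_entries_carrier])
    fix i p q assume i: "i < length ns" "p < ns ! i" "q < ns ! i"
    have "\<mu> (fd_unit ns i q p) = (\<Sum>i'<length ns. \<Sum>p'<ns ! i'. \<Sum>q'<ns ! i'.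
        if i' = i then if p' = p then if q' = q then d ! i $$ (p, q) else 0 else 0 else 0)"
      unfolding eq[OF fd_unit_carrier] fd_tr_mult[OF d fd_unit_carrier]
      by (intro sum.cong refl) simp
    also have "\<dots> = d ! i $$ (p, q)"
      using i unfolding sum_if_const by simp
    finally show "d ! i $$ (p, q) = fd_of_entries ns (\<lambda>i p q. \<mu> (fd_unit ns i q p)) ! i $$ (p, q)"
      using i by simp
  qed
qed

text \<open>
  A diagonalization of the density of \<open>\<mu>\<close>, with the density eliminated: for each block \<open>i\<close> the vectors
  \<open>u i a\<close> form an orthonormal basis (the second condition is completeness), and \<open>\<mu>\<close> is the mixture of
  the vector states of \<open>u i a\<close> with weights \<open>e i a\<close>, the eigenvalues of the density.
\<close>

definition spectral_data ::
  "nat list \<Rightarrow> (complex mat list \<Rightarrow> complex) \<Rightarrow> (nat \<Rightarrow> nat \<Rightarrow> nat \<Rightarrow> complex) \<Rightarrow> (nat \<Rightarrow> nat \<Rightarrow> real) \<Rightarrow> bool" where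
  "spectral_data ns \<mu> u e \<longleftrightarrow>
     (\<forall>i<length ns. \<forall>a<ns ! i. \<forall>b<ns ! i. ip (ns ! i) (u i a) (u i b) = (if a = b then 1 else 0)) \<and>
     (\<forall>i<length ns. \<forall>p<ns ! i. \<forall>q<ns ! i. (\<Sum>a<ns ! i. u i a p * cnj (u i a q)) = (if p = q then 1 else 0)) \<and>
     (\<forall>i<length ns. \<forall>a<ns ! i. 0 \<le> e i a) \<and>
     (\<forall>x\<in>fd_carrier ns. \<mu> x =
        (\<Sum>i<length ns. \<Sum>a<ns ! i. complex_of_real (e i a) * sesq (ns ! i) (x ! i) (u i a) (u i a)))"

lemma spectral_dataD:
  assumes "spectral_data ns \<mu> u e"
  shows "\<And>i a b. i < length ns \<Longrightarrow> a < ns ! i \<Longrightarrow> b < ns ! i \<Longrightarrow>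
           ip (ns ! i) (u i a) (u i b) = (if a = b then 1 else 0)"
    and "\<And>i p q. i < length ns \<Longrightarrow> p < ns ! i \<Longrightarrow> q < ns ! i \<Longrightarrow>
           (\<Sum>a<ns ! i. u i a p * cnj (u i a q)) = (if p = q then 1 else 0)"
    and "\<And>i a. i < length ns \<Longrightarrow> a < ns ! i \<Longrightarrow> 0 \<le> e i a"
    and "\<And>x. x \<in> fd_carrier ns \<Longrightarrow> \<mu> x =
        (\<Sum>i<length ns. \<Sum>a<ns ! i. complex_of_real (e i a) * sesq (ns ! i) (x ! i) (u i a) (u i a))"
  using assms by (simp_all add: spectral_data_def)

lemma spectral_data_rank1_aux:
  assumes orth: "\<And>a b. a < ns ! i \<Longrightarrow> b < ns ! i \<Longrightarrow> ip (ns ! i) (u i a) (u i b) = (if a = b then 1 else 0)"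
    and exp: "\<mu> (fd_rank1 ns i (u i a) (u i b)) =
        (\<Sum>i'<length ns. \<Sum>c<ns ! i'. complex_of_real (e i' c) *
            sesq (ns ! i') (fd_rank1 ns i (u i a) (u i b) ! i') (u i' c) (u i' c))"
    and i: "i < length ns" and a: "a < ns ! i" and b: "b < ns ! i"
  shows "\<mu> (fd_rank1 ns i (u i a) (u i b)) = (if a = b then complex_of_real (e i a) else 0)"
proof -
  have "\<mu> (fd_rank1 ns i (u i a) (u i b)) =
      (\<Sum>i'<length ns. if i' = i then \<Sum>c<ns ! i. complex_of_real (e i c) *
         (ip (ns ! i) (u i c) (u i a) * ip (ns ! i) (u i b) (u i c)) else 0)"
    unfolding exp by (intro sum.cong refl) (auto simp: sesq_rank1 sesq_rank1_other)
  also have "\<dots> = (\<Sum>c<ns ! i. complex_of_real (e i c) *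
         (ip (ns ! i) (u i c) (u i a) * ip (ns ! i) (u i b) (u i c)))"
    using i by simp
  also have "\<dots> = (\<Sum>c<ns ! i. if c = a then (if a = b then complex_of_real (e i a) else 0) else 0)"
    using a b by (intro sum.cong refl) (auto simp: orth)
  finally show ?thesis using a by simp
qed

lemma spectral_data_rank1:
  assumes "spectral_data ns \<mu> u e" "i < length ns" "a < ns ! i" "b < ns ! i"
  shows "\<mu> (fd_rank1 ns i (u i a) (u i b)) = (if a = b then complex_of_real (e i a) else 0)"
  using assms(2-4) spectral_dataD(1)[OF assms(1)] spectral_dataD(4)[OF assms(1) fd_rank1_carrier]
  by (intro spectral_data_rank1_aux)

lemma spectral_data_sum:
  assumes sd: "spectral_data ns \<mu> u e" and "\<mu> (fd_one ns) = 1"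
  shows "(\<Sum>i<length ns. \<Sum>a<ns ! i. e i a) = 1"
proof -
  have "\<mu> (fd_one ns) = (\<Sum>i<length ns. \<Sum>a<ns ! i. complex_of_real (e i a) * sesq (ns ! i) (fd_one ns ! i) (u i a) (u i a))"
    by (rule spectral_dataD(4)[OF sd fd_one_carrier])
  also have "\<dots> = (\<Sum>i<length ns. \<Sum>a<ns ! i. complex_of_real (e i a))"
    by (intro sum.cong refl) (simp add: sesq_one spectral_dataD(1)[OF sd])
  finally have "complex_of_real (\<Sum>i<length ns. \<Sum>a<ns ! i. e i a) = 1" using assms(2) by simp
  thus ?thesis using of_real_eq_1_iff by blast
qed

text \<open>
  The adjusted entropy is a sum over blocks and eigenvalues, with the block size as an additional weight:
  \<open>- \<Sum> e log (e / n)\<close>, where \<open>n\<close> is the size of the block to which the eigenvalue \<open>e\<close> belongs.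
  After this lemma densities and functional calculus do not occur any more.
\<close>

lemma state_spectral:
  assumes st: "fd_state ns \<mu>"
  obtains u e where "spectral_data ns \<mu> u e"
    "adj_entropy b ns \<mu> = (\<Sum>i<length ns. \<Sum>a<ns ! i. e i a * log b (ns ! i) - xlogx b (e i a))"
proof -
  note L = fd_state_functional[OF st]
  define d where "d = fd_density ns \<mu>"
  have d_eq: "d = fd_of_entries ns (\<lambda>i p q. \<mu> (fd_unit ns i q p))" by (simp add: d_def fd_density_eq[OF L])
  have dc: "d \<in> fd_carrier ns" by (simp add: d_eq)
  have psd: "0 \<le> sesq (ns ! i) (d ! i) z z" if i: "i < length ns" for i z
  proof -
    have "sesq (ns ! i) (d ! i) z z = (\<Sum>p<ns ! i. \<Sum>q<ns ! i. z q * cnj (z p) * \<mu> (fd_unit ns i q p))"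
      unfolding sesq_def d_eq using i by (intro sum.cong refl) (simp add: mult_ac)
    also have "\<dots> = \<mu> (fd_rank1 ns i z z)"
      unfolding fd_functional_rank1[OF L i] by (rule sum.swap)
    finally show ?thesis using fd_state_nonneg[OF st fd_rank1_positive] by simp
  qed
  have "\<exists>U e. unitary_mat (ns ! i) U \<and>
      d ! i = U * mat_diag (ns ! i) (\<lambda>a. complex_of_real (e a)) * mat_adjoint U" if i: "i < length ns" for i
  proof (rule hermitian_unitarily_diagonalizable)
    show c: "d ! i \<in> carrier_mat (ns ! i) (ns ! i)" by (rule fd_carrier_nth[OF dc i])
    show "mat_adjoint (d ! i) = d ! i"
    proof (rule eq_matI)
      fix p q assume "p < dim_row (d ! i)" "q < dim_col (d ! i)"
      with c have pq: "p < ns ! i" "q < ns ! i" by auto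
      show "mat_adjoint (d ! i) $$ (p, q) = d ! i $$ (p, q)"
        unfolding psd_imp_hermitian[OF psd[OF i] pq] using pq c by (intro mat_adjoint_index) auto
    qed (use c in auto)
  qed
  then obtain U e where U: "\<And>i. i < length ns \<Longrightarrow> unitary_mat (ns ! i) (U i)"
    and Ue: "\<And>i. i < length ns \<Longrightarrow>
      d ! i = U i * mat_diag (ns ! i) (\<lambda>a. complex_of_real (e i a)) * mat_adjoint (U i)"
    by metis
  have Uc: "U i \<in> carrier_mat (ns ! i) (ns ! i)" if "i < length ns" for i
    using U[OF that] by (simp add: unitary_mat_def)
  define u where "u i a p = U i $$ (p, a)" for i a p
  have orth: "ip (ns ! i) (u i a) (u i b) = (if a = b then 1 else 0)"
    if i: "i < length ns" and ab: "a < ns ! i" "b < ns ! i" for i a b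
  proof -
    have "ip (ns ! i) (u i a) (u i b) = (mat_adjoint (U i) * U i) $$ (a, b)"
      using ab Uc[OF i] by (subst mat_mult_entry[of _ "ns ! i" "ns ! i" _ "ns ! i"]) (auto simp: ip_def u_def)
    also have "mat_adjoint (U i) * U i = 1\<^sub>m (ns ! i)" using U[OF i] by (simp add: unitary_mat_def)
    finally show ?thesis using ab by simp
  qed
  have compl: "(\<Sum>a<ns ! i. u i a p * cnj (u i a q)) = (if p = q then 1 else 0)"
    if i: "i < length ns" and pq: "p < ns ! i" "q < ns ! i" for i p q
  proof -
    have "(\<Sum>a<ns ! i. u i a p * cnj (u i a q)) = (U i * mat_adjoint (U i)) $$ (p, q)"
      using pq Uc[OF i] by (subst mat_mult_entry[of _ "ns ! i" "ns ! i" _ "ns ! i"]) (auto simp: u_def)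
    also have "U i * mat_adjoint (U i) = 1\<^sub>m (ns ! i)" using U[OF i] by (simp add: unitary_mat_def)
    finally show ?thesis using pq by simp
  qed
  have d_ent: "d ! i $$ (p, q) = (\<Sum>a<ns ! i. complex_of_real (e i a) * (u i a p * cnj (u i a q)))"
    if i: "i < length ns" and pq: "p < ns ! i" "q < ns ! i" for i p q
    unfolding Ue[OF i] unitary_diag_entry[OF Uc[OF i] pq] u_def ..
  have exp: "\<mu> x = (\<Sum>i<length ns. \<Sum>a<ns ! i. complex_of_real (e i a) * sesq (ns ! i) (x ! i) (u i a) (u i a))"
    if x: "x \<in> fd_carrier ns" for x
  proof -
    have "(\<Sum>p<ns ! i. \<Sum>q<ns ! i. x ! i $$ (p, q) * \<mu> (fd_unit ns i p q))
        = (\<Sum>a<ns ! i. complex_of_real (e i a) * sesq (ns ! i) (x ! i) (u i a) (u i a))"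
      if i: "i < length ns" for i
    proof -
      let ?n = "ns ! i"
      have "(\<Sum>p<?n. \<Sum>q<?n. x ! i $$ (p, q) * \<mu> (fd_unit ns i p q))
          = (\<Sum>p<?n. \<Sum>q<?n. x ! i $$ (p, q) * d ! i $$ (q, p))"
        using i by (intro sum.cong refl) (simp add: d_eq)
      also have "\<dots> = (\<Sum>p<?n. \<Sum>q<?n. \<Sum>a<?n. complex_of_real (e i a) * (cnj (u i a p) * x ! i $$ (p, q) * u i a q))"
        using i by (intro sum.cong refl) (simp add: d_ent sum_distrib_left mult_ac)
      also have "\<dots> = (\<Sum>p<?n. \<Sum>a<?n. \<Sum>q<?n. complex_of_real (e i a) * (cnj (u i a p) * x ! i $$ (p, q) * u i a q))"
        by (intro sum.cong refl sum.swap)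
      also have "\<dots> = (\<Sum>a<?n. \<Sum>p<?n. \<Sum>q<?n. complex_of_real (e i a) * (cnj (u i a p) * x ! i $$ (p, q) * u i a q))"
        by (rule sum.swap)
      finally show ?thesis by (simp add: sesq_def sum_distrib_left)
    qed
    thus ?thesis unfolding fd_functional_expand[OF L x] by (rule sum.cong[OF refl]) simp
  qed
  have e_nonneg: "0 \<le> e i a" if i: "i < length ns" and a: "a < ns ! i" for i a
  proof -
    have "\<mu> (fd_rank1 ns i (u i a) (u i a)) = complex_of_real (e i a)"
      using spectral_data_rank1_aux[of ns i u \<mu> a a e] orth[OF i] exp[OF fd_rank1_carrier] i a by simp
    thus ?thesis using fd_state_nonneg[OF st fd_rank1_positive[of ns i "u i a"]]
      by (simp add: less_eq_complex_def)
  qed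
  have sd: "spectral_data ns \<mu> u e"
    unfolding spectral_data_def by (intro conjI allI ballI impI orth compl e_nonneg exp)
  have tr: "sum_list (diag_mat (mat_fun f (d ! i))) = (\<Sum>a<ns ! i. complex_of_real (f (e i a)))"
    if i: "i < length ns" for i f
  proof -
    let ?n = "ns ! i"
    let ?X = "U i * mat_diag ?n (\<lambda>a. complex_of_real (f (e i a))) * mat_adjoint (U i)"
    have X: "mat_fun f (d ! i) = ?X"
      unfolding Ue[OF i] by (rule mat_fun_unitary_diag[OF U[OF i]])
    have "sum_list (diag_mat ?X) = (\<Sum>p<?n. ?X $$ (p, p))"
      using Uc[OF i] by (simp add: diag_mat_def sum_list_sum_nth atLeast0LessThan del: index_mult_mat(1))
    also have "\<dots> = (\<Sum>p<?n. \<Sum>a<?n. complex_of_real (f (e i a)) * (u i a p * cnj (u i a p)))"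
      by (intro sum.cong refl) (simp add: unitary_diag_entry[OF Uc[OF i]] u_def del: index_mult_mat(1))
    also have "\<dots> = (\<Sum>a<?n. \<Sum>p<?n. complex_of_real (f (e i a)) * (u i a p * cnj (u i a p)))"
      by (rule sum.swap)
    also have "\<dots> = (\<Sum>a<?n. complex_of_real (f (e i a)) * ip ?n (u i a) (u i a))"
      by (simp add: ip_def sum_distrib_left mult_ac)
    finally show ?thesis using X orth[OF i] by simp
  qed
  have "fd_tr (fd_fun (xlogx b) d) = (\<Sum>i<length ns. sum_list (diag_mat (mat_fun (xlogx b) (d ! i))))"
    using dc by (simp add: fd_tr_def fd_fun_def sum_list_sum_nth atLeast0LessThan)
  also have "\<dots> = (\<Sum>i<length ns. \<Sum>a<ns ! i. complex_of_real (xlogx b (e i a)))"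
    by (intro sum.cong refl) (simp add: tr)
  finally have part1: "fd_tr (fd_fun (xlogx b) d) = complex_of_real (\<Sum>i<length ns. \<Sum>a<ns ! i. xlogx b (e i a))"
    by simp
  have zeta: "fd_fun (log b) (fd_zeta ns) =
      fd_of_entries ns (\<lambda>i p q. if p = q then complex_of_real (log b (ns ! i)) else 0)" (is "_ = ?z")
  proof (rule nth_equalityI)
    fix i assume "i < length (fd_fun (log b) (fd_zeta ns))"
    hence i: "i < length ns" by (simp add: fd_fun_def fd_zeta_def)
    let ?n = "ns ! i"
    have u1: "unitary_mat ?n (1\<^sub>m ?n)" by (simp add: unitary_mat_def)
    have "of_nat ?n \<cdot>\<^sub>m 1\<^sub>m ?n = (1\<^sub>m ?n * mat_diag ?n (\<lambda>_. complex_of_real (real ?n))) * mat_adjoint (1\<^sub>m ?n)"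
      by (simp add: right_mult_one_mat[of _ ?n ?n] left_mult_one_mat[of _ ?n ?n])
        (intro eq_matI, auto simp: mat_diag_def)
    hence "fd_fun (log b) (fd_zeta ns) ! i = 
        mat_fun (log b) (1\<^sub>m ?n * mat_diag ?n (\<lambda>_. complex_of_real (real ?n)) * mat_adjoint (1\<^sub>m ?n))"
      using i by (simp add: fd_fun_def fd_zeta_def)
    also have "\<dots> = 1\<^sub>m ?n * mat_diag ?n (\<lambda>_. complex_of_real (log b (real ?n))) * mat_adjoint (1\<^sub>m ?n)"
      by (rule mat_fun_unitary_diag[OF u1])
    also have "\<dots> = mat_diag ?n (\<lambda>_. complex_of_real (log b (real ?n)))"
      by (simp add: right_mult_one_mat[of _ ?n ?n] left_mult_one_mat[of _ ?n ?n])
    also have "\<dots> = ?z ! i" using i by (intro eq_matI) (auto simp: mat_diag_def fd_of_entries_def)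
    finally show "fd_fun (log b) (fd_zeta ns) ! i = ?z ! i" .
  qed (simp add: fd_fun_def fd_zeta_def fd_of_entries_def)
  have "\<mu> ?z = (\<Sum>i<length ns. \<Sum>a<ns ! i. complex_of_real (e i a) * sesq (ns ! i) (?z ! i) (u i a) (u i a))"
    by (rule exp) simp
  also have "\<dots> = (\<Sum>i<length ns. \<Sum>a<ns ! i. complex_of_real (e i a * log b (ns ! i)))"
  proof (intro sum.cong refl)
    fix i a assume ia: "i \<in> {..<length ns}" "a \<in> {..<ns ! i}"
    have "sesq (ns ! i) (?z ! i) (u i a) (u i a) = complex_of_real (log b (ns ! i)) * ip (ns ! i) (u i a) (u i a)"
      using ia unfolding sesq_def ip_def sum_distrib_left
      by (intro sum.cong refl) (simp add: if_distrib[of "\<lambda>x. _ * x"] if_distrib[of "\<lambda>x. x * _"] mult_ac cong: if_cong)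
    thus "complex_of_real (e i a) * sesq (ns ! i) (?z ! i) (u i a) (u i a) = complex_of_real (e i a * log b (ns ! i))"
      using ia orth by simp
  qed
  finally have "adj_entropy b ns \<mu> = (\<Sum>i<length ns. \<Sum>a<ns ! i. e i a * log b (ns ! i) - xlogx b (e i a))"
    unfolding adj_entropy_def zeta part1[unfolded d_def] by (simp add: sum_subtractf)
  thus thesis using sd that by blast
qed

lemma sesq_functional:
  assumes "\<And>p q. p < m \<Longrightarrow> q < m \<Longrightarrow> fd_functional ns (\<lambda>a. M a $$ (p, q))"
  shows "fd_functional ns (\<lambda>a. sesq m (M a) x y)"
proof -
  have "sesq m (M (fd_add a b)) x y = sesq m (M a) x y + sesq m (M b) x y"
    if ab: "a \<in> fd_carrier ns" "b \<in> fd_carrier ns" for a b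
  proof -
    have "M (fd_add a b) $$ (p, q) = M a $$ (p, q) + M b $$ (p, q)" if "p < m" "q < m" for p q
      using assms[OF that] ab by (simp add: fd_functional_def)
    thus ?thesis unfolding sesq_def sum.distrib[symmetric]
      by (intro sum.cong refl) (simp add: algebra_simps)
  qed
  moreover have "sesq m (M (fd_smult c a)) x y = c * sesq m (M a) x y" if a: "a \<in> fd_carrier ns" for a c
  proof -
    have "M (fd_smult c a) $$ (p, q) = c * M a $$ (p, q)" if "p < m" "q < m" for p q
      using assms[OF that] a by (simp add: fd_functional_def)
    thus ?thesis unfolding sesq_def sum_distrib_left
      by (intro sum.cong refl) (simp add: mult_ac)
  qed
  ultimately show ?thesis unfolding fd_functional_def by blast
qed

lemma entry_functional:
  "j < length ns \<Longrightarrow> p < ns ! j \<Longrightarrow> q < ns ! j \<Longrightarrow> fd_functional ns (\<lambda>a. a ! j $$ (p, q))"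
  by (simp add: fd_functional_def)

lemma fd_state_iff:
  "fd_state ns \<mu> \<longleftrightarrow> fd_functional ns \<mu> \<and> (\<forall>a. fd_positive ns a \<longrightarrow> 0 \<le> \<mu> a) \<and> \<mu> (fd_one ns) = 1"
  by (auto simp: fd_state_def fd_functional_def less_eq_complex_def complex_is_Real_iff)

lemma vector_state:
  assumes j: "j < length ns" and v: "ip (ns ! j) v v = 1"
  shows "fd_state ns (\<lambda>x. sesq (ns ! j) (x ! j) v v)"
  unfolding fd_state_iff
  using sesq_functional[OF entry_functional[OF j]] fd_positive_sesq_nonneg[OF _ j] v j
  by (simp add: sesq_one)

text \<open>
  The density of a vector state is a rank one projection in block \<open>j\<close>. In terms of spectral data, the
  numbers \<open>\<mu>(u\<^sub>a u\<^sub>c*) = y\<^sub>a cnj(y\<^sub>c)\<close> vanish for \<open>a \<noteq> c\<close>, so at most one eigenvalue differs from zero.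
\<close>

lemma vector_state_entropy:
  assumes j: "j < length ns" and v: "ip (ns ! j) v v = 1"
  shows "adj_entropy b ns (\<lambda>x. sesq (ns ! j) (x ! j) v v) = log b (ns ! j)"
proof -
  let ?\<mu> = "\<lambda>x. sesq (ns ! j) (x ! j) v v"
  obtain u e where sd: "spectral_data ns ?\<mu> u e" and
    ent: "adj_entropy b ns ?\<mu> = (\<Sum>i<length ns. \<Sum>a<ns ! i. e i a * log b (ns ! i) - xlogx b (e i a))"
    using state_spectral[OF vector_state[OF assms]] by blast
  have sum1: "(\<Sum>i<length ns. \<Sum>a<ns ! i. e i a) = 1"
    using spectral_data_sum[OF sd] v j by (simp add: sesq_one)
  have other: "e i a = 0" if "i < length ns" "a < ns ! i" "i \<noteq> j" for i a
    using spectral_data_rank1[OF sd that(1,2,2)] sesq_rank1_other[OF j that(3)[symmetric]] by simp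
  define y where "y a = ip (ns ! j) v (u j a)" for a
  have y_cnj: "ip (ns ! j) (u j a) v = cnj (y a)" for a
    by (simp add: y_def ip_def mult.commute)
  have yy: "y a * cnj (y c) = (if a = c then complex_of_real (e j a) else 0)" if "a < ns ! j" "c < ns ! j" for a c
    using spectral_data_rank1[OF sd j that] unfolding sesq_rank1[OF j] y_cnj y_def[symmetric] .
  have ee: "e j a * e j c = 0" if "a < ns ! j" "c < ns ! j" "a \<noteq> c" for a c
  proof -
    have "complex_of_real (e j a * e j c) = (y a * cnj (y a)) * (y c * cnj (y c))"
      using yy[OF that(1,1)] yy[OF that(2,2)] by simp
    also have "\<dots> = (y a * cnj (y c)) * (y c * cnj (y a))" by (simp only: mult_ac)
    also have "\<dots> = 0" using yy[OF that(1,2)] that(3) by simp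
    finally show ?thesis by (simp only: of_real_eq_0_iff)
  qed
  have "(\<Sum>i<length ns. \<Sum>a<ns ! i. e i a) = (\<Sum>i<length ns. if i = j then \<Sum>a<ns ! j. e j a else 0)"
    using other by (intro sum.cong refl) auto
  hence sumj: "(\<Sum>a<ns ! j. e j a) = 1" using sum1 j by simp
  have zero_one: "xlogx b (e j a) = 0" if a: "a < ns ! j" for a
  proof -
    have "e j a = e j a * (\<Sum>c<ns ! j. e j c)" by (simp add: sumj)
    also have "\<dots> = (\<Sum>c<ns ! j. if c = a then e j a * e j a else 0)"
      unfolding sum_distrib_left using ee[OF a] by (intro sum.cong refl) auto
    also have "\<dots> = e j a * e j a" using a by simp
    finally have "e j a = 0 \<or> e j a = 1" by simp
    thus ?thesis by (auto simp: xlogx_def)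
  qed
  have "adj_entropy b ns ?\<mu> = (\<Sum>i<length ns. if i = j then \<Sum>a<ns ! j. e j a * log b (ns ! j) else 0)"
    unfolding ent using other zero_one by (intro sum.cong refl) (auto simp: xlogx_def)
  also have "\<dots> = log b (ns ! j)"
    using j sumj by (simp add: sum_distrib_right[symmetric])
  finally show ?thesis .
qed

lemma fd_state_amp:
  assumes cp: "fd_completely_positive ns ms \<phi>" and u: "fd_unital ns ms \<phi>" and k: "0 < k"
    and st: "fd_state (amp_sizes k ms) \<mu>"
  shows "fd_state (amp_sizes k ns) (\<mu> \<circ> amp_map k ns ms \<phi>)"
proof -
  have lin: "fd_linear_map (amp_sizes k ns) (amp_sizes k ms) (amp_map k ns ms \<phi>)"
    by (rule amp_map_linear[OF cp_linear[OF cp]])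
  have "fd_functional (amp_sizes k ns) (\<mu> \<circ> amp_map k ns ms \<phi>)"
    using lin fd_state_functional[OF st] by (simp add: fd_functional_def fd_linear_map_def)
  thus ?thesis
    using st cp k amp_map_unital[OF cp_linear[OF cp] u, of k]
    by (simp add: fd_state_iff fd_completely_positive_def fd_unital_def)
qed

section \<open>The Choi matrix of a unital completely positive map\<close>

lemma fd_unit_star_mult:
  assumes "i < length ns" "r < ns ! i"
  shows "fd_mult (fd_star (fd_unit ns i r p)) (fd_unit ns i r q) = fd_unit ns i p q"
proof (rule fd_eqI[of _ ns])
  fix i' p' q' assume i': "i' < length ns" "p' < ns ! i'" "q' < ns ! i'"
  have "fd_mult (fd_star (fd_unit ns i r p)) (fd_unit ns i r q) ! i' $$ (p', q') =
      (\<Sum>t<ns ! i'. if t = r then if i' = i \<and> p' = p \<and> q' = q then 1 else 0 else 0)"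
    unfolding fd_mult_entry[OF fd_star_carrier[OF fd_unit_carrier] fd_unit_carrier i']
    using i' by (intro sum.cong refl) (auto simp: fd_star_entry[of _ ns])
  also have "\<dots> = (if i' = i \<and> p' = p \<and> q' = q then 1 else 0)"
    using assms i' by auto
  finally show "fd_mult (fd_star (fd_unit ns i r p)) (fd_unit ns i r q) ! i' $$ (p', q') =
      fd_unit ns i p q ! i' $$ (p', q')" using i' by simp
qed auto

lemma fd_star_unit: "fd_star (fd_unit ns i p q) = fd_unit ns i q p"
  by (intro fd_eqI[of _ ns]) (auto simp: fd_star_entry[of _ ns])

lemma sesq_uminus: 
  "sesq m M (\<lambda>p. - x p) y = - sesq m M x y" "sesq m M x (\<lambda>p. - y p) = - sesq m M x y"
  by (simp_all add: sesq_def sum_negf)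

text \<open>
  The images of the diagonal matrix units are positive and add up to the identity.
\<close>

lemma cp_unit_diag_le:
  assumes cp: "fd_completely_positive ns ms \<phi>" and un: "fd_unital ns ms \<phi>" and j: "j < length ms"
    and i: "i < length ns" and p: "p < ns ! i"
  shows "sesq (ms ! j) (\<phi> (fd_unit ns i p p) ! j) x x \<le> ip (ms ! j) x x"
proof -
  let ?L = "\<lambda>a. sesq (ms ! j) (\<phi> a ! j) x x"
  have L: "fd_functional ns ?L"
    by (rule sesq_functional) (rule fd_functional_entry[OF cp_linear[OF cp] j])
  have nn: "0 \<le> ?L (fd_unit ns i' q q)" if "i' < length ns" "q < ns ! i'" for i' q
    using cp_form_nonneg[OF cp j, of 1 "\<lambda>_. fd_unit ns i' q q" "\<lambda>_. x"] fd_unit_star_mult[OF that] by simp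
  have "?L (fd_unit ns i p p) \<le> (\<Sum>q<ns ! i. ?L (fd_unit ns i q q))"
    using p nn[OF i] by (intro member_le_sum) auto
  also have "\<dots> \<le> (\<Sum>i'<length ns. \<Sum>q<ns ! i'. ?L (fd_unit ns i' q q))"
    using i nn by (intro member_le_sum[of i _ "\<lambda>i'. \<Sum>q<ns ! i'. ?L (fd_unit ns i' q q)"]) (auto intro!: sum_nonneg)
  also have "\<dots> = (\<Sum>i'<length ns. \<Sum>q<ns ! i'. \<Sum>q'<ns ! i'. fd_one ns ! i' $$ (q, q') * ?L (fd_unit ns i' q q'))"
    by (intro sum.cong refl) (simp add: if_distrib[of "\<lambda>x. x * _"] cong: if_cong)
  also have "\<dots> = ?L (fd_one ns)"
    by (rule fd_functional_expand[OF L fd_one_carrier, symmetric])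
  also have "\<dots> = ip (ms ! j) x x" using un j by (simp add: fd_unital_def sesq_one)
  finally show ?thesis .
qed

text \<open>
  The Choi matrix of \<open>\<phi>\<close> on the block of size \<open>n\<close> is at most \<open>n\<close>. In the semidefinite inner product
  \<open>\<langle>y \<otimes> \<xi>, y' \<otimes> \<xi>'\<rangle> = \<langle>\<xi>, \<phi>(y* y') \<xi>'\<rangle>\<close> the left hand side is \<open>\<parallel>\<Sum>p. E\<^sub>0\<^sub>p \<otimes> \<zeta>\<^sub>p\<parallel>\<^sup>2\<close>, and the square of
  a sum of \<open>n\<close> vectors is at most \<open>n\<close> times the sum of their squares.
\<close>

lemma cp_choi_le:
  assumes cp: "fd_completely_positive ns ms \<phi>" and un: "fd_unital ns ms \<phi>" and j: "j < length ms"
    and i: "i < length ns"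
  shows "(\<Sum>p<ns ! i. \<Sum>q<ns ! i. sesq (ms ! j) (\<phi> (fd_unit ns i p q) ! j) (\<zeta> p) (\<zeta> q))
       \<le> of_nat (ns ! i) * (\<Sum>p<ns ! i. ip (ms ! j) (\<zeta> p) (\<zeta> p))"
proof -
  let ?n = "ns ! i"
  define F where "F p q = sesq (ms ! j) (\<phi> (fd_unit ns i p q) ! j) (\<zeta> p) (\<zeta> q)" for p q
  \<comment> \<open>The square of a difference; row 0 exists because block \<open>i\<close> has positive size.\<close>
  have pair: "0 \<le> F p p - F p q - F q p + F q q" if pq: "p < ?n" "q < ?n" for p q
  proof -
    have n0: "0 < ?n" using pq by simp
    have "0 \<le> (\<Sum>r<2. \<Sum>s<2. sesq (ms ! j)
       (\<phi> (fd_mult (fd_star (fd_unit ns i 0 (if r = (0::nat) then p else q))) (fd_unit ns i 0 (if s = (0::nat) then p else q))) ! j)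
        (if r = 0 then \<zeta> p else (\<lambda>l. - \<zeta> q l)) (if s = 0 then \<zeta> p else (\<lambda>l. - \<zeta> q l)))"
      by (intro cp_form_nonneg[OF cp j]) auto
    thus ?thesis
      by (simp add: numeral_2_eq_2 fd_unit_star_mult[OF i n0] sesq_uminus F_def algebra_simps)
  qed
  have "0 \<le> (\<Sum>p<?n. \<Sum>q<?n. F p p - F p q - F q p + F q q)"
    using pair by (intro sum_nonneg) auto
  also have "\<dots> = 2 * (of_nat ?n * (\<Sum>p<?n. F p p) - (\<Sum>p<?n. \<Sum>q<?n. F p q))"
    using sum.swap[of "\<lambda>p q. F q p" "{..<?n}" "{..<?n}"]
    by (simp add: sum.distrib sum_subtractf sum_distrib_left sum_negf)
  finally have "(\<Sum>p<?n. \<Sum>q<?n. F p q) \<le> of_nat ?n * (\<Sum>p<?n. F p p)"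
    by (simp add: less_eq_complex_def)
  also have "\<dots> \<le> of_nat ?n * (\<Sum>p<?n. ip (ms ! j) (\<zeta> p) (\<zeta> p))"
    unfolding F_def
    by (intro mult_left_mono sum_mono cp_unit_diag_le[OF cp un j i]) (auto simp: less_eq_complex_def)
  finally show ?thesis unfolding F_def .
qed

lemma fd_functional_eqI:
  assumes L: "fd_functional ns L" and K: "fd_functional ns K"
    and eq: "\<And>i p q. i < length ns \<Longrightarrow> p < ns ! i \<Longrightarrow> q < ns ! i \<Longrightarrow> L (fd_unit ns i p q) = K (fd_unit ns i p q)"
    and a: "a \<in> fd_carrier ns"
  shows "L a = K a"
  unfolding fd_functional_expand[OF L a] fd_functional_expand[OF K a]
  by (intro sum.cong refl) (simp add: eq)

lemma fd_mult_add_left: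
  assumes "a \<in> fd_carrier ns" "b \<in> fd_carrier ns" "x \<in> fd_carrier ns"
  shows "fd_mult (fd_add a b) x = fd_add (fd_mult a x) (fd_mult b x)"
  using assms by (intro fd_eqI[of _ ns])
    (auto simp: fd_mult_entry[of _ ns] fd_add_entry[of _ ns] sum.distrib algebra_simps)

lemma fd_mult_smult_left:
  assumes "a \<in> fd_carrier ns" "x \<in> fd_carrier ns"
  shows "fd_mult (fd_smult c a) x = fd_smult c (fd_mult a x)"
  using assms by (intro fd_eqI[of _ ns])
    (auto simp: fd_mult_entry[of _ ns] fd_smult_entry[of _ ns] sum_distrib_left mult.assoc)

text \<open>
  The hypothesis says, on the diagonal, that the Choi matrix \<open>C\<close> satisfies \<open>C\<^sup>2 = n C\<close>. It makes the sum
  over \<open>q\<close> of the Schwarz defects \<open>\<phi>(E\<^sub>p\<^sub>q E\<^sub>q\<^sub>p) - \<phi>(E\<^sub>p\<^sub>q) \<phi>(E\<^sub>q\<^sub>p)\<close> vanish at each diagonal entry. Every defect is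
  nonnegative, so all of them vanish and every matrix unit lies in the multiplicative domain.
\<close>

lemma cp_hom_if_choi_square:
  assumes cp: "fd_completely_positive ns ms \<phi>" and un: "fd_unital ns ms \<phi>"
    and sq: "\<And>j i p r. j < length ms \<Longrightarrow> i < length ns \<Longrightarrow> p < ns ! i \<Longrightarrow> r < ms ! j \<Longrightarrow>
       (\<Sum>q<ns ! i. fd_mult (\<phi> (fd_unit ns i p q)) (\<phi> (fd_unit ns i q p)) ! j $$ (r, r))
         = of_nat (ns ! i) * \<phi> (fd_unit ns i p p) ! j $$ (r, r)"
  shows "fd_hom ns ms \<phi>"
proof -
  note lin = cp_linear[OF cp]
  note phi_c = fd_linear_map_carrier[OF lin]
  have unit: "\<phi> (fd_mult (fd_unit ns i p q) x) ! j $$ (r, s) = fd_mult (\<phi> (fd_unit ns i p q)) (\<phi> x) ! j $$ (r, s)"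
    if i: "i < length ns" and p: "p < ns ! i" and q: "q < ns ! i" and x: "x \<in> fd_carrier ns"
      and j: "j < length ms" and r: "r < ms ! j" and s: "s < ms ! j" for i p q x j r s
  proof (rule cp_multiplicative_domain[OF cp un j _ x r s])
    define D where "D q = \<phi> (fd_unit ns i p p) ! j $$ (r, r)
        - fd_mult (\<phi> (fd_unit ns i p q)) (\<phi> (fd_unit ns i q p)) ! j $$ (r, r)" for q
    have D_nonneg: "0 \<le> D q" if "q < ns ! i" for q
      using cp_defect_nonneg[OF cp un j fd_unit_carrier r, of i q p] fd_unit_star_mult[OF i that]
      by (simp add: D_def fd_star_unit cp_star[OF cp un, symmetric])
    have "(\<Sum>q<ns ! i. D q) = 0"
      unfolding D_def sum_subtractf sq[OF j i p r] by simp
    hence "D q = 0" using D_nonneg q sum_nonneg_eq_0_iff[of "{..<ns ! i}" D] by auto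
    moreover have "fd_mult (fd_unit ns i p q) (fd_star (fd_unit ns i p q)) = fd_unit ns i p p"
      using fd_unit_star_mult[OF i q, of p p] by (simp add: fd_star_unit)
    ultimately show "\<phi> (fd_mult (fd_unit ns i p q) (fd_star (fd_unit ns i p q))) ! j $$ (r, r)
        = fd_mult (\<phi> (fd_unit ns i p q)) (\<phi> (fd_star (fd_unit ns i p q))) ! j $$ (r, r)"
      by (simp add: D_def fd_star_unit)
  qed auto
  have "\<phi> (fd_mult a x) = fd_mult (\<phi> a) (\<phi> x)" if a: "a \<in> fd_carrier ns" and x: "x \<in> fd_carrier ns" for a x
  proof (rule fd_eqI[of _ ms])
    fix j r s assume j: "j < length ms" "r < ms ! j" "s < ms ! j"
    show "\<phi> (fd_mult a x) ! j $$ (r, s) = fd_mult (\<phi> a) (\<phi> x) ! j $$ (r, s)"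
    proof (rule fd_functional_eqI[OF _ _ _ a])
      show "fd_functional ns (\<lambda>a. \<phi> (fd_mult a x) ! j $$ (r, s))"
        using fd_functional_entry[OF lin j] x
        by (simp add: fd_functional_def fd_mult_add_left[of _ ns] fd_mult_smult_left[of _ ns])
      have "\<phi> (fd_add a b) = fd_add (\<phi> a) (\<phi> b)" "\<phi> (fd_smult c a) = fd_smult c (\<phi> a)"
        if "a \<in> fd_carrier ns" "b \<in> fd_carrier ns" for a b c
        using lin that unfolding fd_linear_map_def by auto
      thus "fd_functional ns (\<lambda>a. fd_mult (\<phi> a) (\<phi> x) ! j $$ (r, s))"
        using x j phi_c
        by (simp add: fd_functional_def fd_mult_add_left[of _ ms] fd_mult_smult_left[of _ ms]
            fd_add_entry[of _ ms] fd_smult_entry[of _ ms])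
    qed (rule unit[OF _ _ _ x j])
  qed (use a x phi_c in auto)
  thus ?thesis using lin cp_star[OF cp un] unfolding fd_hom_def by blast
qed

section \<open>Maximally entangled states force multiplicativity\<close>

text \<open>
  The maximally entangled unit vector of \<open>\<complex>\<^sup>m \<otimes> \<complex>\<^sup>m\<close>; in the block of size \<open>m * m\<close> the position
  \<open>r * m + p\<close> stands for the pair \<open>(r, p)\<close>.
\<close>

definition maxent_vec :: "nat \<Rightarrow> nat \<Rightarrow> complex" where
  "maxent_vec m P = (if P div m = P mod m then complex_of_real (1 / sqrt m) else 0)"

lemma maxent_vec_block:
  "p < m \<Longrightarrow> maxent_vec m (r * m + p) = (if r = p then complex_of_real (1 / sqrt m) else 0)"
  by (simp add: maxent_vec_def)

lemma sqrt_inverse_square: "0 < m \<Longrightarrow> complex_of_real (1 / sqrt (real m)) * complex_of_real (1 / sqrt (real m)) = 1 / of_nat m"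
  by (simp flip: of_real_mult)

lemma sesq_maxent:
  "sesq (m * m) M (maxent_vec m) (maxent_vec m) = (\<Sum>r<m. \<Sum>s<m. M $$ (r * m + r, s * m + s)) / of_nat m"
proof (cases "m = 0")
  case False
  let ?c = "complex_of_real (1 / sqrt m)"
  have "sesq (m * m) M (maxent_vec m) (maxent_vec m) =
      (\<Sum>r<m. \<Sum>p<m. \<Sum>s<m. \<Sum>q<m. if q = s then if p = r then
          (?c * ?c) * M $$ (r * m + p, s * m + q) else 0 else 0)"
    unfolding sesq_def sum_blocks
    by (intro sum.cong refl) (simp add: maxent_vec_block mult_ac)
  also have "\<dots> = (\<Sum>r<m. \<Sum>p<m. if p = r then (\<Sum>s<m. (?c * ?c) * M $$ (r * m + p, s * m + s)) else 0)"
    by (intro sum.cong refl) simp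
  also have "\<dots> = (\<Sum>r<m. \<Sum>s<m. (?c * ?c) * M $$ (r * m + r, s * m + s))"
    by (rule sum.cong[OF refl]) simp
  also have "?c * ?c = 1 / of_nat m" using False by (intro sqrt_inverse_square) simp
  finally show ?thesis by (simp add: sum_divide_distrib)
qed (simp add: sesq_def)

lemma ip_maxent:
  assumes "0 < m"
  shows "ip (m * m) (maxent_vec m) (maxent_vec m) = 1"
proof -
  let ?c = "complex_of_real (1 / sqrt m)"
  have "ip (m * m) (maxent_vec m) (maxent_vec m) = (\<Sum>r<m. \<Sum>p<m. if p = r then ?c * ?c else 0)"
    unfolding ip_def sum_blocks by (intro sum.cong refl) (simp add: maxent_vec_block)
  also have "\<dots> = of_nat m * (?c * ?c)" by simp
  also have "?c * ?c = 1 / of_nat m" using assms by (rule sqrt_inverse_square)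
  finally show ?thesis using assms by simp
qed

lemma amp_entry_rank1:
  "r < k \<Longrightarrow> s < k \<Longrightarrow> i < length ns \<Longrightarrow>
   amp_entry ns (fd_rank1 (amp_sizes k ns) i x y) r s =
     fd_rank1 ns i (\<lambda>p. x (r * ns ! i + p)) (\<lambda>q. y (s * ns ! i + q))"
  by (intro fd_eqI[of _ ns]) (auto simp: block_index_less)

lemma amp_entry_unit:
  assumes "r < k" "s < k" "i < length ns" "r' < k" "s' < k" "p < ns ! i" "q < ns ! i"
  shows "amp_entry ns (fd_unit (amp_sizes k ns) i (r' * ns ! i + p) (s' * ns ! i + q)) r s =
     fd_smult (if r = r' \<and> s = s' then 1 else 0) (fd_unit ns i p q)"
proof (rule fd_eqI[of _ ns])
  fix i' p' q' assume i': "i' < length ns" "p' < ns ! i'" "q' < ns ! i'"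
  have inj: "a * n + b = a' * n + b' \<longleftrightarrow> a = a' \<and> b = b'" if "b < n" "b' < n" for a a' b b' n :: nat
    using that by (metis add_left_cancel div_mult_self3 div_less add.right_neutral less_nat_zero_code)
  show "amp_entry ns (fd_unit (amp_sizes k ns) i (r' * ns ! i + p) (s' * ns ! i + q)) r s ! i' $$ (p', q') =
      fd_smult (if r = r' \<and> s = s' then 1 else 0) (fd_unit ns i p q) ! i' $$ (p', q')"
    using i' assms by (auto simp: block_index_less fd_smult_entry[of _ ns] inj)
qed auto

text \<open>
  The density of the pullback of the maximally entangled state is the Choi matrix divided by \<open>m\<close>, so
  the bound on the Choi matrix bounds its eigenvalues by \<open>n / m\<close>.
\<close>

lemma maxent_spectrum_le:
  assumes cp: "fd_completely_positive ns ms \<phi>" and un: "fd_unital ns ms \<phi>" and j: "j < length ms"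
    and m: "0 < ms ! j" and i: "i < length ns"
    and x: "ip (ms ! j * ns ! i) x x = 1"
  shows "sesq (ms ! j * ms ! j) (amp_map (ms ! j) ns ms \<phi> (fd_rank1 (amp_sizes (ms ! j) ns) i x x) ! j)
      (maxent_vec (ms ! j)) (maxent_vec (ms ! j)) \<le> complex_of_real (real (ns ! i) / real (ms ! j))"
proof -
  let ?m = "ms ! j" and ?n = "ns ! i"
  define \<Phi> where "\<Phi> p q = \<phi> (fd_unit ns i p q) ! j" for p q
  define \<zeta> where "\<zeta> p r = cnj (x (r * ?n + p))" for p r
  have "(\<Sum>r<?m. \<Sum>s<?m. amp_map ?m ns ms \<phi> (fd_rank1 (amp_sizes ?m ns) i x x) ! j $$ (r * ?m + r, s * ?m + s))
      = (\<Sum>r<?m. \<Sum>s<?m. \<Sum>p<?n. \<Sum>q<?n. cnj (\<zeta> p r) * \<Phi> p q $$ (r, s) * \<zeta> q s)"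
    using j i by (intro sum.cong refl)
      (simp add: amp_map_block_entry amp_entry_rank1 \<zeta>_def \<Phi>_def mult_ac
        fd_functional_rank1[OF fd_functional_entry[OF cp_linear[OF cp]]])
  also have "\<dots> = (\<Sum>r<?m. \<Sum>p<?n. \<Sum>s<?m. \<Sum>q<?n. cnj (\<zeta> p r) * \<Phi> p q $$ (r, s) * \<zeta> q s)"
    by (intro sum.cong refl sum.swap)
  also have "\<dots> = (\<Sum>p<?n. \<Sum>r<?m. \<Sum>s<?m. \<Sum>q<?n. cnj (\<zeta> p r) * \<Phi> p q $$ (r, s) * \<zeta> q s)"
    by (rule sum.swap)
  also have "\<dots> = (\<Sum>p<?n. \<Sum>r<?m. \<Sum>q<?n. \<Sum>s<?m. cnj (\<zeta> p r) * \<Phi> p q $$ (r, s) * \<zeta> q s)"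
    by (intro sum.cong refl sum.swap)
  also have "\<dots> = (\<Sum>p<?n. \<Sum>q<?n. \<Sum>r<?m. \<Sum>s<?m. cnj (\<zeta> p r) * \<Phi> p q $$ (r, s) * \<zeta> q s)"
    by (intro sum.cong[OF refl] sum.swap)
  also have "\<dots> = (\<Sum>p<?n. \<Sum>q<?n. sesq ?m (\<Phi> p q) (\<zeta> p) (\<zeta> q))"
    by (simp add: sesq_def)
  also have "\<dots> \<le> of_nat ?n * (\<Sum>p<?n. ip ?m (\<zeta> p) (\<zeta> p))"
    unfolding \<Phi>_def by (rule cp_choi_le[OF cp un j i])
  also have "(\<Sum>p<?n. ip ?m (\<zeta> p) (\<zeta> p)) = (\<Sum>r<?m. \<Sum>p<?n. cnj (\<zeta> p r) * \<zeta> p r)"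
    unfolding ip_def by (rule sum.swap)
  also have "\<dots> = ip (?m * ?n) x x"
    unfolding ip_def sum_blocks by (simp add: \<zeta>_def mult.commute)
  finally have "(\<Sum>r<?m. \<Sum>s<?m. amp_map ?m ns ms \<phi> (fd_rank1 (amp_sizes ?m ns) i x x) ! j $$ (r * ?m + r, s * ?m + s))
      \<le> of_nat ?n" (is "?S \<le> _") using x by simp
  hence "?S / of_nat ?m \<le> of_nat ?n / of_nat ?m"
    using m by (simp add: less_eq_complex_def divide_right_mono)
  thus ?thesis unfolding sesq_maxent by simp
qed

text \<open>
  For \<open>t > 0\<close> the gap equals \<open>t (log (n / m) - log t)\<close>.
\<close>

lemma xlogx_gap_nonneg:
  fixes t :: real
  assumes b: "1 < b" and m: "0 < m" and n: "0 < n" and t: "0 \<le> t" "t \<le> n / m"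
  shows "0 \<le> t * log b (m * n) - xlogx b t - t * log b (m * m)"
    and "t * log b (m * n) - xlogx b t - t * log b (m * m) = 0 \<Longrightarrow> t = 0 \<or> t = n / m"
proof -
  have eq: "t * log b (m * n) - xlogx b t - t * log b (m * m) = t * (log b (n / m) - log b t)" if "0 < t"
    using that b m n by (simp add: xlogx_def log_mult log_divide algebra_simps)
  have "log b t \<le> log b (n / m)" if "0 < t" using that t b m n by (simp add: log_le_cancel_iff)
  thus "0 \<le> t * log b (m * n) - xlogx b t - t * log b (m * m)"
    using eq t by (cases "t = 0") (auto simp: xlogx_def)
  show "t = 0 \<or> t = n / m" if z: "t * log b (m * n) - xlogx b t - t * log b (m * m) = 0"
  proof (cases "t = 0")
    case False
    hence t0: "0 < t" using t by simp
    hence "log b t = log b (n / m)" using z eq by simp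
    thus ?thesis using t0 b m n by (simp add: log_inj[THEN inj_onD])
  qed simp
qed

text \<open>
  The maximally entangled state on \<open>B \<otimes> M\<^sub>m\<close>, supported in block \<open>j\<close> of size \<open>m\<close>, has adjusted entropy
  \<open>log (m * m)\<close>. Since the eigenvalues of the density of its pullback are bounded by \<open>n / m\<close>, the
  adjusted entropy of the pullback is at least \<open>log (m * m)\<close>. The hypothesis forces equality, hence every
  eigenvalue is \<open>0\<close> or \<open>n / m\<close>, and the density satisfies a quadratic equation.
\<close>

lemma entropy_condition_imp_choi_square:
  assumes ns: "fd_cstar ns" and ms: "fd_cstar ms"
    and cp: "fd_completely_positive ns ms \<phi>" and un: "fd_unital ns ms \<phi>" and b: "1 < b"
    and ent: "\<And>k \<mu>. 0 < k \<Longrightarrow> fd_state (amp_sizes k ms) \<mu> \<Longrightarrow>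
       adj_entropy b (amp_sizes k ns) (\<mu> \<circ> amp_map k ns ms \<phi>) \<le> adj_entropy b (amp_sizes k ms) \<mu>"
    and j: "j < length ms" and i: "i < length ns" and p: "p < ns ! i" and r: "r < ms ! j"
  shows "(\<Sum>q<ns ! i. fd_mult (\<phi> (fd_unit ns i p q)) (\<phi> (fd_unit ns i q p)) ! j $$ (r, r))
         = of_nat (ns ! i) * \<phi> (fd_unit ns i p p) ! j $$ (r, r)"
proof -
  define m where "m = ms ! j"
  have m0: "0 < m" using ms j by (simp add: fd_cstar_def m_def)
  let ?A = "amp_sizes m ns" and ?B = "amp_sizes m ms"
  have Bj: "?B ! j = m * m" using j by (simp add: m_def)
  have jB: "j < length ?B" using j by simp
  define \<mu> where "\<mu> x = sesq (?B ! j) (x ! j) (maxent_vec m) (maxent_vec m)" for x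
  have ip1: "ip (?B ! j) (maxent_vec m) (maxent_vec m) = 1" unfolding Bj by (rule ip_maxent[OF m0])
  have st: "fd_state ?B \<mu>"
    unfolding \<mu>_def by (rule vector_state[OF jB ip1])
  have entB: "adj_entropy b ?B \<mu> = log b (real m * real m)"
    using vector_state_entropy[OF jB ip1, of b] unfolding \<mu>_def Bj by simp
  define \<nu> where "\<nu> = \<mu> \<circ> amp_map m ns ms \<phi>"
  have stA: "fd_state ?A \<nu>" unfolding \<nu>_def by (rule fd_state_amp[OF cp un m0 st])
  have \<nu>_eq: "\<nu> x = (\<Sum>r<m. \<Sum>s<m. \<phi> (amp_entry ns x r s) ! j $$ (r, s)) / of_nat m" for x
    unfolding \<nu>_def \<mu>_def comp_def Bj sesq_maxent
    using j by (simp add: amp_map_block_entry m_def)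
  obtain u e where sd: "spectral_data ?A \<nu> u e" and
    entA: "adj_entropy b ?A \<nu> = (\<Sum>i<length ?A. \<Sum>a<?A ! i. e i a * log b (?A ! i) - xlogx b (e i a))"
    using state_spectral[OF stA] by blast
  have sum1: "(\<Sum>i<length ?A. \<Sum>a<?A ! i. e i a) = 1"
    using spectral_data_sum[OF sd] stA by (simp add: fd_state_iff)
  have e_le: "e i a \<le> real (ns ! i) / real m" if ia: "i < length ns" "a < m * ns ! i" for i a
  proof -
    have ia': "i < length ?A" "a < ?A ! i" using ia by simp_all
    have "ip (m * ns ! i) (u i a) (u i a) = 1" using spectral_dataD(1)[OF sd ia' ia'(2)] ia by simp
    hence "\<nu> (fd_rank1 ?A i (u i a) (u i a)) \<le> complex_of_real (real (ns ! i) / real m)"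
      using maxent_spectrum_le[OF cp un j _ ia(1), of "u i a"] m0
      unfolding \<nu>_def \<mu>_def comp_def Bj unfolding m_def by blast
    thus ?thesis unfolding spectral_data_rank1[OF sd ia' ia'(2)] by (simp add: less_eq_complex_def)
  qed
  have n0: "0 < ns ! i" if "i < length ns" for i using ns that by (simp add: fd_cstar_def)
  \<comment> \<open>The excess of the entropy of the pullback over \<open>log (m * m)\<close> is the sum of the nonnegative gaps \<open>G\<close>.\<close>
  define G where "G i a = e i a * log b (real m * real (ns ! i)) - xlogx b (e i a) - e i a * log b (real m * real m)" for i a
  have e0: "0 \<le> e i a" if "i < length ns" "a < m * ns ! i" for i a
    using spectral_dataD(3)[OF sd] that by simp
  have G0: "0 \<le> G i a" if "i < length ns" "a < m * ns ! i" for i a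
    unfolding G_def using e0[OF that] e_le[OF that] n0[OF that(1)] m0 b by (intro xlogx_gap_nonneg) auto
  have "(\<Sum>i<length ns. \<Sum>a<m * ns ! i. G i a) = adj_entropy b ?A \<nu> - log b (real m * real m)"
    using sum1 unfolding entA G_def
    by (simp add: sum_subtractf sum_distrib_right[symmetric])
  also have "\<dots> \<le> 0" using ent[OF m0 st] entB unfolding \<nu>_def by simp
  finally have G_sum: "(\<Sum>i<length ns. \<Sum>a<m * ns ! i. G i a) = 0"
    using G0 by (intro antisym sum_nonneg) auto
  have G_zero: "G i a = 0" if a: "a < m * ns ! i" for a
  proof -
    have "(\<Sum>a<m * ns ! i. G i a) = 0"
      using G_sum i G0 sum_nonneg_eq_0_iff[of "{..<length ns}" "\<lambda>i. \<Sum>a<m * ns ! i. G i a"]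
      by (auto intro: sum_nonneg)
    thus ?thesis using a i G0 sum_nonneg_eq_0_iff[of "{..<m * ns ! i}" "G i"] by auto
  qed
  have e_sq: "e i a * e i a = real (ns ! i) / real m * e i a" if a: "a < m * ns ! i" for a
    using xlogx_gap_nonneg(2)[OF b _ _ e0[OF i a] e_le[OF i a]] m0 n0[OF i] G_zero[OF a]
    by (auto simp: G_def)
  \<comment> \<open>The entries of the transposed density: they are computed once from the spectral data, where squaring
    is easy, and once from \<open>\<phi>\<close>, where they are entries of the Choi matrix.\<close>
  define g where "g P Q = \<nu> (fd_unit ?A i P Q)" for P Q
  let ?N = "m * ns ! i"
  have iA: "i < length ?A" "?A ! i = ?N" using i by simp_all
  have g_eq: "g P Q = (\<Sum>a<?N. complex_of_real (e i a) * (cnj (u i a P) * u i a Q))"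
    if PQ: "P < ?N" "Q < ?N" for P Q
  proof -
    have "g P Q = (\<Sum>i'<length ?A. if i' = i then \<Sum>a<?N. complex_of_real (e i a) * (cnj (u i a P) * u i a Q) else 0)"
      unfolding g_def spectral_dataD(4)[OF sd fd_unit_carrier]
    proof (intro sum.cong[OF refl])
      fix i' assume i': "i' \<in> {..<length ?A}"
      have "sesq (?A ! i') (fd_unit ?A i P Q ! i') (u i' a) (u i' a) =
          (if i' = i then cnj (u i a P) * u i a Q else 0)" for a
      proof -
        have "sesq (?A ! i') (fd_unit ?A i P Q ! i') (u i' a) (u i' a) = (\<Sum>p<?A ! i'. \<Sum>q<?A ! i'.
            if i' = i then if p = P then if q = Q then cnj (u i a P) * u i a Q else 0 else 0 else 0)"
          unfolding sesq_def using i' by (intro sum.cong refl) simp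
        also have "\<dots> = (if i' = i then cnj (u i a P) * u i a Q else 0)"
          using PQ i unfolding sum_if_const by simp
        finally show ?thesis .
      qed
      thus "(\<Sum>a<?A ! i'. complex_of_real (e i' a) * sesq (?A ! i') (fd_unit ?A i P Q ! i') (u i' a) (u i' a)) =
          (if i' = i then \<Sum>a<?N. complex_of_real (e i a) * (cnj (u i a P) * u i a Q) else 0)"
        using i by simp
    qed
    thus ?thesis using iA by simp
  qed
  have g_sq: "(\<Sum>S<?N. g P S * g S Q) = of_nat (ns ! i) / of_nat m * g P Q" if PQ: "P < ?N" "Q < ?N" for P Q
  proof -
    let ?h = "\<lambda>a c S. complex_of_real (e i a * e i c) * (cnj (u i a P) * u i c Q) * (cnj (u i c S) * u i a S)"
    have "(\<Sum>S<?N. g P S * g S Q) = (\<Sum>S<?N. \<Sum>a<?N. \<Sum>c<?N. ?h a c S)"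
      using PQ by (intro sum.cong refl) (simp add: g_eq sum_product mult_ac)
    also have "\<dots> = (\<Sum>a<?N. \<Sum>S<?N. \<Sum>c<?N. ?h a c S)" by (rule sum.swap)
    also have "\<dots> = (\<Sum>a<?N. \<Sum>c<?N. \<Sum>S<?N. ?h a c S)" by (intro sum.cong refl sum.swap)
    also have "\<dots> = (\<Sum>a<?N. \<Sum>c<?N. if c = a then complex_of_real (e i a * e i a) * (cnj (u i a P) * u i a Q) else 0)"
    proof (intro sum.cong refl)
      fix a c assume "a \<in> {..<?N}" "c \<in> {..<?N}"
      hence "ip ?N (u i c) (u i a) = (if c = a then 1 else 0)"
        using spectral_dataD(1)[OF sd iA(1), of c a] iA(2) by simp
      thus "(\<Sum>S<?N. ?h a c S) = (if c = a then complex_of_real (e i a * e i a) * (cnj (u i a P) * u i a Q) else 0)"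
        unfolding sum_distrib_left[symmetric] ip_def[symmetric] by simp
    qed
    also have "\<dots> = (\<Sum>a<?N. complex_of_real (real (ns ! i) / real m * e i a) * (cnj (u i a P) * u i a Q))"
      by (intro sum.cong refl) (simp add: e_sq flip: of_real_mult)
    also have "\<dots> = of_nat (ns ! i) / of_nat m * g P Q"
      unfolding g_eq[OF PQ] sum_distrib_left by (intro sum.cong refl) simp
    finally show ?thesis .
  qed
  have g_phi: "g (r * ns ! i + p) (s * ns ! i + q) = \<phi> (fd_unit ns i p q) ! j $$ (r, s) / of_nat m"
    if rs: "r < m" "s < m" and pq: "p < ns ! i" "q < ns ! i" for r s p q
  proof -
    have sm: "\<phi> (fd_smult c (fd_unit ns i p q)) = fd_smult c (\<phi> (fd_unit ns i p q))" for c
      using cp_linear[OF cp] by (simp add: fd_linear_map_def)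
    have "g (r * ns ! i + p) (s * ns ! i + q) = 
        (\<Sum>r'<m. \<Sum>s'<m. if r' = r then if s' = s then \<phi> (fd_unit ns i p q) ! j $$ (r, s) else 0 else 0) / of_nat m"
      unfolding g_def \<nu>_eq using rs pq i j fd_linear_map_carrier[OF cp_linear[OF cp] fd_unit_carrier]
      by (intro arg_cong[where f = "\<lambda>x. x / of_nat m"] sum.cong refl)
        (simp add: amp_entry_unit sm fd_smult_entry[of _ ms] m_def)
    also have "\<dots> = \<phi> (fd_unit ns i p q) ! j $$ (r, s) / of_nat m"
      using rs unfolding sum_if_const by simp
    finally show ?thesis .
  qed
  have rm: "r < m" using r by (simp add: m_def)
  have "(\<Sum>q<ns ! i. fd_mult (\<phi> (fd_unit ns i p q)) (\<phi> (fd_unit ns i q p)) ! j $$ (r, r))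
      = (\<Sum>q<ns ! i. \<Sum>t<m. \<phi> (fd_unit ns i p q) ! j $$ (r, t) * \<phi> (fd_unit ns i q p) ! j $$ (t, r))"
    using j r fd_linear_map_carrier[OF cp_linear[OF cp] fd_unit_carrier]
    by (intro sum.cong refl) (simp add: fd_mult_entry[of _ ms] m_def)
  also have "\<dots> = (\<Sum>t<m. \<Sum>q<ns ! i. \<phi> (fd_unit ns i p q) ! j $$ (r, t) * \<phi> (fd_unit ns i q p) ! j $$ (t, r))"
    by (rule sum.swap)
  also have "\<dots> = (\<Sum>t<m. \<Sum>q<ns ! i. of_nat m * of_nat m *
      (g (r * ns ! i + p) (t * ns ! i + q) * g (t * ns ! i + q) (r * ns ! i + p)))"
    using rm p m0 by (intro sum.cong refl) (simp add: g_phi)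
  also have "\<dots> = of_nat m * of_nat m * (\<Sum>S<?N. g (r * ns ! i + p) S * g S (r * ns ! i + p))"
    unfolding sum_blocks by (simp add: sum_distrib_left)
  also have "\<dots> = of_nat (ns ! i) * \<phi> (fd_unit ns i p p) ! j $$ (r, r)"
    using block_index_less[OF rm p] m0 rm p by (simp add: g_sq g_phi)
  finally show ?thesis .
qed

section \<open>Homomorphisms do not increase the adjusted entropy\<close>

lemma sum_square_le:
  fixes x :: "nat \<Rightarrow> real"
  shows "(\<Sum>r<m. x r)\<^sup>2 \<le> real m * (\<Sum>r<m. (x r)\<^sup>2)"
proof -
  have "0 \<le> (\<Sum>r<m. \<Sum>s<m. (x r - x s)\<^sup>2)" by (intro sum_nonneg) auto
  also have "\<dots> = (\<Sum>r<m. \<Sum>s<m. (x r)\<^sup>2 + (x s)\<^sup>2 - 2 * (x r * x s))"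
    by (intro sum.cong refl) (simp add: power2_diff)
  also have "\<dots> = 2 * (real m * (\<Sum>r<m. (x r)\<^sup>2) - (\<Sum>r<m. x r)\<^sup>2)"
    by (simp add: sum.distrib sum_subtractf sum_distrib_left[symmetric] sum_product power2_eq_square)
  finally show ?thesis by simp
qed

lemma ip_cnj: "cnj (ip m x y) = ip m y x"
  by (simp add: ip_def mult.commute)

text \<open>
  For a weighted family of vectors in \<open>\<complex>\<^sup>m\<close> the frame operator \<open>Y = \<Sum>t. w\<^sub>t \<alpha>\<^sub>t \<alpha>\<^sub>t*\<close> has
  \<open>(tr Y)\<^sup>2 \<le> m tr (Y* Y)\<close>; written out with Gram matrix entries, this is the Welch bound.
\<close>

lemma frame_bound:
  fixes w :: "'t \<Rightarrow> real" and \<alpha> :: "'t \<Rightarrow> nat \<Rightarrow> complex"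
  shows "(\<Sum>t\<in>T. w t * Re (ip m (\<alpha> t) (\<alpha> t)))\<^sup>2
       \<le> real m * (\<Sum>t\<in>T. \<Sum>t'\<in>T. w t * w t' * (cmod (ip m (\<alpha> t) (\<alpha> t')))\<^sup>2)"
proof -
  define Y where "Y r s = (\<Sum>t\<in>T. complex_of_real (w t) * (\<alpha> t r * cnj (\<alpha> t s)))" for r s
  have "(\<Sum>t\<in>T. complex_of_real (w t) * ip m (\<alpha> t) (\<alpha> t)) = (\<Sum>t\<in>T. \<Sum>r<m. complex_of_real (w t) * (\<alpha> t r * cnj (\<alpha> t r)))"
    by (simp add: ip_def sum_distrib_left mult_ac)
  also have "\<dots> = (\<Sum>r<m. Y r r)" unfolding Y_def by (rule sum.swap)
  finally have "(\<Sum>t\<in>T. complex_of_real (w t) * ip m (\<alpha> t) (\<alpha> t)) = (\<Sum>r<m. Y r r)" .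
  from arg_cong[OF this, of Re]
  have tr: "(\<Sum>t\<in>T. w t * Re (ip m (\<alpha> t) (\<alpha> t))) = (\<Sum>r<m. Re (Y r r))" by simp
  have "complex_of_real (\<Sum>r<m. \<Sum>s<m. (cmod (Y r s))\<^sup>2) = (\<Sum>r<m. \<Sum>s<m. Y r s * cnj (Y r s))"
    by (simp only: of_real_sum complex_norm_square)
  also have "\<dots> = (\<Sum>r<m. \<Sum>s<m. \<Sum>t\<in>T. \<Sum>t'\<in>T. complex_of_real (w t * w t') *
      ((cnj (\<alpha> t' r) * \<alpha> t r) * (cnj (\<alpha> t s) * \<alpha> t' s)))"
    unfolding Y_def cnj_sum sum_product by (intro sum.cong refl) (simp add: mult_ac)
  also have "\<dots> = (\<Sum>r<m. \<Sum>t\<in>T. \<Sum>s<m. \<Sum>t'\<in>T. complex_of_real (w t * w t') *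
      ((cnj (\<alpha> t' r) * \<alpha> t r) * (cnj (\<alpha> t s) * \<alpha> t' s)))"
    by (intro sum.cong[OF refl] sum.swap)
  also have "\<dots> = (\<Sum>r<m. \<Sum>t\<in>T. \<Sum>t'\<in>T. \<Sum>s<m. complex_of_real (w t * w t') *
      ((cnj (\<alpha> t' r) * \<alpha> t r) * (cnj (\<alpha> t s) * \<alpha> t' s)))"
    by (intro sum.cong[OF refl] sum.swap)
  also have "\<dots> = (\<Sum>t\<in>T. \<Sum>r<m. \<Sum>t'\<in>T. \<Sum>s<m. complex_of_real (w t * w t') *
      ((cnj (\<alpha> t' r) * \<alpha> t r) * (cnj (\<alpha> t s) * \<alpha> t' s)))"
    by (rule sum.swap)
  also have "\<dots> = (\<Sum>t\<in>T. \<Sum>t'\<in>T. \<Sum>r<m. \<Sum>s<m. complex_of_real (w t * w t') *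
      ((cnj (\<alpha> t' r) * \<alpha> t r) * (cnj (\<alpha> t s) * \<alpha> t' s)))"
    by (intro sum.cong[OF refl] sum.swap)
  also have "\<dots> = (\<Sum>t\<in>T. \<Sum>t'\<in>T. complex_of_real (w t * w t') * (ip m (\<alpha> t') (\<alpha> t) * ip m (\<alpha> t) (\<alpha> t')))"
    by (intro sum.cong refl) (simp only: ip_def sum_product, simp only: sum_distrib_left)
  also have "\<dots> = (\<Sum>t\<in>T. \<Sum>t'\<in>T. complex_of_real (w t * w t' * (cmod (ip m (\<alpha> t) (\<alpha> t')))\<^sup>2))"
  proof (intro sum.cong refl)
    fix t t'
    have "ip m (\<alpha> t') (\<alpha> t) * ip m (\<alpha> t) (\<alpha> t') = complex_of_real ((cmod (ip m (\<alpha> t) (\<alpha> t')))\<^sup>2)"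
      using complex_norm_square[of "ip m (\<alpha> t) (\<alpha> t')"] by (simp add: ip_cnj mult.commute)
    thus "complex_of_real (w t * w t') * (ip m (\<alpha> t') (\<alpha> t) * ip m (\<alpha> t) (\<alpha> t')) =
        complex_of_real (w t * w t' * (cmod (ip m (\<alpha> t) (\<alpha> t')))\<^sup>2)" by simp
  qed
  also have "\<dots> = complex_of_real (\<Sum>t\<in>T. \<Sum>t'\<in>T. w t * w t' * (cmod (ip m (\<alpha> t) (\<alpha> t')))\<^sup>2)"
    by simp
  finally have hs: "(\<Sum>r<m. \<Sum>s<m. (cmod (Y r s))\<^sup>2) = (\<Sum>t\<in>T. \<Sum>t'\<in>T. w t * w t' * (cmod (ip m (\<alpha> t) (\<alpha> t')))\<^sup>2)"
    using of_real_eq_iff by blast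
  have "(\<Sum>r<m. Re (Y r r))\<^sup>2 \<le> real m * (\<Sum>r<m. (Re (Y r r))\<^sup>2)" by (rule sum_square_le)
  also have "(\<Sum>r<m. (Re (Y r r))\<^sup>2) \<le> (\<Sum>r<m. \<Sum>s<m. (cmod (Y r s))\<^sup>2)"
  proof (rule sum_mono)
    fix r assume r: "r \<in> {..<m}"
    have "(Re (Y r r))\<^sup>2 \<le> (cmod (Y r r))\<^sup>2" by (simp add: cmod_power2)
    also have "\<dots> \<le> (\<Sum>s<m. (cmod (Y r s))\<^sup>2)" using r by (intro member_le_sum) auto
    finally show "(Re (Y r r))\<^sup>2 \<le> (\<Sum>s<m. (cmod (Y r s))\<^sup>2)" .
  qed
  finally show ?thesis unfolding tr hs by (simp add: mult_left_mono)
qed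

lemma sesq_mult:
  assumes a: "a \<in> fd_carrier ms" and b: "b \<in> fd_carrier ms" and j: "j < length ms"
  shows "ip (ms ! j) (mv (ms ! j) (a ! j) x) (mv (ms ! j) (b ! j) y)
       = sesq (ms ! j) (fd_mult (fd_star a) b ! j) x y"
proof -
  let ?m = "ms ! j"
  have "ip ?m (mv ?m (a ! j) x) (mv ?m (b ! j) y) =
      (\<Sum>r<?m. \<Sum>p<?m. \<Sum>q<?m. cnj (a ! j $$ (r, p) * x p) * (b ! j $$ (r, q) * y q))"
    by (simp add: ip_def mv_def sum_product)
  also have "\<dots> = (\<Sum>p<?m. \<Sum>r<?m. \<Sum>q<?m. cnj (a ! j $$ (r, p) * x p) * (b ! j $$ (r, q) * y q))"
    by (rule sum.swap)
  also have "\<dots> = (\<Sum>p<?m. \<Sum>q<?m. \<Sum>r<?m. cnj (a ! j $$ (r, p) * x p) * (b ! j $$ (r, q) * y q))"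
    by (intro sum.cong[OF refl] sum.swap)
  also have "\<dots> = sesq ?m (fd_mult (fd_star a) b ! j) x y"
    unfolding sesq_def using a b j
    by (intro sum.cong refl) (simp add: fd_mult_entry[of _ ms] fd_star_entry[of _ ms]
        sum_distrib_left sum_distrib_right mult_ac)
  finally show ?thesis .
qed

lemma fd_rank1_star_mult:
  assumes i: "i < length ns"
  shows "fd_mult (fd_star (fd_rank1 ns i x y)) (fd_rank1 ns i' x' y') =
    fd_smult (if i = i' then ip (ns ! i) x x' else 0) (fd_rank1 ns i y y')"
proof (rule fd_eqI[of _ ns])
  fix k p q assume k: "k < length ns" "p < ns ! k" "q < ns ! k"
  have "fd_mult (fd_star (fd_rank1 ns i x y)) (fd_rank1 ns i' x' y') ! k $$ (p, q) =
      (\<Sum>r<ns ! k. if k = i \<and> k = i' then y p * (cnj (x r) * x' r) * cnj (y' q) else 0)"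
    unfolding fd_mult_entry[OF fd_star_carrier[OF fd_rank1_carrier] fd_rank1_carrier k]
    using k by (intro sum.cong refl) (simp add: fd_star_entry[of _ ns] mult_ac)
  also have "\<dots> = (if k = i \<and> k = i' then y p * ip (ns ! k) x x' * cnj (y' q) else 0)"
    unfolding ip_def sum_distrib_left sum_distrib_right sum_if_const ..
  finally show "fd_mult (fd_star (fd_rank1 ns i x y)) (fd_rank1 ns i' x' y') ! k $$ (p, q) =
      fd_smult (if i = i' then ip (ns ! i) x x' else 0) (fd_rank1 ns i y y') ! k $$ (p, q)"
    using k by (auto simp: fd_smult_entry[of _ ns])
qed auto

text \<open>
  The images of rank one elements under a homomorphism multiply like matrix units, which reduces inner
  products of the vectors \<open>\<phi>(x y*) v\<close> to values of the vector functional of \<open>v\<close>.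
\<close>

lemma hom_ip_rank1:
  assumes hom: "fd_hom ns ms \<phi>" and j: "j < length ms" and i: "i < length ns"
  shows "ip (ms ! j) (mv (ms ! j) (\<phi> (fd_rank1 ns i x y) ! j) v) (mv (ms ! j) (\<phi> (fd_rank1 ns i' x' y') ! j) v)
    = (if i = i' then ip (ns ! i) x x' else 0) * sesq (ms ! j) (\<phi> (fd_rank1 ns i y y') ! j) v v"
proof -
  have lin: "fd_linear_map ns ms \<phi>" using hom by (simp add: fd_hom_def)
  note phi_c = fd_linear_map_carrier[OF lin fd_rank1_carrier]
  have L: "fd_functional ns (\<lambda>a. sesq (ms ! j) (\<phi> a ! j) v v)"
    by (rule sesq_functional) (rule fd_functional_entry[OF lin j])
  have "ip (ms ! j) (mv (ms ! j) (\<phi> (fd_rank1 ns i x y) ! j) v) (mv (ms ! j) (\<phi> (fd_rank1 ns i' x' y') ! j) v)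
    = sesq (ms ! j) (\<phi> (fd_mult (fd_star (fd_rank1 ns i x y)) (fd_rank1 ns i' x' y')) ! j) v v"
    using hom unfolding sesq_mult[OF phi_c phi_c j] by (simp add: fd_hom_def)
  thus ?thesis using L unfolding fd_rank1_star_mult[OF i] by (simp add: fd_functional_def)
qed

lemma sum_triples:
  fixes L :: nat and n :: "nat \<Rightarrow> nat"
  shows
  "(\<Sum>t\<in>(SIGMA i:{..<L}. {..<n i} \<times> {..<n i}). G t) = (\<Sum>i<L. \<Sum>p<n i. \<Sum>q<n i. G (i, p, q))"
proof -
  have "(\<Sum>i<L. \<Sum>t\<in>{..<n i} \<times> {..<n i}. G (i, t)) = (\<Sum>t\<in>(SIGMA i:{..<L}. {..<n i} \<times> {..<n i}). G t)"
    by (subst sum.Sigma) auto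
  thus ?thesis by (simp add: sum.cartesian_product split_def)
qed

text \<open>
  The frame bound for the vectors \<open>\<phi>(w\<^sub>p w\<^sub>q*) v\<close>, where each \<open>p\<close> contributes the same amount and the weight
  \<open>h\<^sub>q / n\<^sub>i\<close> compensates for the \<open>n\<^sub>i\<close> values of \<open>p\<close>. It plays the part of the Pimsner-Popa inequality for
  the conditional expectation that belongs to \<open>\<phi>\<close>.
\<close>

lemma hom_frame_bound:
  fixes v :: "nat \<Rightarrow> complex"
  assumes hom: "fd_hom ns ms \<phi>" and j: "j < length ms" and ns: "\<And>i. i < length ns \<Longrightarrow> 0 < ns ! i"
    and orth: "\<And>i p q. i < length ns \<Longrightarrow> p < ns ! i \<Longrightarrow> q < ns ! i \<Longrightarrow>
        ip (ns ! i) (w i p) (w i q) = (if p = q then 1 else 0)"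
  defines "K \<equiv> \<lambda>i p q. sesq (ms ! j) (\<phi> (fd_rank1 ns i (w i p) (w i q)) ! j) v v"
  shows "(\<Sum>i<length ns. \<Sum>p<ns ! i. h i p * Re (K i p p))\<^sup>2
    \<le> real (ms ! j) * (\<Sum>i<length ns. (\<Sum>p<ns ! i. \<Sum>q<ns ! i. h i p * h i q * (cmod (K i p q))\<^sup>2) / real (ns ! i))"
proof -
  let ?m = "ms ! j"
  define J where "J i = {..<ns ! i} \<times> {..<ns ! i}" for i
  define T where "T = (SIGMA i:{..<length ns}. J i)"
  define W where "W = (\<lambda>(i, p :: nat, q). h i q / real (ns ! i))"
  define \<alpha> where "\<alpha> = (\<lambda>(i, p, q). mv ?m (\<phi> (fd_rank1 ns i (w i p) (w i q)) ! j) v)"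
  have ip_\<alpha>: "ip ?m (\<alpha> (i, p, q)) (\<alpha> (i', p', q')) = (if i = i' \<and> p = p' then K i q q' else 0)"
    if "i < length ns" "p < ns ! i" "i' < length ns" "p' < ns ! i'" for i p q i' p' q'
    using that orth unfolding \<alpha>_def prod.case hom_ip_rank1[OF hom j that(1)] K_def by auto
  have sumT: "(\<Sum>t\<in>T. G t) = (\<Sum>i<length ns. \<Sum>p<ns ! i. \<Sum>q<ns ! i. G (i, p, q))" for G :: "nat \<times> nat \<times> nat \<Rightarrow> real"
    unfolding T_def J_def by (rule sum_triples)
  have lhs: "(\<Sum>t\<in>T. W t * Re (ip ?m (\<alpha> t) (\<alpha> t))) = (\<Sum>i<length ns. \<Sum>p<ns ! i. h i p * Re (K i p p))"
  proof -
    have "(\<Sum>t\<in>T. W t * Re (ip ?m (\<alpha> t) (\<alpha> t))) = (\<Sum>i<length ns. \<Sum>p<ns ! i. \<Sum>q<ns ! i. h i q * Re (K i q q) / real (ns ! i))"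
      unfolding sumT by (intro sum.cong refl) (simp add: ip_\<alpha> W_def)
    also have "\<dots> = (\<Sum>i<length ns. \<Sum>p<ns ! i. h i p * Re (K i p p))"
      by (rule sum.cong[OF refl]) (use ns in \<open>simp add: sum_divide_distrib[symmetric]\<close>)
    finally show ?thesis .
  qed
  have rhs: "(\<Sum>t\<in>T. \<Sum>t'\<in>T. W t * W t' * (cmod (ip ?m (\<alpha> t) (\<alpha> t')))\<^sup>2) =
     (\<Sum>i<length ns. (\<Sum>p<ns ! i. \<Sum>q<ns ! i. h i p * h i q * (cmod (K i p q))\<^sup>2) / real (ns ! i))"
  proof -
    have inner: "(\<Sum>t'\<in>T. W (i, p, q) * W t' * (cmod (ip ?m (\<alpha> (i, p, q)) (\<alpha> t')))\<^sup>2)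
        = (\<Sum>q'<ns ! i. h i q * h i q' * (cmod (K i q q'))\<^sup>2) / (real (ns ! i))\<^sup>2"
      if ipq: "i < length ns" "p < ns ! i" "q < ns ! i" for i p q
    proof -
      have "(\<Sum>t'\<in>T. W (i, p, q) * W t' * (cmod (ip ?m (\<alpha> (i, p, q)) (\<alpha> t')))\<^sup>2) =
          (\<Sum>i'<length ns. \<Sum>p'<ns ! i'. \<Sum>q'<ns ! i'. if i' = i then if p' = p then
             h i q * h i q' * (cmod (K i q q'))\<^sup>2 / (real (ns ! i))\<^sup>2 else 0 else 0)"
        unfolding sumT using ipq
        by (intro sum.cong refl) (auto simp: ip_\<alpha> W_def power2_eq_square)
      also have "\<dots> = (\<Sum>q'<ns ! i. h i q * h i q' * (cmod (K i q q'))\<^sup>2 / (real (ns ! i))\<^sup>2)"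
        unfolding sum_if_const using ipq by simp
      finally show ?thesis by (simp add: sum_divide_distrib)
    qed
    have "(\<Sum>t\<in>T. \<Sum>t'\<in>T. W t * W t' * (cmod (ip ?m (\<alpha> t) (\<alpha> t')))\<^sup>2) =
      (\<Sum>i<length ns. \<Sum>p<ns ! i. \<Sum>q<ns ! i. (\<Sum>q'<ns ! i. h i q * h i q' * (cmod (K i q q'))\<^sup>2) / (real (ns ! i))\<^sup>2)"
      unfolding sumT[of "\<lambda>t. \<Sum>t'\<in>T. W t * W t' * (cmod (ip ?m (\<alpha> t) (\<alpha> t')))\<^sup>2"]
      by (intro sum.cong[OF refl]) (simp add: inner)
    also have "\<dots> = (\<Sum>i<length ns. (\<Sum>p<ns ! i. \<Sum>q<ns ! i. h i p * h i q * (cmod (K i p q))\<^sup>2) / real (ns ! i))"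
      by (rule sum.cong[OF refl]) (use ns in \<open>simp add: sum_divide_distrib[symmetric] power2_eq_square\<close>)
    finally show ?thesis .
  qed
  show ?thesis using frame_bound[of W m \<alpha> T for m] unfolding lhs[symmetric] rhs[symmetric] .
qed

lemma sum_mult_cnj_eq_ip:
  "(\<Sum>r<m. x r * cnj (y r)) = ip m y x"
  by (simp add: ip_def mult.commute)

text \<open>
  The hypothesis says that the positive matrix \<open>e K\<close> is dominated by the diagonal matrix \<open>f\<close>. Hence
  \<open>G = f\<^sup>-\<^sup>1\<^sup>/\<^sup>2 e K f\<^sup>-\<^sup>1\<^sup>/\<^sup>2\<close> lies between 0 and 1, and the claim is \<open>tr G\<^sup>2 \<le> tr G\<close>, up to a factor \<open>e\<close>.
  It follows by summing the hypothesis over vectors \<open>c\<close> that come from a Gram representation of \<open>K\<close>;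
  terms with \<open>f p = 0\<close> vanish because division by zero gives zero.
\<close>

lemma hom_compression_le:
  assumes hom: "fd_hom ns ms \<phi>" and j: "j < length ms" and i: "i < length ns"
    and orth: "\<And>p q. p < ns ! i \<Longrightarrow> q < ns ! i \<Longrightarrow> ip (ns ! i) (w p) (w q) = (if p = q then 1 else 0)"
    and dom: "\<And>c. complex_of_real e * (\<Sum>p<ns ! i. \<Sum>q<ns ! i.
          c p * cnj (c q) * sesq (ms ! j) (\<phi> (fd_rank1 ns i (w p) (w q)) ! j) v v)
        \<le> complex_of_real (\<Sum>p<ns ! i. f p * (cmod (c p))\<^sup>2)"
    and e: "0 \<le> e" and f: "\<And>p. p < ns ! i \<Longrightarrow> 0 \<le> f p"
  defines "K \<equiv> \<lambda>p q. sesq (ms ! j) (\<phi> (fd_rank1 ns i (w p) (w q)) ! j) v v"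
  shows "e * (\<Sum>p<ns ! i. \<Sum>q<ns ! i. (cmod (K p q))\<^sup>2 / (f p * f q)) \<le> (\<Sum>p<ns ! i. Re (K p p) / f p)"
proof (cases "ns ! i = 0")
  case False
  let ?m = "ms ! j" and ?n = "ns ! i"
  \<comment> \<open>The Gram representation of \<open>K\<close>: \<open>w\<^sub>0 w\<^sub>p*\<close> and \<open>w\<^sub>0 w\<^sub>q*\<close> satisfy \<open>(w\<^sub>0 w\<^sub>p*)* (w\<^sub>0 w\<^sub>q*) = w\<^sub>p w\<^sub>q*\<close>.\<close>
  define g where "g p = mv ?m (\<phi> (fd_rank1 ns i (w 0) (w p)) ! j) v" for p
  have g_ip: "ip ?m (g p) (g q) = K p q" if "p < ?n" "q < ?n" for p q
    using orth[of 0 0] False unfolding g_def hom_ip_rank1[OF hom j i] K_def by simp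
  have K_cnj: "K q p = cnj (K p q)" if "p < ?n" "q < ?n" for p q
    using g_ip[OF that] g_ip[OF that(2,1)] ip_cnj[of ?m "g p" "g q"] by simp
  define c where "c r p = g p r / complex_of_real (f p)" for r p
  have "complex_of_real e * (\<Sum>r<?m. \<Sum>p<?n. \<Sum>q<?n. c r p * cnj (c r q) * K p q)
      \<le> (\<Sum>r<?m. complex_of_real (\<Sum>p<?n. f p * (cmod (c r p))\<^sup>2))"
    unfolding sum_distrib_left[of "complex_of_real e" _ "{..<?m}"] K_def by (intro sum_mono dom)
  also have "(\<Sum>r<?m. \<Sum>p<?n. \<Sum>q<?n. c r p * cnj (c r q) * K p q)
      = (\<Sum>p<?n. \<Sum>r<?m. \<Sum>q<?n. c r p * cnj (c r q) * K p q)" by (rule sum.swap)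
  also have "\<dots> = (\<Sum>p<?n. \<Sum>q<?n. \<Sum>r<?m. c r p * cnj (c r q) * K p q)"
    by (intro sum.cong[OF refl] sum.swap)
  also have "\<dots> = (\<Sum>p<?n. \<Sum>q<?n. complex_of_real ((cmod (K p q))\<^sup>2 / (f p * f q)))"
  proof (intro sum.cong refl)
    fix p q assume "p \<in> {..<?n}" "q \<in> {..<?n}"
    hence pq: "p < ?n" "q < ?n" by auto
    have "(\<Sum>r<?m. c r p * cnj (c r q) * K p q) = (\<Sum>r<?m. g p r * cnj (g q r)) * K p q / complex_of_real (f p * f q)"
      unfolding sum_distrib_right sum_divide_distrib c_def by (intro sum.cong refl) simp
    also have "(\<Sum>r<?m. g p r * cnj (g q r)) = cnj (K p q)"
      unfolding sum_mult_cnj_eq_ip using g_ip[OF pq(2,1)] K_cnj[OF pq] by simp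
    also have "cnj (K p q) * K p q = complex_of_real ((cmod (K p q))\<^sup>2)"
      unfolding complex_norm_square by (rule mult.commute)
    finally show "(\<Sum>r<?m. c r p * cnj (c r q) * K p q) = complex_of_real ((cmod (K p q))\<^sup>2 / (f p * f q))"
      by simp
  qed
  also have "(\<Sum>r<?m. complex_of_real (\<Sum>p<?n. f p * (cmod (c r p))\<^sup>2)) =
      complex_of_real (\<Sum>p<?n. \<Sum>r<?m. f p * (cmod (c r p))\<^sup>2)"
    unfolding of_real_sum by (rule sum.swap)
  also have "(\<Sum>p<?n. \<Sum>r<?m. f p * (cmod (c r p))\<^sup>2) = (\<Sum>p<?n. Re (K p p) / f p)"
  proof (intro sum.cong refl)
    fix p assume "p \<in> {..<?n}"
    hence p: "p < ?n" by auto
    have "complex_of_real (\<Sum>r<?m. (cmod (g p r))\<^sup>2) = K p p"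
      unfolding of_real_sum complex_norm_square sum_mult_cnj_eq_ip g_ip[OF p p] ..
    hence gr: "(\<Sum>r<?m. (cmod (g p r))\<^sup>2) = Re (K p p)" by (metis Re_complex_of_real)
    have "(\<Sum>r<?m. f p * (cmod (c r p))\<^sup>2) = (\<Sum>r<?m. (cmod (g p r))\<^sup>2 / f p)"
      using f[OF p] by (intro sum.cong refl) (simp add: c_def norm_divide power_divide power2_eq_square)
    thus "(\<Sum>r<?m. f p * (cmod (c r p))\<^sup>2) = Re (K p p) / f p"
      by (simp only: sum_divide_distrib[symmetric] gr)
  qed
  finally show ?thesis by (simp add: less_eq_complex_def)
qed simp

lemma sesq_nonneg_rank1_hom:
  assumes pos: "\<And>a. fd_positive ns a \<Longrightarrow> fd_positive ms (\<phi> a)" and j: "j < length ms"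
  shows "0 \<le> sesq (ms ! j) (\<phi> (fd_rank1 ns i x x) ! j) v v"
  by (rule fd_positive_sesq_nonneg[OF pos[OF fd_rank1_positive] j])

lemma hom_positive:
  assumes "fd_hom ns ms \<phi>" "fd_positive ns a"
  shows "fd_positive ms (\<phi> a)"
proof -
  obtain c where "c \<in> fd_carrier ns" "a = fd_mult (fd_star c) c"
    using assms(2) by (auto simp: fd_positive_def)
  thus ?thesis using assms(1) unfolding fd_hom_def fd_linear_map_def fd_positive_def
    by (metis fd_star_carrier)
qed

text \<open>
  The tangent to the logarithm at \<open>m / e\<close>, weighted by \<open>t\<close>; summed over weights with total 1 it takes the
  place of Jensen's inequality.
\<close>

lemma ln_tangent:
  fixes t :: real
  assumes t: "0 \<le> t" and f: "0 < t \<Longrightarrow> 0 < f" and n: "0 < n" and e: "0 < e" and m: "0 < m"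
  shows "t * ln (n / f) \<le> t * (n / f) * (e / m) - t + t * ln (m / e)"
proof (cases "t = 0")
  case False
  hence t0: "0 < t" using t by simp
  have f0: "0 < f" using f t0 by simp
  have "ln (n / f * (e / m)) \<le> n / f * (e / m) - 1"
    using n f0 e m by (intro ln_le_minus_one) simp
  moreover have "ln (n / f * (e / m)) = ln (n / f) - ln (m / e)"
    using n f0 e m by (simp add: ln_mult ln_div)
  ultimately have "ln (n / f) \<le> n / f * (e / m) - 1 + ln (m / e)" by simp
  hence "t * ln (n / f) \<le> t * (n / f * (e / m) - 1 + ln (m / e))" using t0 by simp
  thus ?thesis by (simp add: algebra_simps)
qed simp

lemma entropy_term_ln:
  fixes t :: real
  assumes "0 \<le> t" "0 < n" "1 < b"
  shows "(t * log b n - xlogx b t) * ln b = t * ln (n / t)"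
proof (cases "t = 0")
  case False
  hence t: "0 < t" using assms by simp
  have "ln b \<noteq> 0" using assms by simp
  hence "log b n * ln b = ln n" "log b t * ln b = ln t" by (simp_all add: log_def)
  moreover have "ln (n / t) = ln n - ln t" using t assms by (simp add: ln_div)
  ultimately have "t * (log b n * ln b) - t * (log b t * ln b) = t * ln (n / t)"
    by (simp add: right_diff_distrib)
  moreover have "(t * log b n - xlogx b t) * ln b = t * (log b n * ln b) - t * (log b t * ln b)"
    using t by (simp add: xlogx_def left_diff_distrib)
  ultimately show ?thesis by simp
qed (simp add: xlogx_def)

lemma sum_swap_pairs:
  "(\<Sum>i\<in>I. \<Sum>p\<in>P i. \<Sum>j\<in>J. \<Sum>a\<in>A j. G i p j a) = (\<Sum>j\<in>J. \<Sum>a\<in>A j. \<Sum>i\<in>I. \<Sum>p\<in>P i. G i p j a)"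
proof -
  have "(\<Sum>i\<in>I. \<Sum>p\<in>P i. \<Sum>j\<in>J. \<Sum>a\<in>A j. G i p j a) = (\<Sum>i\<in>I. \<Sum>j\<in>J. \<Sum>p\<in>P i. \<Sum>a\<in>A j. G i p j a)"
    by (intro sum.cong[OF refl] sum.swap)
  also have "\<dots> = (\<Sum>j\<in>J. \<Sum>i\<in>I. \<Sum>p\<in>P i. \<Sum>a\<in>A j. G i p j a)" by (rule sum.swap)
  also have "\<dots> = (\<Sum>j\<in>J. \<Sum>i\<in>I. \<Sum>a\<in>A j. \<Sum>p\<in>P i. G i p j a)"
    by (intro sum.cong[OF refl] sum.swap)
  also have "\<dots> = (\<Sum>j\<in>J. \<Sum>a\<in>A j. \<Sum>i\<in>I. \<Sum>p\<in>P i. G i p j a)"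
    by (intro sum.cong[OF refl] sum.swap)
  finally show ?thesis .
qed

text \<open>
  Let \<open>u, e\<close> and \<open>w, f\<close> be spectral data of \<open>\<mu>\<close> and \<open>\<mu> \<circ> \<phi>\<close>. For each eigenvector \<open>u\<^sub>j\<^sub>a\<close>
  the numbers \<open>t = \<langle>u\<^sub>j\<^sub>a, \<phi>(w\<^sub>i\<^sub>p w\<^sub>i\<^sub>p*) u\<^sub>j\<^sub>a\<rangle>\<close> are weights with sum 1, and \<open>f\<close> is the average of \<open>t\<close> with
  respect to \<open>e\<close>. It therefore suffices to show \<open>\<Sum> t ln (n / f) \<le> ln (m / e)\<close> for each \<open>(j, a)\<close>, and by
  concavity of the logarithm this follows from \<open>\<Sum> t n / f \<le> m / e\<close>.
\<close>

lemma hom_entropy_le: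
  assumes ns: "\<And>i. i < length ns \<Longrightarrow> 0 < ns ! i" and ms: "\<And>j. j < length ms \<Longrightarrow> 0 < ms ! j"
    and hom: "fd_hom ns ms \<phi>" and un: "fd_unital ns ms \<phi>" and b: "1 < b"
    and st: "fd_state ms \<mu>" and st': "fd_state ns (\<mu> \<circ> \<phi>)"
  shows "adj_entropy b ns (\<mu> \<circ> \<phi>) \<le> adj_entropy b ms \<mu>"
proof -
  have lin: "fd_linear_map ns ms \<phi>" using hom by (simp add: fd_hom_def)
  note phi_c = fd_linear_map_carrier[OF lin]
  obtain u e where sd: "spectral_data ms \<mu> u e" and
    entB: "adj_entropy b ms \<mu> = (\<Sum>j<length ms. \<Sum>a<ms ! j. e j a * log b (ms ! j) - xlogx b (e j a))"
    using state_spectral[OF st] by blast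
  obtain w f where sd': "spectral_data ns (\<mu> \<circ> \<phi>) w f" and
    entA: "adj_entropy b ns (\<mu> \<circ> \<phi>) = (\<Sum>i<length ns. \<Sum>p<ns ! i. f i p * log b (ns ! i) - xlogx b (f i p))"
    using state_spectral[OF st'] by blast
  define K where "K j a i p q = sesq (ms ! j) (\<phi> (fd_rank1 ns i (w i p) (w i q)) ! j) (u j a) (u j a)" for j a i p q
  define t where "t j a i p = Re (K j a i p p)" for j a i p
  note e0 = spectral_dataD(3)[OF sd] and f0 = spectral_dataD(3)[OF sd']
  have K_nn: "0 \<le> K j a i p p" if "j < length ms" for j a i p
    unfolding K_def by (rule sesq_nonneg_rank1_hom[OF hom_positive[OF hom] that])
  have t0: "0 \<le> t j a i p" if "j < length ms" for j a i p
    using K_nn[OF that, of a i p] by (simp add: t_def less_eq_complex_def)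
  have \<nu>_eq: "\<mu> (\<phi> x) = (\<Sum>j<length ms. \<Sum>a<ms ! j. complex_of_real (e j a) * sesq (ms ! j) (\<phi> x ! j) (u j a) (u j a))"
    if "x \<in> fd_carrier ns" for x
    using spectral_dataD(4)[OF sd phi_c[OF that]] .
  have f_eq: "f i p = (\<Sum>j<length ms. \<Sum>a<ms ! j. e j a * t j a i p)" if ip: "i < length ns" "p < ns ! i" for i p
  proof -
    have "complex_of_real (f i p) = (\<Sum>j<length ms. \<Sum>a<ms ! j. complex_of_real (e j a) * K j a i p p)"
      using spectral_data_rank1[OF sd' ip ip(2)] \<nu>_eq[OF fd_rank1_carrier, of i "w i p" "w i p"]
      by (simp add: K_def)
    from arg_cong[OF this, of Re] show ?thesis by (simp add: t_def)
  qed
  have f_ge: "e j a * t j a i p \<le> f i p"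
    if "j < length ms" "a < ms ! j" "i < length ns" "p < ns ! i" for j a i p
  proof -
    have "e j a * t j a i p \<le> (\<Sum>a<ms ! j. e j a * t j a i p)"
      using that e0 t0 by (intro member_le_sum[of a _ "\<lambda>a. e j a * t j a i p"]) auto
    also have "\<dots> \<le> (\<Sum>j<length ms. \<Sum>a<ms ! j. e j a * t j a i p)"
      using that e0 t0 by (intro member_le_sum[of j _ "\<lambda>j. \<Sum>a<ms ! j. e j a * t j a i p"]) (auto intro!: sum_nonneg)
    finally show ?thesis using f_eq that by simp
  qed
  have t_sum: "(\<Sum>i<length ns. \<Sum>p<ns ! i. t j a i p) = 1" if j: "j < length ms" and a: "a < ms ! j" for j a
  proof -
    have L: "fd_functional ns (\<lambda>x. sesq (ms ! j) (\<phi> x ! j) (u j a) (u j a))" (is "fd_functional ns ?L")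
      by (rule sesq_functional) (rule fd_functional_entry[OF lin j])
    let ?T = "SIGMA i:{..<length ns}. {..<ns ! i}"
    have "?L (fd_one ns) = (\<Sum>x\<in>?T. 1 * ?L (case x of (i, p) \<Rightarrow> fd_rank1 ns i (w i p) (w i p)))"
    proof (rule fd_functional_sum[OF L])
      fix i p q assume i: "i < length ns" "p < ns ! i" "q < ns ! i"
      have "(\<Sum>x\<in>?T. 1 * (case x of (i, p) \<Rightarrow> fd_rank1 ns i (w i p) (w i p)) ! i $$ (p, q))
          = (\<Sum>i'<length ns. \<Sum>a<ns ! i'. if i' = i then w i a p * cnj (w i a q) else 0)"
        using i by (subst sum.Sigma) (auto intro!: sum.cong split: prod.splits)
      also have "\<dots> = (\<Sum>a<ns ! i. w i a p * cnj (w i a q))"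
        unfolding sum_if_const using i by simp
      also have "\<dots> = fd_one ns ! i $$ (p, q)"
        using spectral_dataD(2)[OF sd' i] i by simp
      finally show "fd_one ns ! i $$ (p, q) = (\<Sum>x\<in>?T. 1 * (case x of (i, p) \<Rightarrow> fd_rank1 ns i (w i p) (w i p)) ! i $$ (p, q))" ..
    qed (auto split: prod.splits)
    also have "\<dots> = (\<Sum>i<length ns. \<Sum>p<ns ! i. K j a i p p)"
      unfolding K_def by (subst sum.Sigma) (auto intro!: sum.cong split: prod.splits)
    finally have "(\<Sum>i<length ns. \<Sum>p<ns ! i. K j a i p p) = 1"
      using un j spectral_dataD(1)[OF sd j a a] by (simp add: fd_unital_def sesq_one)
    from arg_cong[OF this, of Re] show ?thesis by (simp add: t_def)
  qed
  have dom: "complex_of_real (e j a) * (\<Sum>p<ns ! i. \<Sum>q<ns ! i. c p * cnj (c q) * K j a i p q)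
        \<le> complex_of_real (\<Sum>p<ns ! i. f i p * (cmod (c p))\<^sup>2)"
    if j: "j < length ms" and a: "a < ms ! j" and i: "i < length ns" for j a i c
  proof -
    let ?n = "ns ! i"
    \<comment> \<open>Both sides are values at the positive element \<open>y y*\<close>: the right hand side is that of \<open>\<mu> \<circ> \<phi>\<close>, and
      the left hand side is that of one of the vector functionals whose sum is \<open>\<mu> \<circ> \<phi>\<close>.\<close>
    define y where "y r = (\<Sum>p<?n. c p * w i p r)" for r
    have L: "fd_functional ns (\<lambda>x. sesq (ms ! j) (\<phi> x ! j) (u j a) (u j a))" (is "fd_functional ns ?L")
      by (rule sesq_functional) (rule fd_functional_entry[OF lin j])
    have Ly: "?L (fd_rank1 ns i y y) = (\<Sum>p<?n. \<Sum>q<?n. c p * cnj (c q) * K j a i p q)"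
    proof -
      have "?L (fd_rank1 ns i y y) = (\<Sum>x\<in>{..<?n} \<times> {..<?n}. (case x of (p, q) \<Rightarrow> c p * cnj (c q)) *
          ?L (case x of (p, q) \<Rightarrow> fd_rank1 ns i (w i p) (w i q)))"
      proof (rule fd_functional_sum[OF L])
        fix i' r s assume i': "i' < length ns" "r < ns ! i'" "s < ns ! i'"
        show "fd_rank1 ns i y y ! i' $$ (r, s) = (\<Sum>x\<in>{..<?n} \<times> {..<?n}. (case x of (p, q) \<Rightarrow> c p * cnj (c q)) *
          (case x of (p, q) \<Rightarrow> fd_rank1 ns i (w i p) (w i q)) ! i' $$ (r, s))"
        proof (cases "i' = i")
          case True
          thus ?thesis using i'
            by (simp add: y_def sum_product sum.cartesian_product split_def mult_ac)
        next
          case False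
          thus ?thesis using i' by (simp add: split_def)
        qed
      qed (auto split: prod.splits)
      thus ?thesis by (simp add: sum.cartesian_product split_def K_def)
    qed
    have y_ip: "ip ?n (w i p) y = c p" if p: "p < ?n" for p
    proof -
      have "ip ?n (w i p) y = (\<Sum>q<?n. c q * ip ?n (w i p) (w i q))"
        unfolding y_def ip_sum_right by (simp add: ip_def sum_distrib_left mult_ac)
      also have "\<dots> = (\<Sum>q<?n. if q = p then c q else 0)"
        using spectral_dataD(1)[OF sd' i p] by (intro sum.cong refl) auto
      finally show ?thesis using p by simp
    qed
    have "\<mu> (\<phi> (fd_rank1 ns i y y)) = (\<Sum>i'<length ns. \<Sum>p<ns ! i'. complex_of_real (f i' p) *
        sesq (ns ! i') (fd_rank1 ns i y y ! i') (w i' p) (w i' p))"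
      using spectral_dataD(4)[OF sd' fd_rank1_carrier, of i y y] unfolding comp_def .
    also have "\<dots> = (\<Sum>i'<length ns. if i' = i then
        \<Sum>p<?n. complex_of_real (f i p) * (ip ?n (w i p) y * ip ?n y (w i p)) else 0)"
    proof (rule sum.cong[OF refl])
      fix i' assume "i' \<in> {..<length ns}"
      thus "(\<Sum>p<ns ! i'. complex_of_real (f i' p) * sesq (ns ! i') (fd_rank1 ns i y y ! i') (w i' p) (w i' p)) =
        (if i' = i then \<Sum>p<?n. complex_of_real (f i p) * (ip ?n (w i p) y * ip ?n y (w i p)) else 0)"
        by (cases "i' = i") (simp_all add: sesq_rank1 sesq_rank1_other)
    qed
    also have "\<dots> = (\<Sum>p<?n. complex_of_real (f i p) * (ip ?n (w i p) y * ip ?n y (w i p)))"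
      using i by simp
    also have "\<dots> = complex_of_real (\<Sum>p<?n. f i p * (cmod (c p))\<^sup>2)"
    proof -
      have "ip ?n (w i p) y * ip ?n y (w i p) = complex_of_real ((cmod (c p))\<^sup>2)" if "p < ?n" for p
        using y_ip[OF that] ip_cnj[of ?n "w i p" y] complex_norm_square[of "c p"] by simp
      thus ?thesis by simp
    qed
    finally have tot: "\<mu> (\<phi> (fd_rank1 ns i y y)) = complex_of_real (\<Sum>p<?n. f i p * (cmod (c p))\<^sup>2)" .
    let ?G = "\<lambda>j a. complex_of_real (e j a) * sesq (ms ! j) (\<phi> (fd_rank1 ns i y y) ! j) (u j a) (u j a)"
    have G0: "0 \<le> ?G j a" if "j < length ms" "a < ms ! j" for j a
    proof (rule mult_nonneg_nonneg)
      show "0 \<le> complex_of_real (e j a)" using e0[OF that] by (simp add: less_eq_complex_def)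
    qed (rule sesq_nonneg_rank1_hom[OF hom_positive[OF hom] that(1)])
    have "?G j a \<le> (\<Sum>a<ms ! j. ?G j a)"
      using a G0[OF j] by (intro member_le_sum) auto
    also have "\<dots> \<le> (\<Sum>j<length ms. \<Sum>a<ms ! j. ?G j a)"
      using j G0 by (intro member_le_sum[of j _ "\<lambda>j. \<Sum>a<ms ! j. ?G j a"]) (auto intro!: sum_nonneg)
    also have "\<dots> = \<mu> (\<phi> (fd_rank1 ns i y y))"
      by (rule \<nu>_eq[OF fd_rank1_carrier, symmetric])
    finally show ?thesis unfolding tot Ly .
  qed
  have key: "e j a * (\<Sum>i<length ns. \<Sum>p<ns ! i. t j a i p * ln (ns ! i / f i p)) \<le> e j a * ln (ms ! j / e j a)"
    if j: "j < length ms" and a: "a < ms ! j" for j a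
  proof (cases "e j a = 0")
    case False
    hence ep: "0 < e j a" using e0[OF j a] by simp
    let ?m = "real (ms ! j)" and ?e = "e j a"
    have m0: "0 < ?m" using ms[OF j] by simp
    \<comment> \<open>The goal is \<open>e s \<le> m\<close>. The frame bound with \<open>h = n / f\<close> and the compression bound are combined
      into \<open>e s\<^sup>2 \<le> m s\<close>.\<close>
    define s where "s = (\<Sum>i<length ns. \<Sum>p<ns ! i. (ns ! i / f i p) * t j a i p)"
    have s0: "0 \<le> s"
      unfolding s_def using t0[OF j] f0 by (intro sum_nonneg mult_nonneg_nonneg divide_nonneg_nonneg) auto
    have "s\<^sup>2 \<le> ?m * (\<Sum>i<length ns. (\<Sum>p<ns ! i. \<Sum>q<ns ! i. (ns ! i / f i p) * (ns ! i / f i q) * (cmod (K j a i p q))\<^sup>2) / real (ns ! i))"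
      unfolding s_def t_def K_def
      by (rule hom_frame_bound[OF hom j ns spectral_dataD(1)[OF sd']])
    also have "(\<Sum>i<length ns. (\<Sum>p<ns ! i. \<Sum>q<ns ! i. (ns ! i / f i p) * (ns ! i / f i q) * (cmod (K j a i p q))\<^sup>2) / real (ns ! i))
        = (\<Sum>i<length ns. real (ns ! i) * (\<Sum>p<ns ! i. \<Sum>q<ns ! i. (cmod (K j a i p q))\<^sup>2 / (f i p * f i q)))"
      using ns unfolding sum_distrib_left sum_divide_distrib by (intro sum.cong refl) (auto simp: field_simps)
    finally have 1: "s\<^sup>2 \<le> ?m * (\<Sum>i<length ns. real (ns ! i) * (\<Sum>p<ns ! i. \<Sum>q<ns ! i. (cmod (K j a i p q))\<^sup>2 / (f i p * f i q)))" .
    have "?e * (\<Sum>i<length ns. real (ns ! i) * (\<Sum>p<ns ! i. \<Sum>q<ns ! i. (cmod (K j a i p q))\<^sup>2 / (f i p * f i q)))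
        = (\<Sum>i<length ns. real (ns ! i) * (?e * (\<Sum>p<ns ! i. \<Sum>q<ns ! i. (cmod (K j a i p q))\<^sup>2 / (f i p * f i q))))"
      unfolding sum_distrib_left[of ?e _ "{..<length ns}"] by (intro sum.cong refl mult.left_commute)
    also have "\<dots> \<le> (\<Sum>i<length ns. real (ns ! i) * (\<Sum>p<ns ! i. t j a i p / f i p))"
      unfolding t_def K_def using e0[OF j a] f0 spectral_dataD(1)[OF sd'] dom[OF j a, unfolded K_def]
      by (intro sum_mono mult_left_mono hom_compression_le[OF hom j]) auto
    also have "\<dots> = s" unfolding s_def sum_distrib_left by (intro sum.cong refl) simp
    finally have 2: "?e * (\<Sum>i<length ns. real (ns ! i) * (\<Sum>p<ns ! i. \<Sum>q<ns ! i. (cmod (K j a i p q))\<^sup>2 / (f i p * f i q))) \<le> s" .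
    have "?e * s\<^sup>2 \<le> ?e * (?m * (\<Sum>i<length ns. real (ns ! i) * (\<Sum>p<ns ! i. \<Sum>q<ns ! i. (cmod (K j a i p q))\<^sup>2 / (f i p * f i q))))"
      using 1 ep by (intro mult_left_mono) auto
    also have "\<dots> \<le> ?m * s"
      unfolding mult.left_commute[of ?e ?m] using 2 m0 by (intro mult_left_mono) auto
    finally have "?e * s\<^sup>2 \<le> ?m * s" .
    hence se: "s * (?e / ?m) \<le> 1"
      using s0 m0 ep by (cases "s = 0") (auto simp: power2_eq_square field_simps)
    have "(\<Sum>i<length ns. \<Sum>p<ns ! i. t j a i p * ln (ns ! i / f i p)) \<le>
        (\<Sum>i<length ns. \<Sum>p<ns ! i. t j a i p * (ns ! i / f i p) * (?e / ?m) - t j a i p + t j a i p * ln (?m / ?e))"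
    proof (intro sum_mono ln_tangent)
      fix i p assume "i \<in> {..<length ns}" "p \<in> {..<ns ! i}" "0 < t j a i p"
      thus "0 < f i p" using f_ge[OF j a, of i p] ep by (smt (verit) lessThan_iff mult_pos_pos)
    qed (use t0[OF j] ns ep m0 in auto)
    also have "\<dots> = s * (?e / ?m) - 1 + ln (?m / ?e)"
      by (simp only: sum.distrib sum_subtractf sum_distrib_right[symmetric] t_sum[OF j a])
        (simp add: s_def mult.commute)
    also have "\<dots> \<le> ln (?m / ?e)" using se by simp
    finally show ?thesis using ep by simp
  qed simp
  have entA': "adj_entropy b ns (\<mu> \<circ> \<phi>) * ln b = (\<Sum>i<length ns. \<Sum>p<ns ! i. f i p * ln (ns ! i / f i p))"
    unfolding entA sum_distrib_right
    using f0 ns b by (intro sum.cong refl entropy_term_ln) auto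
  have entB': "adj_entropy b ms \<mu> * ln b = (\<Sum>j<length ms. \<Sum>a<ms ! j. e j a * ln (ms ! j / e j a))"
    unfolding entB sum_distrib_right
    using e0 ms b by (intro sum.cong refl entropy_term_ln) auto
  have "(\<Sum>i<length ns. \<Sum>p<ns ! i. f i p * ln (ns ! i / f i p)) =
      (\<Sum>i<length ns. \<Sum>p<ns ! i. \<Sum>j<length ms. \<Sum>a<ms ! j. e j a * (t j a i p * ln (ns ! i / f i p)))"
  proof (intro sum.cong refl)
    fix i p assume "i \<in> {..<length ns}" "p \<in> {..<ns ! i}"
    hence ip: "i < length ns" "p < ns ! i" by auto
    show "f i p * ln (ns ! i / f i p) = (\<Sum>j<length ms. \<Sum>a<ms ! j. e j a * (t j a i p * ln (ns ! i / f i p)))"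
      by (subst (1) f_eq[OF ip]) (simp only: sum_distrib_right mult.assoc)
  qed
  also have "\<dots> = (\<Sum>j<length ms. \<Sum>a<ms ! j. e j a * (\<Sum>i<length ns. \<Sum>p<ns ! i. t j a i p * ln (ns ! i / f i p)))"
    unfolding sum_distrib_left by (rule sum_swap_pairs)
  also have "\<dots> \<le> (\<Sum>j<length ms. \<Sum>a<ms ! j. e j a * ln (ms ! j / e j a))"
    using key by (intro sum_mono) auto
  finally have "adj_entropy b ns (\<mu> \<circ> \<phi>) * ln b \<le> adj_entropy b ms \<mu> * ln b"
    unfolding entA' entB' .
  thus ?thesis using b by simp
qed

section \<open>The characterization of homomorphisms\<close>

theorem theorem1p1:
  fixes ns ms :: "nat list" and \<phi> :: "complex mat list \<Rightarrow> complex mat list" and b :: real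
  assumes "fd_cstar ns" and "fd_cstar ms"
    and "fd_completely_positive ns ms \<phi>" and "fd_unital ns ms \<phi>"
    and "1 < b"
  shows "fd_hom ns ms \<phi> \<longleftrightarrow>
    (\<forall>k>0. \<forall>\<mu>. fd_state (amp_sizes k ms) \<mu> \<longrightarrow>
       adj_entropy b (amp_sizes k ns) (\<mu> \<circ> amp_map k ns ms \<phi>) \<le> adj_entropy b (amp_sizes k ms) \<mu>)"
proof
  assume hom: "fd_hom ns ms \<phi>"
  show "\<forall>k>0. \<forall>\<mu>. fd_state (amp_sizes k ms) \<mu> \<longrightarrow>
       adj_entropy b (amp_sizes k ns) (\<mu> \<circ> amp_map k ns ms \<phi>) \<le> adj_entropy b (amp_sizes k ms) \<mu>"
  proof (intro allI impI)
    fix k \<mu> assume k: "0 < k" and st: "fd_state (amp_sizes k ms) \<mu>"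
    show "adj_entropy b (amp_sizes k ns) (\<mu> \<circ> amp_map k ns ms \<phi>) \<le> adj_entropy b (amp_sizes k ms) \<mu>"
    proof (rule hom_entropy_le)
      show "fd_hom (amp_sizes k ns) (amp_sizes k ms) (amp_map k ns ms \<phi>)" by (rule amp_map_hom[OF hom])
      show "fd_unital (amp_sizes k ns) (amp_sizes k ms) (amp_map k ns ms \<phi>)"
        by (rule amp_map_unital[OF cp_linear[OF assms(3)] assms(4)])
      show "fd_state (amp_sizes k ns) (\<mu> \<circ> amp_map k ns ms \<phi>)"
        by (rule fd_state_amp[OF assms(3,4) k st])
    qed (use assms k st in \<open>auto simp: fd_cstar_def\<close>)
  qed
next
  assume ent: "\<forall>k>0. \<forall>\<mu>. fd_state (amp_sizes k ms) \<mu> \<longrightarrow>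
       adj_entropy b (amp_sizes k ns) (\<mu> \<circ> amp_map k ns ms \<phi>) \<le> adj_entropy b (amp_sizes k ms) \<mu>"
  show "fd_hom ns ms \<phi>"
    using ent by (intro cp_hom_if_choi_square[OF assms(3,4)] entropy_condition_imp_choi_square[OF assms]) auto
qed

end
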